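(* Let $\theta:\mathbb R^n\to[-\infty,+\infty]$ be a (proper) symmetric polyhedral function and let $g=\theta\circ\lambda:\mathbf S^n\to[-\infty,+\infty]$. Let $(X,Y)\in\mathrm{gph}\,\partial g$ and $P\in\mathbf O^n(X)\cap\mathbf O^n(Y)$. Assume that $K(X,Y)\ne\varnothing$. Then the minimal element in $\mathrm{quad}\,g(X,Y)$ is $\Upsilon_{X,Y}+\delta_{\mathrm{aff}\,\mathcal C_g(X,Y)}$; that is, this function belongs to $\mathrm{quad}\,g(X,Y)$ and $q(H)\ge\Upsilon_{X,Y}(H)+\delta_{\mathrm{aff}\,\mathcal C_g(X,Y)}(H)$ for all $q\in\mathrm{quad}\,g(X,Y)$ and all $H\in\mathbf S^n$, where $$\Upsilon_{X,Y}(H)=2\sum_{1\le l<l'\le r}\ \sum_{i\in\alpha^l}\ \sum_{j\in\alpha^{l'}}\frac{\lambda_i(Y)-\lambda_j(Y)}{\lambda_i(X)-\lambda_j(X)}\,(P^\top HP)_{ij}^2 .$$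
   Context: $\mathbf S^n$ is the space of real symmetric $n\times n$ matrices with the Frobenius inner product; $\lambda(X)=(\lambda_1(X),\dots,\lambda_n(X))$ is the vector of eigenvalues of $X$ in nonincreasing order. $\mathbf O^n(X)$ is the set of orthogonal $P$ with $X=P\,\mathrm{Diag}(\lambda(X))P^\top$. $\mu_1>\dots>\mu_r$ are the distinct eigenvalues of $X$ and $\alpha^l=\{i:\lambda_i(X)=\mu_l\}$. $\delta_C$ is the indicator function and $\mathrm{aff}\,C$ the affine hull of $C$. "Polyhedral" means the epigraph is a polyhedral convex set; "symmetric" means $\theta(Ux)=\theta(x)$ for all permutation matrices $U$. Such $g$ is convex; $\partial g$ is the convex subdifferential. Representation of $\theta$: $\theta=\theta_1+\theta_2$ with $\theta_1(x)=\max_{1\le\nu\le p}\{\langle a^\nu,x\rangle-c_\nu\}$ and $\theta_2=\delta_{\mathrm{dom}\,\theta}$, $\mathrm{dom}\,\theta=\{x:\max_{1\le\mu\le m}\{\langle b^\mu,x\rangle-d_\mu\}\le0\}$, with each $(b^\mu,d_\mu)\ne(0,0)$. (The case $\theta_1=0$ is covered by $p=1,(a^1,c_1)=(0,0)$; the case $\theta_2=0$ by $m=1,(b^1,d_1)=(0,1)$.) For $x\in\mathrm{dom}\,\theta$: $\iota_1(x)$ is the set of $\nu$ attaining the maximum in $\theta_1(x)$, and $\iota_2(x)=\{\mu:\langle b^\mu,x\rangle=d_\mu\}$. For $y\in\partial\theta(x)$, a representation of $y$ is $y=\sum_{\nu\in\iota_1(x)}u_\nu a^\nu+\sum_{\mu\in\iota_2(x)}v_\mu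 b^\mu$ with $u_\nu\ge0$, $\sum u_\nu=1$, $v_\mu\ge0$; $\eta_1(x,y)$ (resp. $\eta_2(x,y)$) is the set of $\nu\in\iota_1(x)$ (resp. $\mu\in\iota_2(x)$) for which some representation of $y$ has $u_\nu>0$ (resp. $v_\mu>0$). Write $\iota_i=\iota_i(\lambda(X))$, $\eta_i=\eta_i(\lambda(X),\lambda(Y))$. Then $K(X,Y)$ is the set of $d\in\mathbb R^n$ with $\langle d,a^{\nu'}-a^\nu\rangle=0$ for $\nu,\nu'\in\eta_1$; $\langle d,b^\mu\rangle=0$ for $\mu\in\eta_2$; $\langle d,a^{\nu'}-a^\nu\rangle<0$ for $\nu'\in\iota_1\setminus\eta_1,\ \nu\in\eta_1$; and $\langle d,b^\mu\rangle<0$ for $\mu\in\iota_2\setminus\eta_2$. Critical cone: $\mathcal C_g(X,Y)=\{H\in\mathbf S^n:\langle Y,H\rangle=\mathrm dg(X)(H)\}$, where $\mathrm dg(X)(H)=\liminf_{t\searrow0,H'\to H}\frac{g(X+tH')-g(X)}{t}$. Second subderivative: $\mathrm d^2g(X,Y)(H)=\liminf_{t\searrow0,H'\to H}\frac{g(X+tH')-g(X)-t\langle Y,H'\rangle}{t^2/2}$. GQF: a proper function $\varphi$ on a Euclidean space is a generalized quadratic form if $\mathrm{dom}\,\varphi$ is a linear subspace and $\varphi(x)=\langle Lx,x\rangle$ on $\mathrm{dom}\,\varphi$ for some linear operator $L$ on $\mathrm{dom}\,\varphi$ satisfying $\langle Lx,y\rangle=\langle x,Ly\rangle$. Quadratic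 bundle: $\mathrm{quad}\,g(X,Y)$ is the set of all GQFs $q$ on $\mathbf S^n$ for which there is a sequence $(X^k,Y^k)\in\mathrm{gph}\,\partial g$ converging to $(X,Y)$, with each $\mathrm d^2g(X^k,Y^k)$ a GQF, such that $\mathrm d^2g(X^k,Y^k)$ epi-converges to $q$ (the epigraphs converge in the Painlevé–Kuratowski sense). *)

theory Defs
  imports "HOL-Analysis.Analysis"
begin

section \<open>Extended-real-valued functions on a subspace\<close>

text \<open>
  A function on a Euclidean space \<open>E\<close> is represented by a total function on an ambient Euclidean
  space together with the carrier set \<open>E\<close>; its values outside \<open>E\<close> are never inspected.
  The carriers of interest are \<open>UNIV\<close> in \<open>real ^ 'n\<close> and the symmetric matrices in
  \<open>real ^ 'n ^ 'n\<close>, whose library inner product is the Frobenius inner product.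
\<close>

definition edom :: "'a set \<Rightarrow> ('a \<Rightarrow> ereal) \<Rightarrow> 'a set" where
  "edom E f = {x \<in> E. f x < \<infinity>}"

definition proper_on :: "'a set \<Rightarrow> ('a \<Rightarrow> ereal) \<Rightarrow> bool" where
  "proper_on E f \<longleftrightarrow> (\<forall>x\<in>E. f x \<noteq> - \<infinity>) \<and> edom E f \<noteq> {}"

definition epi :: "'a set \<Rightarrow> ('a \<Rightarrow> ereal) \<Rightarrow> ('a \<times> real) set" where
  "epi E f = {(x, r). x \<in> E \<and> f x \<le> ereal r}"

definition indic :: "'a set \<Rightarrow> 'a \<Rightarrow> ereal" where
  "indic C x = (if x \<in> C then 0 else \<infinity>)"

definition subdiff :: "'a::euclidean_space set \<Rightarrow> ('a \<Rightarrow> ereal) \<Rightarrow> 'a \<Rightarrow> 'a set" where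
  "subdiff E f x = {y \<in> E. x \<in> E \<and> \<bar>f x\<bar> \<noteq> \<infinity> \<and> (\<forall>z\<in>E. f x + ereal (y \<bullet> (z - x)) \<le> f z)}"

definition gph_subdiff :: "'a::euclidean_space set \<Rightarrow> ('a \<Rightarrow> ereal) \<Rightarrow> ('a \<times> 'a) set" where
  "gph_subdiff E f = {(x, y). y \<in> subdiff E f x}"

text \<open>
  The filter of \<open>(t, h')\<close> with \<open>t\<close> decreasing to \<open>0\<close> and \<open>h'\<close> tending to \<open>h\<close> in \<open>E\<close>. As usual in
  variational analysis \<open>h' = h\<close> is allowed, so the punctured filter \<open>at h within E\<close> would be wrong.
\<close>

definition dir_filter :: "'a::euclidean_space set \<Rightarrow> 'a \<Rightarrow> (real \<times> 'a) filter" where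
  "dir_filter E h = at_right 0 \<times>\<^sub>F inf (nhds h) (principal E)"

definition subderiv :: "'a::euclidean_space set \<Rightarrow> ('a \<Rightarrow> ereal) \<Rightarrow> 'a \<Rightarrow> 'a \<Rightarrow> ereal" where
  "subderiv E f x h =
     Liminf (dir_filter E h) (\<lambda>(t, h'). (f (x + t *\<^sub>R h') - f x) / ereal t)"

definition subderiv2 :: "'a::euclidean_space set \<Rightarrow> ('a \<Rightarrow> ereal) \<Rightarrow> 'a \<Rightarrow> 'a \<Rightarrow> 'a \<Rightarrow> ereal" where
  "subderiv2 E f x y h =
     Liminf (dir_filter E h)
       (\<lambda>(t, h'). (f (x + t *\<^sub>R h') - f x - ereal (t * (y \<bullet> h'))) / ereal (t\<^sup>2 / 2))"

definition crit_cone :: "'a::euclidean_space set \<Rightarrow> ('a \<Rightarrow> ereal) \<Rightarrow> 'a \<Rightarrow> 'a \<Rightarrow> 'a set" where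
  "crit_cone E f x y = {h \<in> E. ereal (y \<bullet> h) = subderiv E f x h}"

definition gqf :: "'a::euclidean_space set \<Rightarrow> ('a \<Rightarrow> ereal) \<Rightarrow> bool" where
  "gqf E q \<longleftrightarrow> proper_on E q \<and> subspace (edom E q) \<and>
     (\<exists>L. (\<forall>x \<in> edom E q. L x \<in> edom E q) \<and>
          (\<forall>x \<in> edom E q. \<forall>z \<in> edom E q. L (x + z) = L x + L z) \<and>
          (\<forall>c. \<forall>x \<in> edom E q. L (c *\<^sub>R x) = c *\<^sub>R L x) \<and>
          (\<forall>x \<in> edom E q. \<forall>z \<in> edom E q. L x \<bullet> z = x \<bullet> L z) \<and>
          (\<forall>x \<in> edom E q. q x = ereal (L x \<bullet> x)))"

definition inner_limit :: "(nat \<Rightarrow> 'a::topological_space set) \<Rightarrow> 'a set" where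
  "inner_limit C = {x. \<exists>s. (\<forall>\<^sub>F k in sequentially. s k \<in> C k) \<and> s \<longlonglongrightarrow> x}"

definition outer_limit :: "(nat \<Rightarrow> 'a::topological_space set) \<Rightarrow> 'a set" where
  "outer_limit C =
     {x. \<exists>(r :: nat \<Rightarrow> nat) s. strict_mono r \<and> (\<forall>k. s k \<in> C (r k)) \<and> s \<longlonglongrightarrow> x}"

definition pk_converges :: "(nat \<Rightarrow> 'a::topological_space set) \<Rightarrow> 'a set \<Rightarrow> bool" where
  "pk_converges C D \<longleftrightarrow> inner_limit C = D \<and> outer_limit C = D"

definition epi_converges ::
  "'a::euclidean_space set \<Rightarrow> (nat \<Rightarrow> 'a \<Rightarrow> ereal) \<Rightarrow> ('a \<Rightarrow> ereal) \<Rightarrow> bool" where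
  "epi_converges E f q \<longleftrightarrow> pk_converges (\<lambda>k. epi E (f k)) (epi E q)"

definition quad ::
  "'a::euclidean_space set \<Rightarrow> ('a \<Rightarrow> ereal) \<Rightarrow> 'a \<Rightarrow> 'a \<Rightarrow> ('a \<Rightarrow> ereal) set" where
  "quad E f x y =
     {q. gqf E q \<and>
         (\<exists>xs ys. (\<forall>k. (xs k, ys k) \<in> gph_subdiff E f) \<and>
                  (\<lambda>k. (xs k, ys k)) \<longlonglongrightarrow> (x, y) \<and>
                  (\<forall>k. gqf E (subderiv2 E f (xs k) (ys k))) \<and>
                  epi_converges E (\<lambda>k. subderiv2 E f (xs k) (ys k)) q)}"


section \<open>Symmetric matrices and their eigenvalues\<close>

type_synonym 'n rvec = "(real, 'n) vec"
type_synonym 'n rmat = "((real, 'n) vec, 'n) vec"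

definition SymMat :: "('n::finite) rmat set" where
  "SymMat = {X. transpose X = X}"

definition Diag :: "('n::finite) rvec \<Rightarrow> 'n rmat" where
  "Diag v = (\<chi> i j. if i = j then v $ i else 0)"

text \<open>
  The eigenvalues, repeated according to their multiplicity as roots of the characteristic polynomial,
  in nonincreasing order along the linearly ordered index type. The description is meaningful for
  symmetric matrices, all of whose eigenvalues are real.
\<close>

definition eigvals :: "('n::{finite,linorder}) rmat \<Rightarrow> 'n rvec" where
  "eigvals X = (THE v. (\<forall>i j. i \<le> j \<longrightarrow> v $ j \<le> v $ i) \<and>
                       (\<forall>t. det (mat t - X) = (\<Prod>i\<in>UNIV. t - v $ i)))"

definition orth_diag :: "('n::{finite,linorder}) rmat \<Rightarrow> 'n rmat set" where
  "orth_diag X = {P. orthogonal_matrix P \<and> X = P ** Diag (eigvals X) ** transpose P}"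

definition distinct_eigvals :: "('n::{finite,linorder}) rmat \<Rightarrow> real set" where
  "distinct_eigvals X = {eigvals X $ i | i. True}"

definition eig_block :: "('n::{finite,linorder}) rmat \<Rightarrow> real \<Rightarrow> 'n set" where
  "eig_block X \<mu> = {i. eigvals X $ i = \<mu>}"

text \<open>
  The distinct eigenvalues are strictly decreasing in their label, so the pairs of labels
  \<open>l < l'\<close> correspond to the pairs of distinct eigenvalues \<open>\<mu> > \<mu>'\<close>.
\<close>

definition Upsilon :: "('n::{finite,linorder}) rmat \<Rightarrow> 'n rmat \<Rightarrow> 'n rmat \<Rightarrow> 'n rmat \<Rightarrow> real" where
  "Upsilon P X Y H =
     2 * (\<Sum>(\<mu>, \<mu>') \<in> {(\<mu>, \<mu>'). \<mu> \<in> distinct_eigvals X \<and> \<mu>' \<in> distinct_eigvals X \<and> \<mu> > \<mu>'}.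
            \<Sum>i \<in> eig_block X \<mu>. \<Sum>j \<in> eig_block X \<mu>'.
              (eigvals Y $ i - eigvals Y $ j) / (eigvals X $ i - eigvals X $ j)
                * ((transpose P ** H ** P) $ i $ j)\<^sup>2)"


section \<open>Symmetric polyhedral functions\<close>

definition polyhedral_fun :: "('a::euclidean_space \<Rightarrow> ereal) \<Rightarrow> bool" where
  "polyhedral_fun \<theta> \<longleftrightarrow> polyhedron (epi UNIV \<theta>)"

definition symmetric_fun :: "(('n::finite) rvec \<Rightarrow> ereal) \<Rightarrow> bool" where
  "symmetric_fun \<theta> \<longleftrightarrow> (\<forall>\<pi> x. \<pi> permutes UNIV \<longrightarrow> \<theta> (\<chi> i. x $ \<pi> i) = \<theta> x)"

definition max_affine ::
  "(nat \<Rightarrow> 'a::euclidean_space) \<Rightarrow> (nat \<Rightarrow> real) \<Rightarrow> nat \<Rightarrow> 'a \<Rightarrow> real" where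
  "max_affine a c p x = Max ((\<lambda>\<nu>. a \<nu> \<bullet> x - c \<nu>) ` {1..p})"

definition represents ::
  "('a::euclidean_space \<Rightarrow> ereal) \<Rightarrow> (nat \<Rightarrow> 'a) \<Rightarrow> (nat \<Rightarrow> real) \<Rightarrow> nat \<Rightarrow>
   (nat \<Rightarrow> 'a) \<Rightarrow> (nat \<Rightarrow> real) \<Rightarrow> nat \<Rightarrow> bool" where
  "represents \<theta> a c p b d m \<longleftrightarrow>
     1 \<le> p \<and> 1 \<le> m \<and> (\<forall>\<mu> \<in> {1..m}. (b \<mu>, d \<mu>) \<noteq> (0, 0)) \<and>
     edom UNIV \<theta> = {x. max_affine b d m x \<le> 0} \<and>
     (\<forall>x. \<theta> x = ereal (max_affine a c p x) + indic (edom UNIV \<theta>) x)"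

definition iota1 ::
  "(nat \<Rightarrow> 'a::euclidean_space) \<Rightarrow> (nat \<Rightarrow> real) \<Rightarrow> nat \<Rightarrow> 'a \<Rightarrow> nat set" where
  "iota1 a c p x = {\<nu> \<in> {1..p}. a \<nu> \<bullet> x - c \<nu> = max_affine a c p x}"

definition iota2 ::
  "(nat \<Rightarrow> 'a::euclidean_space) \<Rightarrow> (nat \<Rightarrow> real) \<Rightarrow> nat \<Rightarrow> 'a \<Rightarrow> nat set" where
  "iota2 b d m x = {\<mu> \<in> {1..m}. b \<mu> \<bullet> x = d \<mu>}"

definition is_rep ::
  "(nat \<Rightarrow> 'a::euclidean_space) \<Rightarrow> (nat \<Rightarrow> real) \<Rightarrow> nat \<Rightarrow>
   (nat \<Rightarrow> 'a) \<Rightarrow> (nat \<Rightarrow> real) \<Rightarrow> nat \<Rightarrow> 'a \<Rightarrow> 'a \<Rightarrow> (nat \<Rightarrow> real) \<Rightarrow> (nat \<Rightarrow> real) \<Rightarrow> bool" where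
  "is_rep a c p b d m x y u v \<longleftrightarrow>
     (\<forall>\<nu> \<in> iota1 a c p x. 0 \<le> u \<nu>) \<and> (\<Sum>\<nu> \<in> iota1 a c p x. u \<nu>) = 1 \<and>
     (\<forall>\<mu> \<in> iota2 b d m x. 0 \<le> v \<mu>) \<and>
     y = (\<Sum>\<nu> \<in> iota1 a c p x. u \<nu> *\<^sub>R a \<nu>) + (\<Sum>\<mu> \<in> iota2 b d m x. v \<mu> *\<^sub>R b \<mu>)"

definition eta1 ::
  "(nat \<Rightarrow> 'a::euclidean_space) \<Rightarrow> (nat \<Rightarrow> real) \<Rightarrow> nat \<Rightarrow>
   (nat \<Rightarrow> 'a) \<Rightarrow> (nat \<Rightarrow> real) \<Rightarrow> nat \<Rightarrow> 'a \<Rightarrow> 'a \<Rightarrow> nat set" where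
  "eta1 a c p b d m x y =
     {\<nu> \<in> iota1 a c p x. \<exists>u v. is_rep a c p b d m x y u v \<and> u \<nu> > 0}"

definition eta2 ::
  "(nat \<Rightarrow> 'a::euclidean_space) \<Rightarrow> (nat \<Rightarrow> real) \<Rightarrow> nat \<Rightarrow>
   (nat \<Rightarrow> 'a) \<Rightarrow> (nat \<Rightarrow> real) \<Rightarrow> nat \<Rightarrow> 'a \<Rightarrow> 'a \<Rightarrow> nat set" where
  "eta2 a c p b d m x y =
     {\<mu> \<in> iota2 b d m x. \<exists>u v. is_rep a c p b d m x y u v \<and> v \<mu> > 0}"

definition K_vec ::
  "(nat \<Rightarrow> 'a::euclidean_space) \<Rightarrow> (nat \<Rightarrow> real) \<Rightarrow> nat \<Rightarrow>
   (nat \<Rightarrow> 'a) \<Rightarrow> (nat \<Rightarrow> real) \<Rightarrow> nat \<Rightarrow> 'a \<Rightarrow> 'a \<Rightarrow> 'a set" where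
  "K_vec a c p b d m x y =
     (let \<iota>\<^sub>1 = iota1 a c p x; \<iota>\<^sub>2 = iota2 b d m x;
          \<eta>\<^sub>1 = eta1 a c p b d m x y; \<eta>\<^sub>2 = eta2 a c p b d m x y
      in {w. (\<forall>\<nu> \<in> \<eta>\<^sub>1. \<forall>\<nu>' \<in> \<eta>\<^sub>1. w \<bullet> (a \<nu>' - a \<nu>) = 0) \<and>
             (\<forall>\<mu> \<in> \<eta>\<^sub>2. w \<bullet> b \<mu> = 0) \<and>
             (\<forall>\<nu>' \<in> \<iota>\<^sub>1 - \<eta>\<^sub>1. \<forall>\<nu> \<in> \<eta>\<^sub>1. w \<bullet> (a \<nu>' - a \<nu>) < 0) \<and>
             (\<forall>\<mu> \<in> \<iota>\<^sub>2 - \<eta>\<^sub>2. w \<bullet> b \<mu> < 0)})"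

definition K_set ::
  "(nat \<Rightarrow> ('n::{finite,linorder}) rvec) \<Rightarrow> (nat \<Rightarrow> real) \<Rightarrow> nat \<Rightarrow> (nat \<Rightarrow> 'n rvec) \<Rightarrow> (nat \<Rightarrow> real) \<Rightarrow> nat \<Rightarrow>
   'n rmat \<Rightarrow> 'n rmat \<Rightarrow> 'n rvec set" where
  "K_set a c p b d m X Y = K_vec a c p b d m (eigvals X) (eigvals Y)"

end

theory Submission
  imports Defs "HOL-Computational_Algebra.Polynomial"
begin

text \<open>The obstacle is that \<open>eigvals\<close> is not differentiable where eigenvalues
  coincide, so \<open>g\<close> has no direct second order expansion. Neither bound on the second
  subderivative expands eigenvalues: the lower one uses minorants affine in the matrix, the upper
  one a curve whose eigenvalues are known exactly up to order. With \<open>N = rot P H\<close>, one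
  skew generator \<open>A\<close> with entries \<open>- N_ij / (x_i - x_j)\<close> serves both. It
  maximizes the lower bound, the sum over \<open>i, j\<close> with \<open>x_i \<noteq> x_j\<close>
  of \<open>- A_ij^2 (x_i - x_j) (y_i - y_j) - 2 A_ij (y_i - y_j) N_ij\<close>, and it solves the
  first order equation that the commutator of \<open>A\<close> and \<open>Diag x\<close> equals
  \<open>N\<close> off the blocks of equal \<open>x\<close>. Polyhedrality enters through the
  finiteness of the set of pieces. Along a direction of the cone \<open>\<theta>\<close> is exactly
  affine for small positive \<open>t\<close>, so it adds no second order term. And a sequence of
  base points has a subsequence with constant active indices; its points share one subdifferential,
  so the limit \<open>y\<close> is a subgradient at all of them, which ties their cones to the cone
  at \<open>x\<close>.\<close>

text \<open>
  Write \<open>x\<close>, \<open>y\<close> for the ordered eigenvalues of \<open>X\<close>, \<open>Y\<close>. Subgradients of \<open>g\<close> at \<open>X\<close> are simultaneously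
  diagonalizable with \<open>X\<close>, and \<open>g\<close> is minorized by the affine functions with slopes
  \<open>U Diag(s) U\<^sup>T\<close> for orthogonal \<open>U\<close> and subgradients \<open>s\<close> of \<open>\<theta>\<close>. Letting \<open>U\<close> run along a Cayley curve
  through \<open>P\<close> bounds the second subderivative below by \<open>\<Upsilon>\<close>; moving \<open>X\<close> along such a curve, with
  the diagonal moving in a direction in which \<open>\<theta>\<close> is affine, attains the bound. The directions of
  finite value are described by the cone of all \<open>w\<close> with \<open>s \<bullet> w \<le> y \<bullet> w\<close> for every subgradient \<open>s\<close>, the
  critical cone of \<open>\<theta>\<close>; its span \<open>W\<close> determines \<open>aff C\<^sub>g(X,Y)\<close> entrywise.
  Perturbing \<open>x\<close> in a relatively interior direction of this cone makes the cone equal to \<open>W\<close>, so the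
  second subderivatives become generalized quadratic forms, and they epi-converge to the claimed one.
  Conversely, along any admissible sequence the linearity spaces of the perturbed cones lie in \<open>W\<close>, and
  the terms with collapsing eigenvalues are nonnegative and blow up unless their entries vanish.
  Relatively interior directions play the role of \<open>K(X,Y)\<close>.
\<close>

section \<open>Conjugation of matrices\<close>

lemma bounded_bilinear_matrix_mult:
  "bounded_bilinear ((**) :: real^'n^'m \<Rightarrow> real^'p^'n \<Rightarrow> real^'p^'m)"
proof -
  have "bilinear ((**) :: real^'n^'m \<Rightarrow> real^'p^'n \<Rightarrow> real^'p^'m)"
    unfolding bilinear_def
    by (auto intro!: linearI simp: matrix_matrix_mult_def vec_eq_iff sum.distrib sum_distrib_left algebra_simps)
  then show ?thesis by (simp add: bilinear_conv_bounded_bilinear)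
qed

interpretation matrix_mult: bounded_bilinear "(**) :: real^'n^'m \<Rightarrow> real^'p^'n \<Rightarrow> real^'p^'m"
  by (rule bounded_bilinear_matrix_mult)

lemma linear_transpose: "linear (transpose :: real^'n^'m \<Rightarrow> real^'m^'n)"
  by (auto intro!: linearI simp: transpose_def vec_eq_iff)

lemma bounded_linear_transpose: "bounded_linear (transpose :: real^'n^'m \<Rightarrow> real^'m^'n)"
  using linear_transpose by (simp add: linear_conv_bounded_linear)

lemmas transpose_add = linear_add[OF linear_transpose]
  and transpose_scaleR = linear_scale[OF linear_transpose]
  and transpose_zero = linear_0[OF linear_transpose]
  and tendsto_transpose = bounded_linear.tendsto[OF bounded_linear_transpose]
  and continuous_on_transpose = bounded_linear.continuous_on[OF bounded_linear_transpose]

section \<open>Adjoints for the Frobenius inner product and conjugation\<close>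

lemma inner_matrix_mult_left: "(A ** B) \<bullet> C = B \<bullet> (transpose A ** C)"
  for A :: "real^'n^'m"
proof -
  have "(A ** B) \<bullet> C = (\<Sum>i\<in>UNIV. \<Sum>j\<in>UNIV. \<Sum>k\<in>UNIV. A $ i $ k * B $ k $ j * C $ i $ j)"
    by (simp add: inner_vec_def matrix_matrix_mult_def sum_distrib_right)
  also have "\<dots> = (\<Sum>i\<in>UNIV. \<Sum>k\<in>UNIV. \<Sum>j\<in>UNIV. A $ i $ k * B $ k $ j * C $ i $ j)"
    by (rule sum.cong[OF refl], rule sum.swap)
  also have "\<dots> = (\<Sum>k\<in>UNIV. \<Sum>i\<in>UNIV. \<Sum>j\<in>UNIV. A $ i $ k * B $ k $ j * C $ i $ j)"
    by (rule sum.swap)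
  also have "\<dots> = (\<Sum>k\<in>UNIV. \<Sum>j\<in>UNIV. \<Sum>i\<in>UNIV. A $ i $ k * B $ k $ j * C $ i $ j)"
    by (rule sum.cong[OF refl], rule sum.swap)
  also have "\<dots> = B \<bullet> (transpose A ** C)"
    by (simp add: inner_vec_def matrix_matrix_mult_def transpose_def sum_distrib_left mult_ac)
  finally show ?thesis .
qed

lemma inner_transpose: "transpose A \<bullet> transpose B = A \<bullet> (B :: real^'n^'m)"
  unfolding inner_vec_def transpose_def by (simp, rule sum.swap)

lemma inner_matrix_mult_right: "(A ** B) \<bullet> C = A \<bullet> (C ** transpose B)"
  for A :: "real^'n^'m"
proof -
  have "(A ** B) \<bullet> C = (transpose B ** transpose A) \<bullet> transpose C"
    by (metis inner_transpose matrix_transpose_mul)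
  also have "\<dots> = transpose A \<bullet> transpose (C ** transpose B)"
    by (simp add: inner_matrix_mult_left matrix_transpose_mul)
  finally show ?thesis by (simp add: inner_transpose)
qed

text \<open>The coordinates of \<open>H\<close> in the basis formed by the columns of
  \<open>P\<close>; for orthogonal \<open>P\<close>, \<open>rot (transpose P)\<close> leads back. By
  \<open>rot_rot\<close>, refining a diagonalizing basis multiplies \<open>P\<close> on the
  right.\<close>

definition rot :: "real^'n^'n \<Rightarrow> real^'n^'n \<Rightarrow> real^'n^'n" where
  "rot P H = transpose P ** H ** P"

lemma rot_rot: "rot Q (rot P H) = rot (P ** Q) H"
  by (simp add: rot_def matrix_transpose_mul matrix_mul_assoc)

lemma rot_mat_1 [simp]: "rot (mat 1) H = H"
  by (simp add: rot_def)

lemma orthogonal_matrix_cancel: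
  assumes "orthogonal_matrix P"
  shows "transpose P ** P = mat 1" "P ** transpose P = mat 1"
  using assms by (auto simp: orthogonal_matrix_def)

lemma rot_cancel [simp]:
  assumes "orthogonal_matrix P"
  shows "rot P (rot (transpose P) H) = H" "rot (transpose P) (rot P H) = H"
  using assms by (simp_all add: rot_rot orthogonal_matrix_cancel)

lemma inner_rot: "rot P A \<bullet> B = A \<bullet> rot (transpose P) B"
proof -
  have "rot P A \<bullet> B = (transpose P ** A) \<bullet> (B ** transpose P)"
    unfolding rot_def by (rule inner_matrix_mult_right)
  also have "\<dots> = A \<bullet> rot (transpose P) B"
    by (simp add: inner_matrix_mult_left rot_def matrix_mul_assoc)
  finally show ?thesis .
qed

lemma inner_rot_rot: "orthogonal_matrix P \<Longrightarrow> rot P A \<bullet> rot P B = A \<bullet> B"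
  by (simp add: inner_rot)

lemma linear_rot: "linear (rot P)"
  by (auto intro!: linearI simp: rot_def matrix_mult.add_left matrix_mult.add_right
      matrix_mult.scaleR_left matrix_mult.scaleR_right)

lemma bounded_linear_rot: "bounded_linear (rot P)"
  using linear_rot by (simp add: linear_conv_bounded_linear)

lemmas rot_add = linear_add[OF linear_rot]
  and rot_diff = linear_diff[OF linear_rot]
  and rot_scaleR = linear_scale[OF linear_rot]
  and rot_zero = linear_0[OF linear_rot]
  and tendsto_rot_right = bounded_linear.tendsto[OF bounded_linear_rot]

lemma tendsto_rot [tendsto_intros]:
  assumes "(P \<longlongrightarrow> P0) F" "(H \<longlongrightarrow> H0) F"
  shows "((\<lambda>k. rot (P k) (H k)) \<longlongrightarrow> rot P0 H0) F"
  unfolding rot_def using assms by (intro matrix_mult.tendsto tendsto_transpose)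

lemma transpose_rot: "transpose (rot P H) = rot P (transpose H)"
  by (simp add: rot_def matrix_transpose_mul matrix_mul_assoc)

lemma subspace_SymMat: "subspace SymMat"
  by (auto simp: subspace_def SymMat_def transpose_add transpose_scaleR transpose_zero)

lemma rot_SymMat [simp]: "H \<in> SymMat \<Longrightarrow> rot P H \<in> SymMat"
  by (simp add: SymMat_def transpose_rot)

lemma SymMat_nth: "H \<in> SymMat \<Longrightarrow> H $ i $ j = H $ j $ i"
  by (metis (mono_tags, lifting) SymMat_def mem_Collect_eq transpose_def vec_lambda_beta)

lemma SymMatI: "(\<And>i j. H $ i $ j = H $ j $ i) \<Longrightarrow> H \<in> SymMat"
  by (simp add: SymMat_def transpose_def vec_eq_iff)

section \<open>Diagonal matrices and diagonal vectors\<close>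

lemma Diag_nth: "Diag v $ i $ j = (if i = j then v $ i else 0)"
  by (simp add: Diag_def)

lemma Diag_SymMat [simp]: "Diag v \<in> SymMat"
  by (rule SymMatI) (simp add: Diag_nth)

lemma linear_Diag: "linear Diag"
  by (auto intro!: linearI simp: Diag_def vec_eq_iff)

lemma bounded_linear_Diag: "bounded_linear Diag"
  using linear_Diag by (simp add: linear_conv_bounded_linear)

lemmas Diag_add = linear_add[OF linear_Diag]
  and Diag_diff = linear_diff[OF linear_Diag]
  and Diag_scaleR = linear_scale[OF linear_Diag]
  and Diag_zero = linear_0[OF linear_Diag]
  and tendsto_Diag = bounded_linear.tendsto[OF bounded_linear_Diag]

definition diagv :: "real^'n^'n \<Rightarrow> real^'n" where
  "diagv M = (\<chi> i. M $ i $ i)"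

lemma diagv_nth [simp]: "diagv M $ i = M $ i $ i"
  by (simp add: diagv_def)

lemma linear_diagv: "linear diagv"
  by (auto intro!: linearI simp: vec_eq_iff)

lemma bounded_linear_diagv: "bounded_linear diagv"
  using linear_diagv by (simp add: linear_conv_bounded_linear)

lemmas diagv_add = linear_add[OF linear_diagv]
  and diagv_diff = linear_diff[OF linear_diagv]
  and diagv_scaleR = linear_scale[OF linear_diagv]
  and diagv_zero = linear_0[OF linear_diagv]
  and tendsto_diagv = bounded_linear.tendsto[OF bounded_linear_diagv]
  and continuous_on_diagv = bounded_linear.continuous_on[OF bounded_linear_diagv]

lemma inner_Diag: "Diag s \<bullet> M = s \<bullet> diagv M"
  by (simp add: inner_vec_def Diag_nth if_distrib[of "\<lambda>x. x * _"] sum.delta cong: if_cong)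

lemma diagv_Diag [simp]: "diagv (Diag v) = v"
  by (simp add: vec_eq_iff Diag_nth)

lemma Diag_mult_nth: "(Diag v ** M) $ i $ j = v $ i * M $ i $ j"
  by (simp add: matrix_matrix_mult_def Diag_nth if_distrib[of "\<lambda>x. x * _"] sum.delta cong: if_cong)

lemma mult_Diag_nth: "(M ** Diag v) $ i $ j = M $ i $ j * v $ j"
  by (simp add: matrix_matrix_mult_def Diag_nth if_distrib[of "\<lambda>x. _ * x"] sum.delta cong: if_cong)

lemma rot_nth: "rot P H $ i $ j = column i P \<bullet> (H *v column j P)"
proof -
  have "rot P H $ i $ j = (transpose P ** (H ** P)) $ i $ j"
    by (simp add: rot_def matrix_mul_assoc)
  also have "\<dots> = column i P \<bullet> (H *v column j P)"
    by (simp add: matrix_matrix_mult_def transpose_def column_def inner_vec_def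
        matrix_vector_mult_def)
  finally show ?thesis .
qed

subsection \<open>Block patterns\<close>

text \<open>A condition on the support instead of a partition of the indices: for an equivalence
  relation \<open>r\<close> these are the block diagonal matrices up to reordering, and ties of
  \<open>x\<close>, of \<open>y\<close> or modulo a subspace can all be used as
  \<open>r\<close>.\<close>

definition blk :: "('n \<Rightarrow> 'n \<Rightarrow> bool) \<Rightarrow> real^'n^'n \<Rightarrow> bool" where
  "blk r M \<longleftrightarrow> (\<forall>i j. M $ i $ j \<noteq> 0 \<longrightarrow> r i j)"

lemma blkD: "blk r M \<Longrightarrow> M $ i $ j \<noteq> 0 \<Longrightarrow> r i j"
  by (simp add: blk_def)

lemma blk_mono: "blk r M \<Longrightarrow> (\<And>i j. r i j \<Longrightarrow> r' i j) \<Longrightarrow> blk r' M"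
  by (auto simp: blk_def)

lemma blk_mult:
  assumes "transp r" "blk r M" "blk r N"
  shows "blk r (M ** N)"
  unfolding blk_def
proof (intro allI impI)
  fix i j assume "(M ** N) $ i $ j \<noteq> 0"
  then obtain k where "M $ i $ k * N $ k $ j \<noteq> 0"
    unfolding matrix_matrix_mult_def by (auto elim: sum.not_neutral_contains_not_neutral)
  then show "r i j" using assms by (metis blkD mult_eq_0_iff transpD)
qed

lemma blk_transpose: "symp r \<Longrightarrow> blk r M \<Longrightarrow> blk r (transpose M)"
  by (auto simp: blk_def transpose_def dest: sympD)

lemma blk_rot: "symp r \<Longrightarrow> transp r \<Longrightarrow> blk r P \<Longrightarrow> blk r M \<Longrightarrow> blk r (rot P M)"
  by (simp add: rot_def blk_mult blk_transpose)

lemma blk_mat_1: "reflp r \<Longrightarrow> blk r (mat 1)"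
  by (auto simp: blk_def mat_def reflp_def split: if_splits)

lemma blk_commute_Diag:
  assumes "blk r R" "\<And>i j. r i j \<Longrightarrow> v $ i = v $ j"
  shows "R ** Diag v = Diag v ** R"
proof -
  have "R $ i $ j * v $ j = v $ i * R $ i $ j" for i j
    using blkD[OF assms(1), of i j] assms(2)[of i j] by (cases "R $ i $ j = 0") auto
  then show ?thesis by (simp add: vec_eq_iff Diag_mult_nth mult_Diag_nth)
qed

lemma blk_rot_Diag:
  assumes "blk r R" "\<And>i j. r i j \<Longrightarrow> v $ i = v $ j" "orthogonal_matrix R"
  shows "rot R (Diag v) = Diag v" "rot (transpose R) (Diag v) = Diag v"
proof -
  have eq: "R ** Diag v = Diag v ** R"
    using blk_commute_Diag[OF assms(1,2)] .
  show "rot R (Diag v) = Diag v" 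
    unfolding rot_def by (metis assms(3) eq matrix_mul_assoc matrix_mul_lid orthogonal_matrix_cancel(1))
  then show "rot (transpose R) (Diag v) = Diag v"
    by (metis assms(3) rot_cancel(2))
qed

subsection \<open>Plane rotations\<close>

text \<open>Given by columns because \<open>rot_nth\<close> evaluates a conjugate column by column.
  Cosine and sine are free parameters, so no angle has to be produced when an optimality condition
  is tested.\<close>

definition givens :: "'n \<Rightarrow> 'n \<Rightarrow> real \<Rightarrow> real \<Rightarrow> real^'n^'n" where
  "givens i j co si = (\<chi> k l. (if l = i then co *\<^sub>R axis i 1 + si *\<^sub>R axis j 1
     else if l = j then co *\<^sub>R axis j 1 - si *\<^sub>R axis i 1 else axis l 1) $ k)"

lemma column_givens: "column l (givens i j co si) =
  (if l = i then co *\<^sub>R axis i 1 + si *\<^sub>R axis j 1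
     else if l = j then co *\<^sub>R axis j 1 - si *\<^sub>R axis i 1 else axis l 1)"
  by (simp add: column_def givens_def vec_eq_iff)

lemma orthogonal_givens:
  assumes "i \<noteq> j" "co\<^sup>2 + si\<^sup>2 = 1"
  shows "orthogonal_matrix (givens i j co si)"
proof -
  have "co * co + si * si = 1" using assms(2) by (simp add: power2_eq_square)
  then have "column k (givens i j co si) \<bullet> column l (givens i j co si) = (if k = l then 1 else 0)" for k l
    using assms(1) unfolding column_givens
    by (auto simp: inner_add_left inner_add_right inner_diff_left inner_diff_right inner_axis_axis
        algebra_simps)
  then have "rot (givens i j co si) (mat 1) $ k $ l = mat 1 $ k $ l" for k l
    by (simp add: rot_nth) (simp add: mat_def)
  then show ?thesis
    by (simp add: orthogonal_matrix rot_def vec_eq_iff)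
qed

lemma blk_givens:
  assumes "reflp r" "symp r" "r i j"
  shows "blk r (givens i j co si)"
  using assms by (auto simp: blk_def givens_def axis_def reflp_def symp_def split: if_splits)

lemma inner_axis_mult_axis: "axis k 1 \<bullet> (M *v axis l 1) = (M $ k $ l :: real)"
  by (simp add: matrix_vector_mult_basis inner_axis' column_def)

lemma axis_nth_if: "axis i a $ j = (if j = i then a else 0)"
  by (simp add: axis_def)

lemma diagv_rot_givens:
  assumes "i \<noteq> j" "co\<^sup>2 + si\<^sup>2 = 1" "M \<in> SymMat"
  shows "diagv (rot (givens i j co si) M) =
    diagv M + (si\<^sup>2 * (M $ j $ j - M $ i $ i) + 2 * co * si * M $ i $ j) *\<^sub>R (axis i 1 - axis j 1)"
proof -
  have co: "co * co = 1 - si * si" using assms(2) by (simp add: power2_eq_square)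
  have co': "co * (co * x) = x - si * (si * x)" for x
    by (metis co left_diff_distrib mult.assoc mult_1)
  have S: "M $ j $ i = M $ i $ j" using assms(3) by (rule SymMat_nth)
  show ?thesis
    using assms(1)
    by (auto simp: vec_eq_iff rot_nth column_givens matrix_vector_right_distrib
        matrix_vector_mult_diff_distrib matrix_vector_mult_scaleR inner_add_left inner_add_right
        inner_diff_left inner_diff_right inner_axis_mult_axis axis_nth_if S)
      (simp_all add: algebra_simps power2_eq_square co')
qed

text \<open>Near the identity rotation the \<open>\<beta>\<close> term is linear in
  \<open>si\<close> and the \<open>\<alpha>\<close> term quadratic, so a nonzero
  \<open>\<beta>\<close> would win for a suitable sign of \<open>si\<close>.\<close>

lemma quadratic_nonpos_imp_zero:
  fixes \<alpha> \<beta> :: real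
  assumes "\<And>co si. co\<^sup>2 + si\<^sup>2 = 1 \<Longrightarrow> si\<^sup>2 * \<alpha> + co * si * \<beta> \<le> 0"
  shows "\<beta> = 0" "\<alpha> \<le> 0"
proof -
  show \<alpha>: "\<alpha> \<le> 0" using assms[of 0 1] by simp
  \<comment> \<open>The tangent of the angle. After division by \<open>co\<^sup>2\<close> the
    hypothesis reads \<open>u\<^sup>2 * \<alpha> + u * \<beta> \<le> 0\<close>, and this
    \<open>u\<close> turns the left side into \<open>u\<^sup>2\<close>.\<close>
  define u where "u = \<beta> / (1 - \<alpha>)"
  have pos: "1 + u\<^sup>2 > 0" by (simp add: add_pos_nonneg)
  define q where "q = sqrt (1 + u\<^sup>2)"
  have q: "q\<^sup>2 = 1 + u\<^sup>2" "q > 0" using pos by (auto simp: q_def)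
  have "(1 / q)\<^sup>2 + (u / q)\<^sup>2 = 1" using q pos by (simp add: power_divide add_divide_distrib[symmetric])
  then have "(u / q)\<^sup>2 * \<alpha> + (1/q) * (u / q) * \<beta> \<le> 0" using assms by blast
  then have "(u\<^sup>2 * \<alpha> + u * \<beta>) / q\<^sup>2 \<le> 0" by (simp add: power2_eq_square add_divide_distrib mult_ac)
  then have "u\<^sup>2 * \<alpha> + u * \<beta> \<le> 0" using q by (metis divide_le_0_iff not_le zero_less_power)
  moreover have "\<beta> = u * (1 - \<alpha>)" using \<alpha> by (simp add: u_def)
  ultimately have "u\<^sup>2 \<le> 0" by (simp add: algebra_simps power2_eq_square)
  then show "\<beta> = 0" using \<open>\<beta> = u * (1 - \<alpha>)\<close> by simp
qed

text \<open>The first order condition at the identity kills the off-diagonal entry whenever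
  \<open>s\<close> separates \<open>i\<close> and \<open>j\<close>; the quarter turn, which swaps
  the two diagonal entries, gives their order.\<close>

lemma givens_optimal:
  assumes "i \<noteq> j" "M \<in> SymMat"
    and "\<And>co si. co\<^sup>2 + si\<^sup>2 = 1 \<Longrightarrow> s \<bullet> diagv (rot (givens i j co si) M) \<le> s \<bullet> diagv M"
  shows "(s $ i - s $ j) * M $ i $ j = 0" "(s $ i - s $ j) * (M $ j $ j - M $ i $ i) \<le> 0"
proof -
  have *: "si\<^sup>2 * ((s $ i - s $ j) * (M $ j $ j - M $ i $ i))
      + co * si * (2 * ((s $ i - s $ j) * M $ i $ j)) \<le> 0" if "co\<^sup>2 + si\<^sup>2 = 1" for co si
    using assms(3)[OF that] unfolding diagv_rot_givens[OF assms(1) that assms(2)]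
    by (simp add: inner_add_right inner_diff_right inner_axis algebra_simps)
  show "(s $ i - s $ j) * M $ i $ j = 0"
    using quadratic_nonpos_imp_zero(1)[OF *] by simp
  show "(s $ i - s $ j) * (M $ j $ j - M $ i $ i) \<le> 0"
    using quadratic_nonpos_imp_zero(2)[OF *] by simp
qed

section \<open>Compactness of orthogonal block matrices and maximizers over orbits\<close>

lemma orthogonal_matrix_transpose: "orthogonal_matrix P \<Longrightarrow> orthogonal_matrix (transpose P)"
  by (simp add: orthogonal_matrix_def)

lemma bounded_orthogonal: "bounded {Q :: real^'n^'n. orthogonal_matrix Q}"
proof -
  have "norm Q ^ 2 = norm (mat 1 :: real^'n^'n) ^ 2" if "orthogonal_matrix Q" for Q :: "real^'n^'n"
  proof -
    have "norm Q ^ 2 = (Q ** mat 1) \<bullet> Q" by (simp add: power2_norm_eq_inner)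
    also have "\<dots> = mat 1 \<bullet> (mat 1 :: real^'n^'n)"
      unfolding inner_matrix_mult_left using that by (simp add: orthogonal_matrix_cancel)
    finally show ?thesis by (simp add: power2_norm_eq_inner)
  qed
  then have "norm Q = norm (mat 1 :: real^'n^'n)" if "orthogonal_matrix Q" for Q :: "real^'n^'n"
    using that by (metis norm_ge_zero power2_eq_imp_eq)
  then show ?thesis by (auto simp: bounded_iff)
qed

lemma compact_orthogonal_blk: "compact {Q :: real^'n^'n. orthogonal_matrix Q \<and> blk r Q}"
proof -
  have 1: "{Q :: real^'n^'n. orthogonal_matrix Q \<and> blk r Q} =
     {Q. transpose Q ** Q = mat 1} \<inter> (\<Inter>(i, j)\<in>{(i, j). \<not> r i j}. {Q. Q $ i $ j = 0})"
    by (auto simp: orthogonal_matrix blk_def)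
  have "closed {Q :: real^'n^'n. transpose Q ** Q = mat 1}"
    by (intro closed_Collect_eq matrix_mult.continuous_on continuous_on_transpose continuous_intros)
  moreover have "closed {Q :: real^'n^'n. Q $ i $ j = 0}" for i j
    by (intro closed_Collect_eq continuous_intros)
  ultimately have "closed {Q :: real^'n^'n. orthogonal_matrix Q \<and> blk r Q}"
    unfolding 1 by (intro closed_Int closed_INT) auto
  moreover have "bounded {Q :: real^'n^'n. orthogonal_matrix Q \<and> blk r Q}"
    by (rule bounded_subset[OF bounded_orthogonal]) auto
  ultimately show ?thesis by (simp add: compact_eq_bounded_closed)
qed

text \<open>A maximizer of a linear functional over the orbit cannot be improved by plane rotations, which
  forces its off-diagonal entries to vanish.\<close>

lemma orbit_maximizer:
  fixes M :: "real^'n^'n"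
  assumes r: "reflp r" "symp r" "transp r" and M: "M \<in> SymMat"
  obtains Q where "orthogonal_matrix Q" "blk r Q"
    "\<And>U. orthogonal_matrix U \<Longrightarrow> blk r U \<Longrightarrow> s \<bullet> diagv (rot U M) \<le> s \<bullet> diagv (rot Q M)"
    "\<And>i j. r i j \<Longrightarrow> s $ i \<noteq> s $ j \<Longrightarrow> rot Q M $ i $ j = 0"
    "\<And>i j. r i j \<Longrightarrow> s $ i > s $ j \<Longrightarrow> rot Q M $ j $ j \<le> rot Q M $ i $ i"
proof -
  let ?S = "{Q :: real^'n^'n. orthogonal_matrix Q \<and> blk r Q}"
  have "?S \<noteq> {}" using blk_mat_1[OF r(1)] orthogonal_matrix_id by blast
  moreover have "continuous_on ?S (\<lambda>U. s \<bullet> diagv (rot U M))"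
    unfolding rot_def by (intro continuous_intros continuous_on_diagv matrix_mult.continuous_on
        continuous_on_transpose)
  ultimately obtain Q where Q: "Q \<in> ?S" "\<And>U. U \<in> ?S \<Longrightarrow> s \<bullet> diagv (rot U M) \<le> s \<bullet> diagv (rot Q M)"
    using continuous_attains_sup[OF compact_orthogonal_blk[of r], of "\<lambda>U. s \<bullet> diagv (rot U M)"] by auto
  have opt: "s \<bullet> diagv (rot (givens i j co si) (rot Q M)) \<le> s \<bullet> diagv (rot Q M)"
    if "r i j" "i \<noteq> j" "co\<^sup>2 + si\<^sup>2 = 1" for i j co si
    unfolding rot_rot using Q(1) that r
    by (intro Q(2)) (auto intro!: orthogonal_matrix_mul blk_mult orthogonal_givens blk_givens)
  show ?thesis
  proof
    show "orthogonal_matrix Q" "blk r Q" using Q(1) by auto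
    show "s \<bullet> diagv (rot U M) \<le> s \<bullet> diagv (rot Q M)" if "orthogonal_matrix U" "blk r U" for U
      using Q(2) that by blast
    fix i j assume ij: "r i j"
    show "rot Q M $ i $ j = 0" if "s $ i \<noteq> s $ j"
    proof -
      have "i \<noteq> j" using that by auto
      from givens_optimal(1)[OF this rot_SymMat[OF M] opt[OF ij this]] show ?thesis
        using that by simp
    qed
    show "rot Q M $ j $ j \<le> rot Q M $ i $ i" if "s $ i > s $ j"
    proof -
      have "i \<noteq> j" using that by auto
      from givens_optimal(2)[OF this rot_SymMat[OF M] opt[OF ij this]] show ?thesis
        using that by (simp add: mult_le_0_iff)
    qed
  qed
qed

section \<open>Spectral theorem within blocks, and sorting\<close>

lemma ex_strict_antimono:
  obtains c :: "('n::{finite,linorder}) rvec" where "\<And>i j. i < j \<Longrightarrow> c $ j < c $ i"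
proof
  fix i j :: 'n assume "i < j"
  then have "{k. k < i} \<subset> {k. k < j}" by auto
  then have "card {k. k < i} < card {k. k < j}" by (intro psubset_card_mono) auto
  then show "(\<chi> i::'n. - real (card {k. k < i})) $ j < (\<chi> i. - real (card {k. k < i})) $ i"
    by simp
qed

text \<open>Maximize the functional given by a vector \<open>c\<close> with strictly decreasing
  entries: \<open>c\<close> separates all indices, so every off-diagonal entry inside a block
  vanishes, and its order is inherited by the diagonal.\<close>

lemma spectral_blk:
  fixes M :: "('n::{finite,linorder}) rmat"
  assumes r: "reflp r" "symp r" "transp r" and M: "M \<in> SymMat" "blk r M"
  obtains Q w where "orthogonal_matrix Q" "blk r Q" "rot Q M = Diag w"
    "\<And>i j. r i j \<Longrightarrow> i \<le> j \<Longrightarrow> w $ j \<le> w $ i"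
proof -
  obtain c :: "'n rvec" where c: "\<And>i j. i < j \<Longrightarrow> c $ j < c $ i" using ex_strict_antimono by blast
  obtain Q where Q: "orthogonal_matrix Q" "blk r Q"
    "\<And>i j. r i j \<Longrightarrow> c $ i \<noteq> c $ j \<Longrightarrow> rot Q M $ i $ j = 0"
    "\<And>i j. r i j \<Longrightarrow> c $ i > c $ j \<Longrightarrow> rot Q M $ j $ j \<le> rot Q M $ i $ i"
    using orbit_maximizer[OF r M(1), of c] by metis
  have ne: "c $ i \<noteq> c $ j" if "i \<noteq> j" for i j using c that by (metis less_irrefl neqE)
  have "blk r (rot Q M)" using r Q M by (simp add: blk_rot)
  then have "rot Q M $ i $ j = 0" if "i \<noteq> j" for i j
    using Q(3) ne[OF that] by (auto simp: blk_def)
  then have "rot Q M = Diag (diagv (rot Q M))" by (auto simp: vec_eq_iff Diag_nth)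
  moreover have "diagv (rot Q M) $ j \<le> diagv (rot Q M) $ i" if "r i j" "i \<le> j" for i j
    using that Q(4) c by (cases "i = j") auto
  ultimately show ?thesis using that Q by blast
qed

text \<open>Rearrangement inequality read backwards: a permutation maximizing the pairing with a
  strictly decreasing \<open>c\<close> cannot be improved by a swap, hence it sorts.\<close>

lemma ex_sorting_permutation:
  fixes v :: "('n::{finite,linorder}) rvec"
  obtains \<sigma> where "\<sigma> permutes UNIV" "\<And>i j. i \<le> j \<Longrightarrow> v $ \<sigma> j \<le> v $ \<sigma> i"
proof -
  obtain c :: "'n rvec" where c: "\<And>i j. i < j \<Longrightarrow> c $ j < c $ i" using ex_strict_antimono by blast
  let ?F = "\<lambda>\<sigma>. \<Sum>i\<in>UNIV. c $ i * v $ \<sigma> i"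
  have fin: "finite {\<sigma>. \<sigma> permutes (UNIV :: 'n set)}" by (simp add: finite_permutations)
  obtain \<sigma> where \<sigma>: "\<sigma> permutes UNIV" "\<And>\<tau>. \<tau> permutes UNIV \<Longrightarrow> ?F \<tau> \<le> ?F \<sigma>"
  proof -
    have "Max (?F ` {\<sigma>. \<sigma> permutes UNIV}) \<in> ?F ` {\<sigma>. \<sigma> permutes UNIV}"
      using fin permutes_id[of UNIV] by (intro Max_in) (auto simp del: permutes_id)
    then obtain \<sigma> where "\<sigma> permutes UNIV" "Max (?F ` {\<sigma>. \<sigma> permutes UNIV}) = ?F \<sigma>" by auto
    moreover have "?F \<tau> \<le> Max (?F ` {\<sigma>. \<sigma> permutes UNIV})" if "\<tau> permutes UNIV" for \<tau>
      using that fin by (intro Max_ge) auto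
    ultimately show ?thesis using that by metis
  qed
  have "v $ \<sigma> j \<le> v $ \<sigma> i" if "i < j" for i j
  proof -
    have "?F (\<sigma> \<circ> Transposition.transpose i j) \<le> ?F \<sigma>"
      using \<sigma>(2)[OF permutes_compose[OF permutes_swap_id[of i UNIV j] \<sigma>(1)]] by simp
    moreover have "?F \<tau> = c $ i * v $ \<tau> i + c $ j * v $ \<tau> j + (\<Sum>k\<in>UNIV - {i} - {j}. c $ k * v $ \<tau> k)" for \<tau>
      using that by (simp add: sum.remove[of UNIV i] sum.remove[of "UNIV - {i}" j])
    ultimately have "(c $ i - c $ j) * (v $ \<sigma> j - v $ \<sigma> i) \<le> 0"
      using less_imp_neq[OF that] by (auto simp: Transposition.transpose_def algebra_simps)
    then show ?thesis using c[OF that] by (simp add: mult_le_0_iff)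
  qed
  then show ?thesis using that \<sigma>(1) by (metis order_le_less order_refl)
qed

section \<open>Ordered spectral decompositions\<close>

definition sorted_vec :: "('n::{finite,linorder}) rvec \<Rightarrow> bool" where
  "sorted_vec v \<longleftrightarrow> (\<forall>i j. i \<le> j \<longrightarrow> v $ j \<le> v $ i)"

lemma card_down_set_eq:
  fixes S T :: "'n::{finite,linorder} set"
  assumes "\<And>i j. i \<le> j \<Longrightarrow> j \<in> S \<Longrightarrow> i \<in> S" "\<And>i j. i \<le> j \<Longrightarrow> j \<in> T \<Longrightarrow> i \<in> T" "card S = card T"
  shows "S = T"
proof -
  have "S \<subseteq> T \<or> T \<subseteq> S" using assms(1,2) by (metis linear subsetI)
  then show ?thesis using assms(3) by (metis card_subset_eq finite)
qed

text \<open>The product determines the multiset of roots, hence the number of entries above each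
  threshold. For a sorted vector the indices of these entries form an initial segment, which its
  cardinality determines.\<close>

lemma sorted_vec_unique:
  fixes v w :: "('n::{finite,linorder}) rvec"
  assumes "sorted_vec v" "sorted_vec w" "\<And>t. (\<Prod>i\<in>UNIV. t - v $ i) = (\<Prod>i\<in>UNIV. t - w $ i)"
  shows "v = w"
proof -
  have im: "image_mset f (mset_set A) = (\<Sum>i\<in>A. {#f i#})" if "finite A" for f :: "'n \<Rightarrow> real" and A
    using that by induction auto
  have roots: "proots (\<Prod>i\<in>UNIV. [:- v $ i, 1:]) = image_mset (($) v) (mset_set UNIV)" for v :: "'n rvec"
    by (subst proots_prod) (auto simp: im)
  have "poly (\<Prod>i\<in>UNIV. [:- v $ i, 1:]) = poly (\<Prod>i\<in>UNIV. [:- w $ i, 1:])"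
    using assms(3) by (auto simp: poly_prod fun_eq_iff)
  then have eq: "image_mset (($) v) (mset_set UNIV) = image_mset (($) w) (mset_set UNIV)"
    by (metis poly_eq_poly_eq_iff roots)
  have "size (filter_mset (\<lambda>q. r \<le> q) (image_mset (($) v) (mset_set UNIV))) = card {i. r \<le> v $ i}"
    for r and v :: "'n rvec"
    by (simp add: filter_mset_image_mset filter_mset_mset_set)
  then have "card {i. r \<le> v $ i} = card {i. r \<le> w $ i}" for r
    by (metis eq)
  then have *: "{i. r \<le> v $ i} = {i. r \<le> w $ i}" for r
    using assms(1,2) by (intro card_down_set_eq) (auto simp: sorted_vec_def intro: order_trans)
  have "v $ i \<le> w $ i \<and> w $ i \<le> v $ i" for i
    using *[of "v $ i"] *[of "w $ i"] by auto
  then show ?thesis by (auto simp: vec_eq_iff intro: antisym)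
qed

lemma det_Diag: "det (Diag v) = (\<Prod>i\<in>UNIV. v $ i)"
  by (subst det_diagonal) (auto simp: Diag_nth)

lemma mat_eq_Diag: "mat t = Diag (\<chi> i. t)"
  by (simp add: mat_def Diag_def vec_eq_iff)

lemma charpoly_rot_Diag:
  assumes "orthogonal_matrix Q"
  shows "det (mat t - rot Q (Diag v)) = (\<Prod>i\<in>UNIV. t - v $ i)"
proof -
  have "mat t = rot Q (Diag (\<chi> i. t))"
    using blk_rot_Diag[of "\<lambda>_ _. True" Q "\<chi> i. t"] assms by (simp add: mat_eq_Diag blk_def)
  then have "mat t - rot Q (Diag v) = rot Q (Diag ((\<chi> i. t) - v))"
    by (simp add: rot_diff Diag_diff)
  moreover have "det (rot Q M) = det M" for M
  proof -
    have "det (rot Q M) = det (transpose Q ** Q) * det M"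
      by (simp add: rot_def det_mul)
    then show ?thesis using assms by (simp add: orthogonal_matrix_cancel)
  qed
  ultimately show ?thesis by (simp add: det_Diag)
qed

lemma eigvals_eqI:
  fixes v :: "('n::{finite,linorder}) rvec"
  assumes "sorted_vec v" "\<And>t. det (mat t - X) = (\<Prod>i\<in>UNIV. t - v $ i)"
  shows "eigvals X = v"
  unfolding eigvals_def
proof (rule the_equality)
  show "(\<forall>i j. i \<le> j \<longrightarrow> v $ j \<le> v $ i) \<and> (\<forall>t. det (mat t - X) = (\<Prod>i\<in>UNIV. t - v $ i))"
    using assms by (simp add: sorted_vec_def)
  fix w :: "'n rvec"
  assume "(\<forall>i j. i \<le> j \<longrightarrow> w $ j \<le> w $ i) \<and> (\<forall>t. det (mat t - X) = (\<Prod>i\<in>UNIV. t - w $ i))"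
  then show "w = v"
    using assms by (intro sorted_vec_unique) (auto simp: sorted_vec_def)
qed

lemma orth_diagI:
  assumes "orthogonal_matrix P" "rot P X = Diag v" "sorted_vec v"
  shows "eigvals X = v" "P \<in> orth_diag X"
proof -
  have X: "X = rot (transpose P) (Diag v)"
    using assms by (metis rot_cancel(2))
  show "eigvals X = v"
    using charpoly_rot_Diag[OF orthogonal_matrix_transpose[OF assms(1)]] assms(3) X
    by (intro eigvals_eqI) auto
  then show "P \<in> orth_diag X"
    using X assms(1) by (simp add: orth_diag_def rot_def)
qed

lemma orth_diagD:
  assumes "P \<in> orth_diag X"
  shows "orthogonal_matrix P" "rot P X = Diag (eigvals X)" "X = rot (transpose P) (Diag (eigvals X))"
proof -
  show P: "orthogonal_matrix P" and X: "X = rot (transpose P) (Diag (eigvals X))"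
    using assms by (auto simp: orth_diag_def rot_def)
  show "rot P X = Diag (eigvals X)" by (subst X) (simp add: P)
qed

lemma ex_orth_diag:
  assumes "X \<in> SymMat"
  obtains P where "P \<in> orth_diag X"
proof -
  obtain Q w where "orthogonal_matrix Q" "rot Q X = Diag w" "sorted_vec w"
    using spectral_blk[of "\<lambda>_ _. True" X] assms
    by (auto simp: sorted_vec_def reflp_def symp_def transp_def blk_def)
  then show ?thesis using orth_diagI that by blast
qed

lemma sorted_eigvals:
  assumes "X \<in> SymMat"
  shows "sorted_vec (eigvals X)"
proof -
  obtain Q w where "orthogonal_matrix Q" "rot Q X = Diag w" "sorted_vec w"
    using spectral_blk[of "\<lambda>_ _. True" X] assms
    by (auto simp: sorted_vec_def reflp_def symp_def transp_def blk_def)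
  then show ?thesis using orth_diagI by blast
qed

section \<open>Polyhedral functions near a point\<close>

lemma max_affine_le_iff:
  "1 \<le> p \<Longrightarrow> max_affine a c p x \<le> r \<longleftrightarrow> (\<forall>\<nu>\<in>{1..p}. a \<nu> \<bullet> x - c \<nu> \<le> r)"
  unfolding max_affine_def by (subst Max_le_iff) auto

locale polyhedral_rep =
  fixes \<theta> :: "'a::euclidean_space \<Rightarrow> ereal" and a c p b d m
  assumes represents: "represents \<theta> a c p b d m"
begin

lemma le_iff: "\<theta> z \<le> ereal r \<longleftrightarrow>
  (\<forall>\<nu>\<in>{1..p}. a \<nu> \<bullet> z - c \<nu> \<le> r) \<and> (\<forall>\<mu>\<in>{1..m}. b \<mu> \<bullet> z \<le> d \<mu>)"
proof -
  have "z \<in> edom UNIV \<theta> \<longleftrightarrow> (\<forall>\<mu>\<in>{1..m}. b \<mu> \<bullet> z \<le> d \<mu>)"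
    using represents by (auto simp: represents_def max_affine_le_iff)
  moreover have "\<theta> z = ereal (max_affine a c p z) + indic (edom UNIV \<theta>) z"
    using represents by (auto simp: represents_def)
  ultimately show ?thesis
    using represents by (auto simp: indic_def represents_def max_affine_le_iff)
qed

lemma not_MInf: "\<theta> z \<noteq> -\<infinity>"
  using represents unfolding represents_def by (metis indic_def ereal_plus_eq_MInfty MInfty_neq_ereal(1) MInfty_neq_PInfty(1) zero_ereal_def)

lemma finite_value: "\<theta> x = ereal r \<Longrightarrow> r = max_affine a c p x"
  using represents unfolding represents_def
  by (metis add.right_neutral ereal.inject indic_def ereal_plus_eq_PInfty PInfty_neq_ereal(1))

text \<open>Active pieces obey the bound for all positive \<open>t\<close> by linearity. Inactive
  ones have slack at \<open>t = 0\<close> and keep it for small \<open>t\<close>. Finitely many such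
  neighbourhoods intersect, so the bound holds without an error term.\<close>

lemma eventually_directional_le:
  assumes x: "\<theta> x = ereal r"
    and 1: "\<And>\<nu>. \<nu> \<in> iota1 a c p x \<Longrightarrow> a \<nu> \<bullet> w \<le> \<kappa>"
    and 2: "\<And>\<mu>. \<mu> \<in> iota2 b d m x \<Longrightarrow> b \<mu> \<bullet> w \<le> 0"
  shows "eventually (\<lambda>t. \<theta> (x + t *\<^sub>R w) \<le> ereal (r + t * \<kappa>)) (at_right 0)"
proof -
  have x': "\<forall>\<nu>\<in>{1..p}. a \<nu> \<bullet> x - c \<nu> \<le> r" "\<forall>\<mu>\<in>{1..m}. b \<mu> \<bullet> x \<le> d \<mu>"
    using le_iff[of x r] x by auto
  have "eventually (\<lambda>t. a \<nu> \<bullet> (x + t *\<^sub>R w) - c \<nu> \<le> r + t * \<kappa>) (at_right 0)" if \<nu>: "\<nu> \<in> {1..p}" for \<nu>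
  proof (cases "\<nu> \<in> iota1 a c p x")
    case True
    then have "a \<nu> \<bullet> x - c \<nu> = r" "a \<nu> \<bullet> w \<le> \<kappa>"
      using 1 finite_value[OF x] by (auto simp: iota1_def)
    then have "a \<nu> \<bullet> (x + t *\<^sub>R w) - c \<nu> \<le> r + t * \<kappa>" if "t > 0" for t
    proof -
      have "t * (a \<nu> \<bullet> w) \<le> t * \<kappa>" using \<open>a \<nu> \<bullet> w \<le> \<kappa>\<close> that by simp
      then show ?thesis using \<open>a \<nu> \<bullet> x - c \<nu> = r\<close> by (simp add: inner_add_right)
    qed
    then show ?thesis by (auto intro: eventually_mono[OF eventually_at_right_less])
  next
    case False
    then have "a \<nu> \<bullet> x - c \<nu> < r"
      using x'(1) \<nu> finite_value[OF x] by (force simp: iota1_def)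
    moreover have "((\<lambda>t. r + t * \<kappa> - (a \<nu> \<bullet> (x + t *\<^sub>R w) - c \<nu>)) \<longlongrightarrow>
        r + 0 * \<kappa> - (a \<nu> \<bullet> (x + 0 *\<^sub>R w) - c \<nu>)) (at_right 0)"
      by (intro tendsto_intros)
    ultimately have "eventually (\<lambda>t. 0 < r + t * \<kappa> - (a \<nu> \<bullet> (x + t *\<^sub>R w) - c \<nu>)) (at_right 0)"
      by (intro order_tendstoD(1)[where y = "r + 0 * \<kappa> - (a \<nu> \<bullet> (x + 0 *\<^sub>R w) - c \<nu>)"]) auto
    then show ?thesis by eventually_elim simp
  qed
  moreover have "eventually (\<lambda>t. b \<mu> \<bullet> (x + t *\<^sub>R w) \<le> d \<mu>) (at_right 0)" if \<mu>: "\<mu> \<in> {1..m}" for \<mu>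
  proof (cases "\<mu> \<in> iota2 b d m x")
    case True
    then have "b \<mu> \<bullet> x = d \<mu>" "b \<mu> \<bullet> w \<le> 0"
      using 2 by (auto simp: iota2_def)
    then have "b \<mu> \<bullet> (x + t *\<^sub>R w) \<le> d \<mu>" if "t > 0" for t
      using that by (simp add: inner_add_right mult_le_0_iff)
    then show ?thesis by (auto intro: eventually_mono[OF eventually_at_right_less])
  next
    case False
    then have "b \<mu> \<bullet> x < d \<mu>"
      using x'(2) \<mu> by (force simp: iota2_def)
    moreover have "((\<lambda>t. b \<mu> \<bullet> (x + t *\<^sub>R w)) \<longlongrightarrow> b \<mu> \<bullet> (x + 0 *\<^sub>R w)) (at_right 0)"
      by (intro tendsto_intros)
    ultimately have "eventually (\<lambda>t. b \<mu> \<bullet> (x + t *\<^sub>R w) < d \<mu>) (at_right 0)"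
      by (intro order_tendstoD(2)[where y = "b \<mu> \<bullet> (x + 0 *\<^sub>R w)"]) auto
    then show ?thesis by eventually_elim simp
  qed
  ultimately have "eventually (\<lambda>t. (\<forall>\<nu>\<in>{1..p}. a \<nu> \<bullet> (x + t *\<^sub>R w) - c \<nu> \<le> r + t * \<kappa>) \<and>
     (\<forall>\<mu>\<in>{1..m}. b \<mu> \<bullet> (x + t *\<^sub>R w) \<le> d \<mu>)) (at_right 0)"
    by (intro eventually_conj eventually_ball_finite) auto
  then show ?thesis by (simp add: le_iff)
qed

lemma ge_piece: "\<nu> \<in> {1..p} \<Longrightarrow> ereal (a \<nu> \<bullet> z - c \<nu>) \<le> \<theta> z"
  using le_iff[of z "real_of_ereal (\<theta> z)"] not_MInf[of z] by (cases "\<theta> z") auto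

lemma subdiff_piece:
  assumes x: "\<theta> x = ereal r" and \<nu>: "\<nu> \<in> iota1 a c p x"
  shows "a \<nu> \<in> subdiff UNIV \<theta> x"
  using ge_piece[of \<nu>] x \<nu> finite_value[OF x] by (auto simp: subdiff_def inner_diff_right algebra_simps iota1_def)

lemma subdiff_piece_add:
  assumes x: "\<theta> x = ereal r" and \<nu>: "\<nu> \<in> iota1 a c p x" and \<mu>: "\<mu> \<in> iota2 b d m x" and "\<tau> \<ge> 0"
  shows "a \<nu> + \<tau> *\<^sub>R b \<mu> \<in> subdiff UNIV \<theta> x"
proof -
  have \<nu>': "\<nu> \<in> {1..p}" "a \<nu> \<bullet> x - c \<nu> = r"
    using \<nu> finite_value[OF x] by (auto simp: iota1_def)
  have \<mu>': "\<mu> \<in> {1..m}" "b \<mu> \<bullet> x = d \<mu>" using \<mu> by (auto simp: iota2_def)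
  have "ereal (r + (a \<nu> + \<tau> *\<^sub>R b \<mu>) \<bullet> (z - x)) \<le> \<theta> z" for z
  proof (cases "\<theta> z")
    case (real q)
    then have "b \<mu> \<bullet> z \<le> d \<mu>" "a \<nu> \<bullet> z - c \<nu> \<le> q" using le_iff[of z q] \<mu>' \<nu>' by auto
    moreover have "\<tau> * (b \<mu> \<bullet> z) \<le> \<tau> * d \<mu>" using \<open>b \<mu> \<bullet> z \<le> d \<mu>\<close> \<open>\<tau> \<ge> 0\<close> by (rule mult_left_mono)
    ultimately show ?thesis using \<mu>' \<nu>' real by (simp add: inner_diff_right inner_add_left algebra_simps)
  qed (use not_MInf in auto)
  then show "a \<nu> + \<tau> *\<^sub>R b \<mu> \<in> subdiff UNIV \<theta> x"
    using x by (auto simp: subdiff_def)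
qed

lemma iota1_nonempty: "iota1 a c p x \<noteq> {}"
proof -
  have "max_affine a c p x \<in> (\<lambda>\<nu>. a \<nu> \<bullet> x - c \<nu>) ` {1..p}"
    unfolding max_affine_def using represents by (intro Max_in) (auto simp: represents_def)
  then show ?thesis by (auto simp: iota1_def)
qed

text \<open>The active slopes \<open>a \<nu>\<close> are subgradients themselves. An active
  constraint with \<open>b \<mu> \<bullet> w > 0\<close> would allow arbitrarily large multiples of
  \<open>b \<mu>\<close> to be added to a subgradient, against the bound
  \<open>\<kappa>\<close>.\<close>

lemma eventually_le_support:
  assumes x: "\<theta> x = ereal r" and s: "\<And>s. s \<in> subdiff UNIV \<theta> x \<Longrightarrow> s \<bullet> w \<le> \<kappa>"
  shows "eventually (\<lambda>t. \<theta> (x + t *\<^sub>R w) \<le> ereal (r + t * \<kappa>)) (at_right 0)"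
proof (rule eventually_directional_le[OF x])
  show "a \<nu> \<bullet> w \<le> \<kappa>" if "\<nu> \<in> iota1 a c p x" for \<nu>
    using subdiff_piece[OF x that] s by blast
  show "b \<mu> \<bullet> w \<le> 0" if \<mu>: "\<mu> \<in> iota2 b d m x" for \<mu>
  proof (rule ccontr)
    assume neg: "\<not> b \<mu> \<bullet> w \<le> 0"
    obtain \<nu> where \<nu>: "\<nu> \<in> iota1 a c p x" using iota1_nonempty by blast
    \<comment> \<open>Large enough that
      \<open>(a \<nu> + \<tau> *\<^sub>R b \<mu>) \<bullet> w\<close> exceeds
      \<open>\<kappa>\<close> by at least 1.\<close>
    define \<tau> where "\<tau> = (\<bar>\<kappa> - a \<nu> \<bullet> w\<bar> + 1) / (b \<mu> \<bullet> w)"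
    have "\<tau> \<ge> 0" using neg by (simp add: \<tau>_def)
    then have "(a \<nu> + \<tau> *\<^sub>R b \<mu>) \<bullet> w \<le> \<kappa>" using subdiff_piece_add[OF x \<nu> \<mu>] s by blast
    then show False using neg by (simp add: \<tau>_def inner_add_left)
  qed
qed

text \<open>Equal active sets allow the segment from \<open>x\<close> to \<open>x'\<close> to be
  prolonged beyond \<open>x'\<close> with \<open>\<theta>\<close> growing at rate at most
  \<open>r' - r\<close>. The subgradient inequality on this prolongation gives
  \<open>s \<bullet> (x' - x) \<le> r' - r\<close>, which moves the minorant from \<open>x'\<close>
  to \<open>x\<close>.\<close>

lemma subdiff_eq_of_active:
  assumes x: "\<theta> x = ereal r" "\<theta> x' = ereal r'"
    and eq: "iota1 a c p x = iota1 a c p x'" "iota2 b d m x = iota2 b d m x'"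
    and s: "s \<in> subdiff UNIV \<theta> x'"
  shows "s \<in> subdiff UNIV \<theta> x"
proof -
  have sub: "ereal (r' + s \<bullet> (z - x')) \<le> \<theta> z" for z
    using s x by (auto simp: subdiff_def)
  have "eventually (\<lambda>t. \<theta> (x' + t *\<^sub>R (x' - x)) \<le> ereal (r' + t * (r' - r))) (at_right 0)"
  proof (rule eventually_directional_le[OF x(2)])
    show "a \<nu> \<bullet> (x' - x) \<le> r' - r" if "\<nu> \<in> iota1 a c p x'" for \<nu>
      using that that[folded eq(1)] finite_value[OF x(1)] finite_value[OF x(2)] by (auto simp: iota1_def inner_diff_right)
    show "b \<mu> \<bullet> (x' - x) \<le> 0" if "\<mu> \<in> iota2 b d m x'" for \<mu>
      using that that[folded eq(2)] by (auto simp: iota2_def inner_diff_right)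
  qed
  then have "eventually (\<lambda>t::real. False \<or> s \<bullet> (x' - x) \<le> r' - r) (at_right 0)"
    using eventually_at_right_less
  proof eventually_elim
    case (elim t)
    have "r' + s \<bullet> (t *\<^sub>R (x' - x)) \<le> r' + t * (r' - r)"
      using order_trans[OF sub elim(1)] by simp
    then show ?case using elim(2) by simp
  qed
  then have "s \<bullet> (x' - x) \<le> r' - r"
    by (simp add: trivial_limit_at_right_real)
  then have "r + s \<bullet> (z - x) \<le> r' + s \<bullet> (z - x')" for z
    by (simp add: inner_diff_right)
  then have "ereal (r + s \<bullet> (z - x)) \<le> \<theta> z" for z
    using sub order_trans ereal_less_eq(3) by blast
  then show ?thesis using x by (simp add: subdiff_def)
qed

end

section \<open>Subgradients of spectral functions\<close>

lemma spectral_level_sets: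
  fixes M :: "('n::{finite,linorder}) rmat"
  assumes "M \<in> SymMat" "blk (\<lambda>i j. s $ i = s $ j) M"
  obtains R w where "orthogonal_matrix R" "blk (\<lambda>i j. s $ i = s $ j) R" "rot R M = Diag w"
    "\<And>i j. s $ i = s $ j \<Longrightarrow> i \<le> j \<Longrightarrow> w $ j \<le> w $ i"
  by (rule spectral_blk[OF _ _ _ assms]) (auto simp: reflp_def symp_def transp_def)

lemma symmetric_fun_eigvals:
  assumes "symmetric_fun \<theta>" "orthogonal_matrix Q"
  shows "\<theta> (eigvals (rot Q (Diag v))) = \<theta> v"
proof -
  obtain \<sigma> where \<sigma>: "\<sigma> permutes UNIV" "\<And>i j. i \<le> j \<Longrightarrow> v $ \<sigma> j \<le> v $ \<sigma> i"
    using ex_sorting_permutation by blast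
  have "(\<Prod>i\<in>UNIV. t - v $ i) = (\<Prod>i\<in>UNIV. t - v $ \<sigma> i)" for t
    using prod.permute[OF \<sigma>(1), of "\<lambda>i. t - v $ i"] by (simp add: o_def)
  then have "eigvals (rot Q (Diag v)) = (\<chi> i. v $ \<sigma> i)"
    using \<sigma>(2) assms(2) by (intro eigvals_eqI) (auto simp: sorted_vec_def charpoly_rot_Diag)
  then show ?thesis using assms(1) \<sigma>(1) by (simp add: symmetric_fun_def)
qed

lemma subdiffD: "s \<in> subdiff UNIV \<theta> x \<Longrightarrow> \<theta> x + ereal (s \<bullet> (z - x)) \<le> \<theta> z"
  by (simp add: subdiff_def)

lemma subdiff_finite: "s \<in> subdiff E f x \<Longrightarrow> \<exists>r. f x = ereal r"
  by (auto simp: subdiff_def)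

locale symmetric_function =
  fixes \<theta> :: "('n::{finite,linorder}) rvec \<Rightarrow> ereal"
  assumes symmetric: "symmetric_fun \<theta>"
begin

abbreviation "g \<equiv> \<theta> \<circ> eigvals"

lemma g_rot_Diag: "orthogonal_matrix Q \<Longrightarrow> g (rot Q (Diag v)) = \<theta> v"
  using symmetric symmetric_fun_eigvals by auto

text \<open>The orbit maximizer for the functional \<open>s\<close> can be diagonalized within the level sets of \<open>s\<close>, so
  the maximum equals \<open>s \<bullet> w\<close> for some rearrangement \<open>w\<close> of the eigenvalues. This replaces the trace
  inequalities of Fan and von Neumann.\<close>

lemma orbit_minorant:
  assumes s: "s \<in> subdiff UNIV \<theta> x" and U: "orthogonal_matrix U" and Z: "Z \<in> SymMat"
  shows "\<theta> x + ereal (s \<bullet> diagv (rot U Z) - s \<bullet> x) \<le> g Z"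
proof -
  have "\<exists>Q. orthogonal_matrix Q \<and>
    (\<forall>U. orthogonal_matrix U \<longrightarrow> s \<bullet> diagv (rot U Z) \<le> s \<bullet> diagv (rot Q Z)) \<and>
    (\<forall>i j. s $ i \<noteq> s $ j \<longrightarrow> rot Q Z $ i $ j = 0)"
    by (rule orbit_maximizer[of "\<lambda>_ _. True" Z s])
      (use Z in \<open>auto simp: reflp_def symp_def transp_def blk_def\<close>)
  then obtain Q where Q: "orthogonal_matrix Q"
    "\<And>U. orthogonal_matrix U \<Longrightarrow> s \<bullet> diagv (rot U Z) \<le> s \<bullet> diagv (rot Q Z)"
    "\<And>i j. s $ i \<noteq> s $ j \<Longrightarrow> rot Q Z $ i $ j = 0"
    by blast
  have "blk (\<lambda>i j. s $ i = s $ j) (rot Q Z)" using Q(3) by (auto simp: blk_def)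
  then obtain R w where R: "orthogonal_matrix R" "blk (\<lambda>i j. s $ i = s $ j) R" "rot R (rot Q Z) = Diag w"
    using spectral_level_sets[OF rot_SymMat[OF Z]] by metis
  have QR: "orthogonal_matrix (Q ** R)" using Q(1) R(1) by (rule orthogonal_matrix_mul)
  have "Z = rot (transpose (Q ** R)) (Diag w)"
    using R(3) QR by (metis rot_cancel(2) rot_rot)
  then have gZ: "g Z = \<theta> w" using g_rot_Diag orthogonal_matrix_transpose[OF QR] by metis
  have "s \<bullet> diagv (rot Q Z) = Diag s \<bullet> rot Q Z" by (simp add: inner_Diag)
  also have "\<dots> = rot R (Diag s) \<bullet> rot R (rot Q Z)" using R(1) by (simp add: inner_rot_rot)
  also have "rot R (Diag s) = Diag s" using R by (intro blk_rot_Diag) auto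
  finally have "s \<bullet> diagv (rot Q Z) = s \<bullet> w" by (simp add: R(3) inner_Diag)
  with Q(2)[OF U] have "s \<bullet> diagv (rot U Z) - s \<bullet> x \<le> s \<bullet> (w - x)" by (simp add: inner_diff_right)
  then have "\<theta> x + ereal (s \<bullet> diagv (rot U Z) - s \<bullet> x) \<le> \<theta> x + ereal (s \<bullet> (w - x))"
    by (intro add_left_mono) simp
  also have "\<dots> \<le> \<theta> w" using s by (rule subdiffD)
  finally show ?thesis using gZ by simp
qed

lemma rot_subdiff:
  assumes s: "s \<in> subdiff UNIV \<theta> x" and P: "orthogonal_matrix P" and X: "rot P X = Diag x"
  shows "rot (transpose P) (Diag s) \<in> subdiff SymMat g X"
proof -
  have Xeq: "X = rot (transpose P) (Diag x)" using P X by (metis rot_cancel(2))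
  then have gX: "g X = \<theta> x" using g_rot_Diag orthogonal_matrix_transpose[OF P] by metis
  have "g X + ereal (rot (transpose P) (Diag s) \<bullet> (Z - X)) \<le> g Z" if "Z \<in> SymMat" for Z
  proof -
    have "rot (transpose P) (Diag s) \<bullet> (Z - X) = s \<bullet> diagv (rot P Z) - s \<bullet> x"
      by (simp add: inner_rot rot_diff X inner_diff_right inner_Diag)
    then show ?thesis using orbit_minorant[OF s P that] gX by simp
  qed
  moreover have "\<bar>g X\<bar> \<noteq> \<infinity>" using s gX by (auto simp: subdiff_def)
  moreover have "X \<in> SymMat" by (simp add: Xeq)
  ultimately show ?thesis by (simp add: subdiff_def)
qed

text \<open>Test the subgradient inequality at matrices with the spectrum of \<open>X\<close>: there
  \<open>g\<close> takes the same value, so only a comparison of inner products with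
  \<open>Y\<close> remains.\<close>

lemma gph_orbit_max:
  assumes XY: "(X, Y) \<in> gph_subdiff SymMat g" and P: "orthogonal_matrix P" "rot P X = Diag x"
    and R: "orthogonal_matrix R"
  shows "x \<bullet> diagv (rot R (rot P Y)) \<le> x \<bullet> diagv (rot P Y)"
proof -
  have Xeq: "X = rot (transpose P) (Diag x)" using P by (metis rot_cancel(2))
  define Z where "Z = rot (transpose P) (rot (transpose R) (Diag x))"
  have Z: "Z = rot (transpose (P ** R)) (Diag x)"
    by (simp add: Z_def rot_rot matrix_transpose_mul)
  have "g Z = \<theta> x" "g X = \<theta> x"
    unfolding Z using Xeq P R by (metis g_rot_Diag orthogonal_matrix_transpose orthogonal_matrix_mul)+
  moreover have "g X + ereal (Y \<bullet> (Z - X)) \<le> g Z" "\<bar>g X\<bar> \<noteq> \<infinity>"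
    using XY by (auto simp: gph_subdiff_def subdiff_def Z)
  ultimately have "Y \<bullet> Z \<le> Y \<bullet> X" by (auto simp: inner_diff_right)
  moreover have "Y \<bullet> X = x \<bullet> diagv (rot P Y)"
    by (simp add: inner_commute[of Y] Xeq inner_rot inner_Diag)
  moreover have "Y \<bullet> Z = x \<bullet> diagv (rot R (rot P Y))"
    by (simp add: inner_commute[of Y] Z_def inner_rot inner_Diag)
  ultimately show ?thesis by simp
qed

text \<open>Optimality under plane rotations makes \<open>Y\<close> block diagonal in an eigenbasis
  of \<open>X\<close>. Rotations inside the eigenspaces, which leave \<open>X\<close> diagonal, then
  diagonalize and sort \<open>Y\<close> there; across eigenspaces the second part of
  \<open>givens_optimal\<close> gives the order.\<close>

lemma gph_orth_diag:
  assumes XY: "(X, Y) \<in> gph_subdiff SymMat g"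
  obtains P where "P \<in> orth_diag X" "P \<in> orth_diag Y"
proof -
  have S: "X \<in> SymMat" "Y \<in> SymMat" using XY by (auto simp: gph_subdiff_def subdiff_def)
  obtain V where "V \<in> orth_diag X" using ex_orth_diag[OF S(1)] .
  note V = orth_diagD[OF this]
  define x where "x = eigvals X"
  let ?r = "\<lambda>i j. x $ i = x $ j"
  have VX: "rot V X = Diag x" using V by (simp add: x_def)
  have max: "x \<bullet> diagv (rot R (rot V Y)) \<le> x \<bullet> diagv (rot V Y)" if "orthogonal_matrix R" for R
    using gph_orbit_max[OF XY V(1) VX that] .
  have "(x $ i - x $ j) * rot V Y $ i $ j = 0" if "i \<noteq> j" for i j
    using that S(2) by (intro givens_optimal(1) max orthogonal_givens) auto
  then have "blk ?r (rot V Y)" unfolding blk_def by (metis mult_eq_0_iff right_minus_eq)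
  then obtain R w where R: "orthogonal_matrix R" "blk ?r R" "rot R (rot V Y) = Diag w"
    "\<And>i j. x $ i = x $ j \<Longrightarrow> i \<le> j \<Longrightarrow> w $ j \<le> w $ i"
    using spectral_level_sets[OF rot_SymMat[OF S(2)]] by metis
  define P where "P = V ** R"
  have P: "orthogonal_matrix P" using V(1) R(1) by (simp add: P_def orthogonal_matrix_mul)
  have PX: "rot P X = Diag x"
    unfolding P_def rot_rot[symmetric] VX using R by (intro blk_rot_Diag) auto
  have PY: "rot P Y = Diag w" by (simp add: P_def rot_rot[symmetric] R(3))
  have x: "sorted_vec x" using sorted_eigvals[OF S(1)] by (simp add: x_def)
  have "w $ j \<le> w $ i" if "i \<le> j" for i j
  proof (cases "x $ i = x $ j")
    case False
    then have "x $ i > x $ j" "i \<noteq> j" using x that by (force simp: sorted_vec_def)+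
    moreover have "(x $ i - x $ j) * (Diag w $ j $ j - Diag w $ i $ i) \<le> 0"
      using gph_orbit_max[OF XY P PX] \<open>i \<noteq> j\<close>
      by (intro givens_optimal(2)) (auto simp: PY orthogonal_givens)
    ultimately show ?thesis by (simp add: Diag_nth mult_le_0_iff)
  qed (use R(4) that in auto)
  then have "sorted_vec w" by (simp add: sorted_vec_def)
  then show ?thesis using that orth_diagI[OF P PX x] orth_diagI[OF P PY] by blast
qed

lemma gph_eigvals:
  assumes XY: "(X, Y) \<in> gph_subdiff SymMat g" and P: "P \<in> orth_diag X" "P \<in> orth_diag Y"
  shows "eigvals Y \<in> subdiff UNIV \<theta> (eigvals X)"
proof -
  note PX = orth_diagD[OF P(1)] and PY = orth_diagD[OF P(2)]
  have fin: "\<bar>g X\<bar> \<noteq> \<infinity>" and sub: "\<And>Z. Z \<in> SymMat \<Longrightarrow> g X + ereal (Y \<bullet> (Z - X)) \<le> g Z"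
    using XY by (auto simp: gph_subdiff_def subdiff_def)
  have "\<theta> (eigvals X) + ereal (eigvals Y \<bullet> (z - eigvals X)) \<le> \<theta> z" for z
  proof -
    have "Y \<bullet> (rot (transpose P) (Diag z) - X) = rot P Y \<bullet> (Diag z - rot P X)"
      by (simp add: inner_rot PX(1) rot_diff)
    also have "\<dots> = eigvals Y \<bullet> (z - eigvals X)"
      by (simp add: PX(2) PY(2) inner_Diag diagv_diff flip: Diag_diff)
    finally show ?thesis
      using sub[of "rot (transpose P) (Diag z)"] g_rot_Diag[OF orthogonal_matrix_transpose[OF PX(1)]]
      by simp
  qed
  then show ?thesis using fin by (simp add: subdiff_def)
qed

lemma subdiff_permute:
  assumes s: "s \<in> subdiff UNIV \<theta> x" and \<sigma>: "\<sigma> permutes UNIV" and x: "\<And>i. x $ \<sigma> i = x $ i"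
  shows "(\<chi> i. s $ \<sigma> i) \<in> subdiff UNIV \<theta> x"
proof -
  have "\<theta> x + ereal ((\<chi> i. s $ \<sigma> i) \<bullet> (z - x)) \<le> \<theta> z" for z
  proof -
    define z' where "z' = (\<chi> i. z $ inv \<sigma> i)"
    have "(\<chi> i. s $ \<sigma> i) \<bullet> (z - x) = (\<Sum>i\<in>UNIV. s $ \<sigma> i * (z $ i - x $ \<sigma> i))"
      by (simp add: inner_vec_def x)
    also have "\<dots> = (\<Sum>i\<in>UNIV. s $ \<sigma> i * (z' $ \<sigma> i - x $ \<sigma> i))"
      using \<sigma> by (simp add: z'_def permutes_inverses)
    also have "\<dots> = s \<bullet> (z' - x)"
      using sum.permute[OF \<sigma>, of "\<lambda>i. s $ i * (z' $ i - x $ i)"] by (simp add: inner_vec_def o_def)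
    finally show ?thesis
      using subdiffD[OF s, of z'] symmetric permutes_inv[OF \<sigma>] by (simp add: symmetric_fun_def z'_def)
  qed
  then show ?thesis using s by (simp add: subdiff_def)
qed

text \<open>Test the subgradient inequality at \<open>x\<close> with two coordinates swapped, where
  \<open>\<theta>\<close> has the same value. This sign is what makes every term of
  \<open>ups\<close> nonnegative.\<close>

lemma subdiff_ordered:
  assumes s: "s \<in> subdiff UNIV \<theta> x"
  shows "0 \<le> (s $ i - s $ j) * (x $ i - x $ j)"
proof (cases "i = j")
  case False
  define \<sigma> where "\<sigma> = Transposition.transpose i j"
  have \<sigma>: "\<sigma> permutes UNIV" unfolding \<sigma>_def by (rule permutes_swap_id) auto
  have "\<theta> (\<chi> k. x $ \<sigma> k) = \<theta> x" using symmetric \<sigma> by (simp add: symmetric_fun_def)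
  then have "s \<bullet> ((\<chi> k. x $ \<sigma> k) - x) \<le> 0"
    using subdiffD[OF s, of "\<chi> k. x $ \<sigma> k"] s by (auto simp: subdiff_def)
  moreover have "(\<chi> k. x $ \<sigma> k) - x = (x $ j - x $ i) *\<^sub>R (axis i 1 - axis j 1)"
    using False by (auto simp: vec_eq_iff \<sigma>_def Transposition.transpose_def axis_nth_if)
  ultimately show ?thesis
    by (simp add: inner_diff_right inner_axis algebra_simps)
qed simp

end

section \<open>The normal cone to the subdifferential\<close>

definition ncone :: "('a::euclidean_space \<Rightarrow> ereal) \<Rightarrow> 'a \<Rightarrow> 'a \<Rightarrow> 'a set" where
  "ncone \<theta> x y = {w. \<forall>s\<in>subdiff UNIV \<theta> x. s \<bullet> w \<le> y \<bullet> w}"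

lemma ncone_0: "0 \<in> ncone \<theta> x y"
  by (simp add: ncone_def)

lemma ncone_add: "v \<in> ncone \<theta> x y \<Longrightarrow> w \<in> ncone \<theta> x y \<Longrightarrow> v + w \<in> ncone \<theta> x y"
  by (force simp: ncone_def inner_add_right intro: add_mono)

lemma ncone_scaleR: "w \<in> ncone \<theta> x y \<Longrightarrow> t \<ge> 0 \<Longrightarrow> t *\<^sub>R w \<in> ncone \<theta> x y"
  by (simp add: ncone_def mult_left_mono)

lemma ncone_sum: "finite A \<Longrightarrow> (\<And>k. k \<in> A \<Longrightarrow> f k \<in> ncone \<theta> x y) \<Longrightarrow> sum f A \<in> ncone \<theta> x y"
  by (induction rule: finite_induct) (auto simp: ncone_0 ncone_add)

lemma convex_ncone: "convex (ncone \<theta> x y)"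
  by (intro convexI ncone_add ncone_scaleR) auto

lemma ncone_of_le:
  assumes x: "\<theta> x = ereal r" and "\<theta> (x + w) \<le> ereal (r + y \<bullet> w)"
  shows "w \<in> ncone \<theta> x y"
proof -
  have "s \<bullet> w \<le> y \<bullet> w" if s: "s \<in> subdiff UNIV \<theta> x" for s
    using order_trans[OF subdiffD[OF s, of "x + w"] assms(2)] x by simp
  then show ?thesis by (simp add: ncone_def)
qed

context symmetric_function
begin

text \<open>A permutation fixing \<open>x\<close> permutes the subdifferential; if it also fixes
  \<open>y\<close>, the defining inequalities of the cone are permuted among themselves.\<close>

lemma ncone_permute:
  assumes w: "w \<in> ncone \<theta> x y" and \<sigma>: "\<sigma> permutes UNIV" and xy: "\<And>i. x $ \<sigma> i = x $ i" "\<And>i. y $ \<sigma> i = y $ i"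
  shows "(\<chi> i. w $ \<sigma> i) \<in> ncone \<theta> x y"
  unfolding ncone_def
proof safe
  fix s assume s: "s \<in> subdiff UNIV \<theta> x"
  have inv: "inv \<sigma> permutes UNIV" using \<sigma> by (rule permutes_inv)
  have "x $ inv \<sigma> i = x $ i" for i using xy(1)[of "inv \<sigma> i"] \<sigma> by (simp add: permutes_inverses)
  then have s': "(\<chi> i. s $ inv \<sigma> i) \<in> subdiff UNIV \<theta> x" using subdiff_permute[OF s inv] by simp
  have sw: "u \<bullet> (\<chi> i. w $ \<sigma> i) = (\<chi> i. u $ inv \<sigma> i) \<bullet> w" for u
    using sum.permute[OF \<sigma>, of "\<lambda>i. u $ inv \<sigma> i * w $ i"] \<sigma>
    by (simp add: inner_vec_def o_def permutes_inverses)
  have "y $ inv \<sigma> i = y $ i" for i using xy(2)[of "inv \<sigma> i"] \<sigma> by (simp add: permutes_inverses)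
  then have y: "(\<chi> i. y $ inv \<sigma> i) = y" by (simp add: vec_eq_iff)
  show "s \<bullet> (\<chi> i. w $ \<sigma> i) \<le> y \<bullet> (\<chi> i. w $ \<sigma> i)"
    using w s' unfolding sw y ncone_def by blast
qed

end

section \<open>Curves of orthogonal matrices\<close>

text \<open>\<open>U\<close> is the inverse of \<open>mat 1 - B\<close> times
  \<open>mat 1 + B\<close>; the inverse exists because \<open>B *v x\<close> is orthogonal to
  \<open>x\<close>. The same orthogonality, applied to
  \<open>U *v v - v = B *v (v + U *v v)\<close>, shows that \<open>U\<close> preserves norms. The
  implicit form is kept because expansions follow by substituting it into itself.\<close>

lemma ex_cayley:
  fixes B :: "real^'n^'n"
  assumes B: "transpose B = - B"
  shows "\<exists>U. orthogonal_matrix U \<and> U = mat 1 + B ** (mat 1 + U)"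
proof -
  have skew: "(B *v x) \<bullet> x = 0" for x
  proof -
    have "x \<bullet> (B *v x) = (transpose B *v x) \<bullet> x" by (simp add: dot_lmul_matrix)
    also have "\<dots> = - ((B *v x) \<bullet> x)"
      unfolding B using matrix_vector_mult_diff_rdistrib[of 0 B x] by simp
    finally show ?thesis by (simp add: inner_commute)
  qed
  have "x = 0" if "(mat 1 - B) *v x = 0" for x
    using that skew[of x] by (simp add: matrix_vector_mult_diff_rdistrib)
  then obtain N where "N ** (mat 1 - B) = mat 1"
    using matrix_left_invertible_ker[of "mat 1 - B"] by blast
  then have N: "(mat 1 - B) ** N = mat 1" by (simp add: matrix_left_right_inverse)
  define U where "U = N ** (mat 1 + B)"
  have "(mat 1 - B) ** U = mat 1 + B" by (simp add: U_def matrix_mul_assoc N)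
  then have "U - B ** U = mat 1 + B" by (simp only: matrix_mult.diff_left matrix_mul_lid)
  moreover have "mat 1 + B + B ** U = mat 1 + B ** (mat 1 + U)"
    by (simp add: matrix_mult.add_right)
  ultimately have U: "U = mat 1 + B ** (mat 1 + U)" by (metis diff_eq_eq)
  have "norm (U *v v) = norm v" for v
  proof -
    have "(mat 1 + B ** (mat 1 + U)) *v v = v + B *v (v + U *v v)"
      by (simp add: matrix_vector_mult_add_rdistrib matrix_vector_mul_assoc[symmetric])
    then have "U *v v - v = B *v (v + U *v v)" by (metis U add_diff_cancel_left')
    then have "(U *v v - v) \<bullet> (v + U *v v) = 0" by (simp add: skew)
    moreover have "(z - v) \<bullet> (v + z) = z \<bullet> z - v \<bullet> v" for z
      using inner_commute[of z v] by (simp only: inner_diff_left inner_add_right)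
    ultimately have "(U *v v) \<bullet> (U *v v) = v \<bullet> v" by simp
    then show ?thesis by (simp add: norm_eq_sqrt_inner)
  qed
  then have "orthogonal_transformation ((*v) U)"
    unfolding orthogonal_transformation using matrix_vector_mul_linear by blast
  then have "orthogonal_matrix U"
    unfolding orthogonal_transformation_matrix by (simp only: matrix_of_matrix_vector_mul)
  from conjI[OF this U] show ?thesis by (rule exI)
qed

text \<open>The Cayley transform of \<open>(t / 2) *\<^sub>R A\<close> agrees with the exponential
  of \<open>t *\<^sub>R A\<close> to second order. Its equation
  \<open>U t - mat 1 = (t / 2) *\<^sub>R (A ** (mat 1 + U t))\<close> bootstraps: boundedness of
  \<open>U\<close> gives the limit, the limit gives the first derivative, and this gives the second
  order term.\<close>

lemma ex_orthogonal_curve: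
  fixes A :: "real^'n^'n"
  assumes A: "transpose A = - A"
  obtains U where "\<And>t. orthogonal_matrix (U t)"
    "(U \<longlongrightarrow> mat 1) (at_right 0)"
    "((\<lambda>t. (1 / t) *\<^sub>R (U t - mat 1)) \<longlongrightarrow> A) (at_right 0)"
    "((\<lambda>t. (1 / t\<^sup>2) *\<^sub>R (U t - mat 1 - t *\<^sub>R A)) \<longlongrightarrow> (1 / 2) *\<^sub>R (A ** A)) (at_right 0)"
proof -
  have "transpose ((t / 2) *\<^sub>R A) = - ((t / 2) *\<^sub>R A)" for t
    by (simp add: transpose_scaleR A)
  then have "\<forall>t. \<exists>U. orthogonal_matrix U \<and> U = mat 1 + ((t / 2) *\<^sub>R A) ** (mat 1 + U)"
    using ex_cayley by blast
  then obtain U where orth: "\<And>t. orthogonal_matrix (U t)"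
    and eq: "\<And>t. U t = mat 1 + ((t / 2) *\<^sub>R A) ** (mat 1 + U t)"
    by metis
  have diff: "U t - mat 1 = (t / 2) *\<^sub>R (A ** (mat 1 + U t))" for t
    by (metis add_diff_cancel_left' eq matrix_mult.scaleR_left)
  obtain K where K: "\<And>t. norm (U t) \<le> K" using bounded_orthogonal orth unfolding bounded_iff by blast
  obtain K' where K': "\<And>(M :: real^'n^'n) (N :: real^'n^'n). norm (M ** N) \<le> norm M * norm N * K'" "K' \<ge> 0"
    using matrix_mult.nonneg_bounded by blast
  define L where "L = norm A * (norm (mat 1 :: real^'n^'n) + K) * K'"
  have "norm (A ** (mat 1 + U t)) \<le> L" for t
  proof -
    have "norm (mat 1 + U t) \<le> norm (mat 1 :: real^'n^'n) + K"
      using norm_triangle_ineq[of "mat 1" "U t"] K[of t] by simp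
    then have "norm A * norm (mat 1 + U t) * K' \<le> L"
      unfolding L_def using K'(2) by (intro mult_right_mono mult_left_mono) auto
    then show ?thesis using K'(1)[of A "mat 1 + U t"] by simp
  qed
  then have "norm (U t - mat 1) \<le> \<bar>t / 2\<bar> * L" for t
    unfolding diff by (simp add: mult_left_mono)
  then have "((\<lambda>t. U t - mat 1) \<longlongrightarrow> 0) (at_right 0)"
  proof (rule Lim_null_comparison[where g = "\<lambda>t. \<bar>t / 2\<bar> * L", OF always_eventually, rule_format])
    have "((\<lambda>t. \<bar>t / 2\<bar> * L) \<longlongrightarrow> \<bar>0 / 2\<bar> * L) (at_right 0)" by (intro tendsto_intros) auto
    then show "((\<lambda>t. \<bar>t / 2\<bar> * L) \<longlongrightarrow> 0) (at_right 0)" by simp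
  qed
  then have lim0: "(U \<longlongrightarrow> mat 1) (at_right 0)" by (simp add: LIM_zero_iff)
  have "((\<lambda>t. (1 / 2) *\<^sub>R (A ** (mat 1 + U t))) \<longlongrightarrow> (1 / 2) *\<^sub>R (A ** (mat 1 + mat 1))) (at_right 0)"
    by (intro tendsto_intros matrix_mult.tendsto lim0)
  moreover have "(1 / 2) *\<^sub>R (A ** (mat 1 + mat 1)) = A"
    by (simp only: matrix_mult.add_right matrix_mul_rid scaleR_add_right) (simp flip: scaleR_add_left)
  moreover have "eventually (\<lambda>t. (1 / 2) *\<^sub>R (A ** (mat 1 + U t)) = (1 / t) *\<^sub>R (U t - mat 1)) (at_right 0)"
    using eventually_at_right_less by eventually_elim (simp add: diff)
  ultimately have lim1: "((\<lambda>t. (1 / t) *\<^sub>R (U t - mat 1)) \<longlongrightarrow> A) (at_right 0)"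
    by (simp add: tendsto_cong)
  have "((\<lambda>t. (1 / 2) *\<^sub>R (A ** ((1 / t) *\<^sub>R (U t - mat 1)))) \<longlongrightarrow> (1 / 2) *\<^sub>R (A ** A)) (at_right 0)"
    by (intro tendsto_intros matrix_mult.tendsto lim1)
  moreover have "eventually (\<lambda>t. (1 / 2) *\<^sub>R (A ** ((1 / t) *\<^sub>R (U t - mat 1)))
      = (1 / t\<^sup>2) *\<^sub>R (U t - mat 1 - t *\<^sub>R A)) (at_right 0)"
    using eventually_at_right_less
  proof eventually_elim
    case (elim t)
    have *: "A ** (mat 1 + U t) = A ** (U t - mat 1) + 2 *\<^sub>R A"
      by (simp add: matrix_mult.add_right matrix_mult.diff_right scaleR_2)
    have "U t - mat 1 - t *\<^sub>R A = (t / 2) *\<^sub>R (A ** (mat 1 + U t)) - t *\<^sub>R A"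
      by (simp only: diff)
    also have "\<dots> = (t / 2) *\<^sub>R (A ** (U t - mat 1))"
      unfolding * by (simp add: scaleR_add_right)
    finally have "U t - mat 1 - t *\<^sub>R A = (t / 2) *\<^sub>R (A ** (U t - mat 1))" .
    then show ?case using elim
      by (simp add: matrix_mult.scaleR_right power2_eq_square)
  qed
  ultimately have lim2: "((\<lambda>t. (1 / t\<^sup>2) *\<^sub>R (U t - mat 1 - t *\<^sub>R A)) \<longlongrightarrow> (1 / 2) *\<^sub>R (A ** A)) (at_right 0)"
    by (simp add: tendsto_cong)
  show ?thesis using that orth lim0 lim1 lim2 by blast
qed

text \<open>The limits are the commutator of \<open>A\<close> with \<open>M\<close> and half the
  double commutator. One curve works for all \<open>M\<close>, since the upper bound later
  conjugates two matrices by the same \<open>U t\<close>.\<close>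

lemma conjugation_expansion:
  fixes A :: "real^'n^'n"
  assumes A: "transpose A = - A"
  obtains U where "\<And>t. orthogonal_matrix (U t)"
    "(U \<longlongrightarrow> mat 1) (at_right 0)"
    "\<And>M. ((\<lambda>t. (1 / t) *\<^sub>R (rot (transpose (U t)) M - M)) \<longlongrightarrow> A ** M - M ** A) (at_right 0)"
    "\<And>M. ((\<lambda>t. (1 / t\<^sup>2) *\<^sub>R (rot (transpose (U t)) M - M - t *\<^sub>R (A ** M - M ** A))) \<longlongrightarrow>
       (1 / 2) *\<^sub>R (A ** A ** M + M ** A ** A) - A ** M ** A) (at_right 0)"
proof -
  obtain U where U: "\<And>t. orthogonal_matrix (U t)"
    "(U \<longlongrightarrow> mat 1) (at_right 0)"
    "((\<lambda>t. (1 / t) *\<^sub>R (U t - mat 1)) \<longlongrightarrow> A) (at_right 0)"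
    "((\<lambda>t. (1 / t\<^sup>2) *\<^sub>R (U t - mat 1 - t *\<^sub>R A)) \<longlongrightarrow> (1 / 2) *\<^sub>R (A ** A)) (at_right 0)"
    using ex_orthogonal_curve[OF A] by blast
  define V where "V t = (1 / t) *\<^sub>R (U t - mat 1)" for t
  define S where "S t = (1 / t\<^sup>2) *\<^sub>R (U t - mat 1 - t *\<^sub>R A)" for t
  have V: "(V \<longlongrightarrow> A) (at_right 0)" and S: "(S \<longlongrightarrow> (1 / 2) *\<^sub>R (A ** A)) (at_right 0)"
    using U by (simp_all add: V_def[abs_def] S_def[abs_def])
  have UV: "U t = mat 1 + t *\<^sub>R V t" and VS: "V t = A + t *\<^sub>R S t" if "t > 0" for t
    using that by (simp_all add: V_def S_def power2_eq_square algebra_simps)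
  have expand: "rot (transpose (U t)) M - M = t *\<^sub>R (V t ** M + M ** transpose (V t)) +
      (t * t) *\<^sub>R (V t ** M ** transpose (V t))" if "t > 0" for t M
    unfolding rot_def UV[OF that]
    by (simp add: transpose_add transpose_scaleR matrix_mult.add_left matrix_mult.add_right
        matrix_mult.scaleR_left matrix_mult.scaleR_right algebra_simps)
  have "((\<lambda>t. (1 / t) *\<^sub>R (rot (transpose (U t)) M - M)) \<longlongrightarrow> A ** M - M ** A) (at_right 0)" for M
  proof -
    have "((\<lambda>t. V t ** M + M ** transpose (V t) + t *\<^sub>R (V t ** M ** transpose (V t))) \<longlongrightarrow>
        A ** M + M ** transpose A + 0 *\<^sub>R (A ** M ** transpose A)) (at_right 0)"
      by (intro tendsto_intros matrix_mult.tendsto tendsto_transpose V)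
    moreover have "eventually (\<lambda>t. V t ** M + M ** transpose (V t) + t *\<^sub>R (V t ** M ** transpose (V t))
        = (1 / t) *\<^sub>R (rot (transpose (U t)) M - M)) (at_right 0)"
      using eventually_at_right_less by eventually_elim (simp add: expand algebra_simps)
    ultimately show ?thesis
      by (simp add: A matrix_mult.minus_right tendsto_cong)
  qed
  moreover have "((\<lambda>t. (1 / t\<^sup>2) *\<^sub>R (rot (transpose (U t)) M - M - t *\<^sub>R (A ** M - M ** A))) \<longlongrightarrow>
       (1 / 2) *\<^sub>R (A ** A ** M + M ** A ** A) - A ** M ** A) (at_right 0)" for M
  proof -
    have "((\<lambda>t. S t ** M + M ** transpose (S t) + V t ** M ** transpose (V t)) \<longlongrightarrow>
        ((1 / 2) *\<^sub>R (A ** A)) ** M + M ** transpose ((1 / 2) *\<^sub>R (A ** A)) + A ** M ** transpose A) (at_right 0)"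
      by (intro tendsto_intros matrix_mult.tendsto tendsto_transpose V S)
    moreover have "eventually (\<lambda>t. S t ** M + M ** transpose (S t) + V t ** M ** transpose (V t)
        = (1 / t\<^sup>2) *\<^sub>R (rot (transpose (U t)) M - M - t *\<^sub>R (A ** M - M ** A))) (at_right 0)"
      using eventually_at_right_less
    proof eventually_elim
      case (elim t)
      have "rot (transpose (U t)) M - M - t *\<^sub>R (A ** M - M ** A) =
          (t * t) *\<^sub>R (S t ** M + M ** transpose (S t) + V t ** M ** transpose (V t))"
        unfolding expand[OF elim] 
        by (subst (1 2) VS[OF elim]) (simp add: A transpose_add transpose_scaleR matrix_mult.add_left
          matrix_mult.add_right matrix_mult.scaleR_left matrix_mult.scaleR_right matrix_mult.minus_right
          matrix_mult.diff_left matrix_mult.diff_right algebra_simps)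
      then show ?case using elim by (simp add: power2_eq_square)
    qed
    moreover have "((1 / 2) *\<^sub>R (A ** A)) ** M + M ** transpose ((1 / 2) *\<^sub>R (A ** A)) + A ** M ** transpose A
        = (1 / 2) *\<^sub>R (A ** A ** M + M ** A ** A) - A ** M ** A"
      by (simp add: A matrix_transpose_mul transpose_scaleR matrix_mult.scaleR_left matrix_mult.scaleR_right
          matrix_mult.minus_right matrix_mult.minus_left matrix_mul_assoc algebra_simps)
    ultimately show ?thesis by (simp add: tendsto_cong)
  qed
  ultimately show ?thesis using that U(1,2) by blast
qed

section \<open>Lower and upper limits along directions\<close>

lemma filterlim_dir_filter:
  "filterlim fst (at_right 0) (dir_filter E h)" "filterlim snd (nhds h) (dir_filter E h)"
proof -
  show "filterlim fst (at_right 0) (dir_filter E h)"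
    unfolding dir_filter_def by (rule filterlim_fst)
  have "filterlim snd (inf (nhds h) (principal E)) (dir_filter E h)"
    unfolding dir_filter_def by (rule filterlim_snd)
  then show "filterlim snd (nhds h) (dir_filter E h)"
    by (rule filterlim_mono) auto
qed

lemma eventually_dir_filter:
  "eventually (\<lambda>z. 0 < fst z \<and> snd z \<in> E) (dir_filter E h)"
proof -
  have "eventually (\<lambda>t::real. 0 < t) (at_right 0)" by (rule eventually_at_right_less)
  moreover have "eventually (\<lambda>h'. h' \<in> E) (inf (nhds h) (principal E))"
    by (simp add: eventually_inf_principal)
  ultimately show ?thesis
    unfolding dir_filter_def
    by (auto simp: eventually_prod_filter intro!: exI[of _ "\<lambda>t::real. 0 < t"] exI[of _ "\<lambda>h'. h' \<in> E"])
qed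

lemma le_Liminf_of_tendsto:
  fixes f :: "'a \<Rightarrow> ereal"
  assumes "eventually (\<lambda>z. ereal (\<phi> z) \<le> f z) F" "(\<phi> \<longlongrightarrow> l) F"
  shows "ereal l \<le> Liminf F f"
  unfolding le_Liminf_iff
proof (intro allI impI)
  fix y assume "y < ereal l"
  have "((\<lambda>z. ereal (\<phi> z)) \<longlongrightarrow> ereal l) F" using assms(2) by (simp add: lim_ereal)
  then have "eventually (\<lambda>z. y < ereal (\<phi> z)) F" using \<open>y < ereal l\<close> by (rule order_tendstoD)
  with assms(1) show "eventually (\<lambda>z. y < f z) F" by eventually_elim auto
qed

lemma Liminf_le_of_curve:
  fixes f :: "'a \<Rightarrow> ereal"
  assumes \<gamma>: "filterlim \<gamma> F G" and G: "G \<noteq> bot"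
    and le: "eventually (\<lambda>t. f (\<gamma> t) \<le> ereal (\<phi> t)) G" and \<phi>: "(\<phi> \<longlongrightarrow> l) G"
  shows "Liminf F f \<le> ereal l"
proof (rule ccontr)
  assume "\<not> Liminf F f \<le> ereal l"
  then obtain y where y: "ereal l < y" "y < Liminf F f" by (meson dense not_le)
  have "eventually (\<lambda>z. y < f z) F" using y(2) by (rule less_LiminfD)
  then have "eventually (\<lambda>t. y < f (\<gamma> t)) G" using \<gamma> by (rule eventually_compose_filterlim)
  moreover have "((\<lambda>t. ereal (\<phi> t)) \<longlongrightarrow> ereal l) G" using \<phi> by (simp add: lim_ereal)
  then have "eventually (\<lambda>t. ereal (\<phi> t) < y) G" using y(1) by (rule order_tendstoD)
  ultimately have "eventually (\<lambda>t. False) G" using le by eventually_elim auto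
  then show False using G by (simp add: trivial_limit_def)
qed

lemma quotient_ge:
  assumes "f0 = ereal r" "ereal (r + q) \<le> f1" "k > 0"
  shows "ereal (q / k) \<le> (f1 - f0) / ereal k" "ereal ((q - u) / k) \<le> (f1 - f0 - ereal u) / ereal k"
  using assms by (cases f1; simp add: divide_right_mono)+

lemma quotient_le:
  assumes "f0 = ereal r" "f1 \<le> ereal (r + q)" "k > 0"
  shows "(f1 - f0) / ereal k \<le> ereal (q / k)" "(f1 - f0 - ereal u) / ereal k \<le> ereal ((q - u) / k)"
  using assms by (cases f1; simp add: divide_right_mono)+

lemma subderiv_ge_inner:
  assumes "subspace E" and M: "M \<in> subdiff E f x"
  shows "ereal (M \<bullet> h) \<le> subderiv E f x h"
  unfolding subderiv_def
proof (rule le_Liminf_of_tendsto)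
  obtain r where r: "f x = ereal r" using subdiff_finite[OF M] by blast
  show "eventually (\<lambda>z. ereal (M \<bullet> snd z) \<le> (case z of (t, h') \<Rightarrow> (f (x + t *\<^sub>R h') - f x) / ereal t)) (dir_filter E h)"
    using eventually_dir_filter
  proof eventually_elim
    case (elim z)
    obtain t h' where z: "z = (t, h')" "t > 0" "h' \<in> E" using elim by (cases z) auto
    have "x + t *\<^sub>R h' \<in> E" using M z(3) assms(1) by (simp add: subdiff_def subspace_add subspace_scale)
    then have "ereal (r + t * (M \<bullet> h')) \<le> f (x + t *\<^sub>R h')" using M r by (auto simp: subdiff_def)
    from quotient_ge(1)[OF r this z(2)] show ?case using z by simp
  qed
  show "((\<lambda>z. M \<bullet> snd z) \<longlongrightarrow> M \<bullet> h) (dir_filter E h)"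
    by (intro tendsto_intros filterlim_dir_filter)
qed

text \<open>If \<open>M\<close> beats \<open>y\<close> on \<open>h\<close>, its affine minorant
  bounds the quotient below by \<open>2 * ((M - y) \<bullet> h') / t\<close>, which tends to
  infinity. Thus finiteness of the second order object forces a first order condition.\<close>

lemma subderiv2_finite_imp_inner_le:
  assumes "subspace E" and M: "M \<in> subdiff E f x" and fin: "subderiv2 E f x y h < \<infinity>"
  shows "M \<bullet> h \<le> y \<bullet> h"
proof (rule ccontr)
  assume neg: "\<not> M \<bullet> h \<le> y \<bullet> h"
  obtain r where r: "f x = ereal r" using subdiff_finite[OF M] by blast
  let ?F = "dir_filter E h"
  let ?q = "\<lambda>(t, h'). (f (x + t *\<^sub>R h') - f x - ereal (t * (y \<bullet> h'))) / ereal (t\<^sup>2 / 2)"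
  have lb: "eventually (\<lambda>z. ereal (2 * ((M - y) \<bullet> snd z) / fst z) \<le> ?q z) ?F"
    using eventually_dir_filter
  proof eventually_elim
    case (elim z)
    obtain t h' where z: "z = (t, h')" "t > 0" "h' \<in> E" using elim by (cases z) auto
    have "x + t *\<^sub>R h' \<in> E" using M z(3) assms(1) by (simp add: subdiff_def subspace_add subspace_scale)
    then have "ereal (r + t * (M \<bullet> h')) \<le> f (x + t *\<^sub>R h')" using M r by (auto simp: subdiff_def)
    from quotient_ge(2)[OF r this, of "t\<^sup>2 / 2" "t * (y \<bullet> h')"]
    have "ereal ((t * (M \<bullet> h') - t * (y \<bullet> h')) / (t\<^sup>2 / 2)) \<le> ?q z" using z by simp
    moreover have "(t * (M \<bullet> h') - t * (y \<bullet> h')) / (t\<^sup>2 / 2) = 2 * ((M - y) \<bullet> h') / t"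
      using z(2) by (simp add: inner_diff_left power2_eq_square field_simps)
    ultimately show ?case using z by simp
  qed
  have "filterlim (\<lambda>z. (2 * ((M - y) \<bullet> snd z)) * inverse (fst z)) at_top ?F"
  proof (rule filterlim_tendsto_pos_mult_at_top)
    show "((\<lambda>z. 2 * ((M - y) \<bullet> snd z)) \<longlongrightarrow> 2 * ((M - y) \<bullet> h)) ?F"
      by (intro tendsto_intros filterlim_dir_filter)
    show "0 < 2 * ((M - y) \<bullet> h)" using neg by (simp add: inner_diff_left)
    show "filterlim (\<lambda>z. inverse (fst z)) at_top ?F"
      using filterlim_compose[OF filterlim_inverse_at_top_right filterlim_dir_filter(1)] .
  qed
  then have top: "eventually (\<lambda>z. B < 2 * ((M - y) \<bullet> snd z) / fst z) ?F" for B
    by (simp add: filterlim_at_top_dense divide_inverse)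
  have "\<infinity> \<le> Liminf ?F ?q"
    unfolding le_Liminf_iff
  proof (intro allI impI)
    fix u :: ereal assume "u < \<infinity>"
    then obtain B where B: "u \<le> ereal B" by (cases u) auto
    show "eventually (\<lambda>z. u < ?q z) ?F"
      using lb top[of B]
    proof eventually_elim
      case (elim z)
      have "u \<le> ereal B" by (rule B)
      also have "ereal B < ereal (2 * ((M - y) \<bullet> snd z) / fst z)" using elim(2) by simp
      also have "\<dots> \<le> ?q z" by (rule elim(1))
      finally show ?case .
    qed
  qed
  then show False using fin by (simp add: subderiv2_def)
qed

section \<open>The second subderivative of a spectral function\<close>

text \<open>The form \<open>Upsilon\<close> in the coordinates of \<open>P\<close>. Summing over
  both orders of a pair replaces the factor 2, and division by zero yielding zero removes the pairs
  with equal \<open>x\<close>.\<close>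

definition ups :: "real^'n \<Rightarrow> real^'n \<Rightarrow> real^'n^'n \<Rightarrow> real" where
  "ups x y N = (\<Sum>i\<in>UNIV. \<Sum>j\<in>UNIV. (y $ i - y $ j) / (x $ i - x $ j) * (N $ i $ j)\<^sup>2)"

text \<open>Since \<open>x / 0 = 0\<close>, this generator vanishes where \<open>x $ i = x $ j\<close>.\<close>

definition skewgen :: "real^'n \<Rightarrow> real^'n^'n \<Rightarrow> real^'n^'n" where
  "skewgen x N = (\<chi> i j. - N $ i $ j / (x $ i - x $ j))"

lemma skewgen_nth: "skewgen x N $ i $ j = - N $ i $ j / (x $ i - x $ j)"
  by (simp add: skewgen_def)

lemma transpose_skewgen:
  assumes "N \<in> SymMat"
  shows "transpose (skewgen x N) = - skewgen x N"
proof -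
  have "n / (u - v) = - (n / (v - u))" for n u v :: real
    by (metis divide_minus_right minus_diff_eq)
  then have eq: "N $ j $ i / (x $ j - x $ i) = - (N $ i $ j / (x $ i - x $ j))" for i j
    using SymMat_nth[OF assms, of i j] by metis
  have "transpose (skewgen x N) $ i $ j = (- skewgen x N) $ i $ j" for i j
    by (simp add: transpose_def skewgen_nth eq[of j i])
  then show ?thesis by (simp only: vec_eq_iff) blast
qed

lemma commutator_Diag_nth: "(A ** Diag y - Diag y ** A) $ i $ j = A $ i $ j * (y $ j - y $ i)"
  by (simp add: Diag_mult_nth mult_Diag_nth algebra_simps)

lemma commutator_Diag_inner_Diag: "(A ** Diag y - Diag y ** A) \<bullet> Diag x = 0"
  unfolding inner_commute[of _ "Diag x"] inner_Diag
  by (simp add: inner_vec_def commutator_Diag_nth del: vector_minus_component)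

lemma commutator_inner_ups: "(skewgen x N ** Diag y - Diag y ** skewgen x N) \<bullet> N = ups x y N"
  unfolding inner_vec_def ups_def commutator_Diag_nth inner_real_def
  by (intro sum.cong refl) (simp add: skewgen_nth power2_eq_square algebra_simps diff_divide_distrib)

text \<open>For skew \<open>A\<close> the commutator with \<open>A\<close> is skew-adjoint, so half
  the double commutator of \<open>Diag y\<close> against \<open>Diag x\<close> is minus half the
  inner product of the two single commutators.\<close>

lemma second_order_inner:
  fixes A :: "real^'n^'n"
  assumes A: "transpose A = - A"
  shows "((1 / 2) *\<^sub>R (A ** A ** Diag y + Diag y ** A ** A) - A ** Diag y ** A) \<bullet> Diag x
    = - (1 / 2) * (\<Sum>i\<in>UNIV. \<Sum>j\<in>UNIV. (A $ i $ j)\<^sup>2 * (x $ i - x $ j) * (y $ i - y $ j))"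
proof -
  have sk: "A $ j $ i = - A $ i $ j" for i j
    using arg_cong[OF A, of "\<lambda>M. M $ i $ j"] by (simp add: transpose_def)
  have "((1 / 2) *\<^sub>R (A ** A ** Diag y + Diag y ** A ** A) - A ** Diag y ** A) \<bullet> Diag x
     = (\<Sum>i\<in>UNIV. x $ i * ((A ** A) $ i $ i * y $ i - (A ** Diag y ** A) $ i $ i))"
    unfolding inner_commute[of _ "Diag x"] inner_Diag matrix_mul_assoc[symmetric, of "Diag y"]
    by (simp add: inner_vec_def Diag_mult_nth mult_Diag_nth algebra_simps)
  also have "\<dots> = (\<Sum>i\<in>UNIV. \<Sum>j\<in>UNIV. (A $ i $ j)\<^sup>2 * x $ i * (y $ j - y $ i))"
  proof (intro sum.cong refl)
    fix i
    have "(A ** A) $ i $ i = - (\<Sum>j\<in>UNIV. (A $ i $ j)\<^sup>2)"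
      by (simp add: matrix_matrix_mult_def sk[of i] power2_eq_square sum_negf)
    moreover have "(A ** Diag y ** A) $ i $ i = - (\<Sum>j\<in>UNIV. (A $ i $ j)\<^sup>2 * y $ j)"
      unfolding matrix_mul_assoc[symmetric, of A]
      by (simp add: matrix_matrix_mult_def[of A] Diag_mult_nth sk[of i] power2_eq_square sum_negf mult_ac)
    ultimately show "x $ i * ((A ** A) $ i $ i * y $ i - (A ** Diag y ** A) $ i $ i)
        = (\<Sum>j\<in>UNIV. (A $ i $ j)\<^sup>2 * x $ i * (y $ j - y $ i))"
      by (simp add: sum_distrib_left sum_distrib_right sum_subtractf algebra_simps)
  qed
  also have "\<dots> = - (1 / 2) * (\<Sum>i\<in>UNIV. \<Sum>j\<in>UNIV. (A $ i $ j)\<^sup>2 * (x $ i - x $ j) * (y $ i - y $ j))"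
    (is "?S = _")
  proof -
    have "?S = (\<Sum>i\<in>UNIV. \<Sum>j\<in>UNIV. (A $ i $ j)\<^sup>2 * x $ j * (y $ i - y $ j))"
      by (subst sum.swap, intro sum.cong refl) (metis sk power2_minus)
    then have "?S + ?S = ?S + (\<Sum>i\<in>UNIV. \<Sum>j\<in>UNIV. (A $ i $ j)\<^sup>2 * x $ j * (y $ i - y $ j))"
      by (rule arg_cong)
    also have "\<dots> = (\<Sum>i\<in>UNIV. \<Sum>j\<in>UNIV. - ((A $ i $ j)\<^sup>2 * (x $ i - x $ j) * (y $ i - y $ j)))"
      unfolding sum.distrib[symmetric] by (intro sum.cong refl) (simp add: algebra_simps)
    finally show ?thesis by (simp add: sum_negf)
  qed
  finally show ?thesis .
qed

lemma skewgen_sum_ups: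
  "(\<Sum>i\<in>UNIV. \<Sum>j\<in>UNIV. (skewgen x N $ i $ j)\<^sup>2 * (x $ i - x $ j) * (y $ i - y $ j)) = ups x y N"
  unfolding ups_def by (intro sum.cong refl) (simp add: skewgen_nth power2_eq_square)


section \<open>Lower and upper bounds for the subderivatives\<close>

lemma rot_trace_eigvals:
  assumes "P \<in> orth_diag Y"
  shows "Y \<bullet> H = eigvals Y \<bullet> diagv (rot P H)"
  by (subst orth_diagD(3)[OF assms]) (simp add: inner_rot inner_Diag)

context symmetric_function
begin

text \<open>The minorant may depend on \<open>t\<close>: at step \<open>t\<close> the one with the
  basis \<open>P ** U t\<close> is used, so its slope turns together with the difference quotient
  and contributes at second order.\<close>

lemma subderiv2_ge_ups:
  assumes XY: "(X, Y) \<in> gph_subdiff SymMat g" and P: "P \<in> orth_diag X" "P \<in> orth_diag Y"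
    and H: "H \<in> SymMat"
  shows "ereal (ups (eigvals X) (eigvals Y) (rot P H)) \<le> subderiv2 SymMat g X Y H"
proof -
  define x y where "x = eigvals X" and "y = eigvals Y"
  define N where "N = rot P H"
  have sub: "y \<in> subdiff UNIV \<theta> x" using gph_eigvals[OF XY P] by (simp add: x_def y_def)
  note PX = orth_diagD[OF P(1), folded x_def] and PY = orth_diagD[OF P(2), folded y_def]
  obtain r where r: "\<theta> x = ereal r" using subdiff_finite[OF sub] by blast
  then have gX: "g X = ereal r" by (simp add: x_def)
  define A where "A = skewgen x N"
  have A: "transpose A = - A" unfolding A_def by (rule transpose_skewgen) (simp add: N_def H)
  define C where "C = A ** Diag y - Diag y ** A"
  define S where "S = (1 / 2) *\<^sub>R (A ** A ** Diag y + Diag y ** A ** A) - A ** Diag y ** A"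
  obtain U where U: "\<And>t. orthogonal_matrix (U t)" and U0: "(U \<longlongrightarrow> mat 1) (at_right 0)"
    and U1: "\<And>M. ((\<lambda>t. (1 / t) *\<^sub>R (rot (transpose (U t)) M - M)) \<longlongrightarrow> A ** M - M ** A) (at_right 0)"
    and U2: "\<And>M. ((\<lambda>t. (1 / t\<^sup>2) *\<^sub>R (rot (transpose (U t)) M - M - t *\<^sub>R (A ** M - M ** A))) \<longlongrightarrow>
       (1 / 2) *\<^sub>R (A ** A ** M + M ** A ** A) - A ** M ** A) (at_right 0)"
    using conjugation_expansion[OF A] by blast
  define E1 where "E1 t = (1 / t) *\<^sub>R (rot (transpose (U t)) (Diag y) - Diag y)" for t
  define E2 where "E2 t = (1 / t\<^sup>2) *\<^sub>R (rot (transpose (U t)) (Diag y) - Diag y - t *\<^sub>R C)" for t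
  \<comment> \<open>After division by \<open>t\<^sup>2 / 2\<close>, the second order part of the
    slope meets the fixed point \<open>Diag x\<close> and the first order part meets the
    direction.\<close>
  let ?\<phi> = "\<lambda>z. 2 * (E2 (fst z) \<bullet> Diag x) + 2 * (E1 (fst z) \<bullet> rot P (snd z))"
  have "ereal (2 * (S \<bullet> Diag x) + 2 * (C \<bullet> rot P H)) \<le> subderiv2 SymMat g X Y H"
    unfolding subderiv2_def
  proof (rule le_Liminf_of_tendsto)
    show "eventually (\<lambda>z. ereal (?\<phi> z) \<le> (case z of (t, h') \<Rightarrow>
        (g (X + t *\<^sub>R h') - g X - ereal (t * (Y \<bullet> h'))) / ereal (t\<^sup>2 / 2))) (dir_filter SymMat H)"
      using eventually_dir_filter
    proof eventually_elim
      case (elim z)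
      obtain t h where z: "z = (t, h)" "t > 0" "h \<in> SymMat" using elim by (cases z) auto
      have Z: "X + t *\<^sub>R h \<in> SymMat"
        using z(3) XY
        by (intro subspace_add[OF subspace_SymMat] subspace_scale[OF subspace_SymMat])
          (auto simp: gph_subdiff_def subdiff_def)
      define q where "q = rot (transpose (U t)) (Diag y) \<bullet> (Diag x + t *\<^sub>R rot P h) - y \<bullet> x"
      have "y \<bullet> diagv (rot (P ** U t) (X + t *\<^sub>R h)) = Diag y \<bullet> rot (U t) (rot P (X + t *\<^sub>R h))"
        by (simp add: rot_rot inner_Diag)
      also have "\<dots> = rot (transpose (U t)) (Diag y) \<bullet> (Diag x + t *\<^sub>R rot P h)"
        by (simp add: inner_rot rot_add rot_scaleR PX(2))
      finally have "ereal (r + q) \<le> g (X + t *\<^sub>R h)"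
        using orbit_minorant[OF sub orthogonal_matrix_mul[OF PX(1) U[of t]] Z] r by (simp add: q_def)
      then have "ereal ((q - t * (Y \<bullet> h)) / (t\<^sup>2 / 2)) \<le>
          (g (X + t *\<^sub>R h) - g X - ereal (t * (Y \<bullet> h))) / ereal (t\<^sup>2 / 2)"
        using z(2) by (intro quotient_ge(2)[OF gX]) auto
      moreover have "(q - t * (Y \<bullet> h)) / (t\<^sup>2 / 2) = ?\<phi> z"
      proof -
        have Yh: "Y \<bullet> h = Diag y \<bullet> rot P h"
          by (subst PY(3)) (simp add: inner_rot)
        \<comment> \<open>The first order part of the slope may be subtracted here since the
          commutator of \<open>A\<close> with \<open>Diag y\<close> has zero diagonal and is
          orthogonal to \<open>Diag x\<close>.\<close>
        have e2: "E2 t \<bullet> Diag x = (rot (transpose (U t)) (Diag y) \<bullet> Diag x - y \<bullet> x) / t\<^sup>2"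
          unfolding E2_def inner_scaleR_left inner_diff_left C_def
            inner_scaleR_left commutator_Diag_inner_Diag[unfolded inner_diff_left]
          by (simp add: inner_Diag)
        have e1: "E1 t \<bullet> rot P h = (rot (transpose (U t)) (Diag y) \<bullet> rot P h - Diag y \<bullet> rot P h) / t"
          unfolding E1_def inner_scaleR_left inner_diff_left by simp
        show ?thesis using z(2)
          by (simp add: z(1) q_def e1 e2 Yh inner_add_right power2_eq_square field_simps)
      qed
      ultimately show ?case by (simp add: z(1))
    qed
    have E1: "(E1 \<longlongrightarrow> C) (at_right 0)" and E2: "(E2 \<longlongrightarrow> S) (at_right 0)"
      unfolding E1_def E2_def C_def S_def by (rule U1 U2)+
    show "(?\<phi> \<longlongrightarrow> 2 * (S \<bullet> Diag x) + 2 * (C \<bullet> rot P H)) (dir_filter SymMat H)"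
      by (intro tendsto_intros tendsto_rot_right filterlim_dir_filter
          filterlim_compose[OF E1] filterlim_compose[OF E2])
  qed
  \<comment> \<open>The first summand equals minus \<open>ups\<close>, the second twice
    \<open>ups\<close>.\<close>
  moreover have "2 * (S \<bullet> Diag x) + 2 * (C \<bullet> rot P H) = ups x y N"
    unfolding S_def C_def second_order_inner[OF A] N_def[symmetric]
    by (simp add: A_def skewgen_sum_ups commutator_inner_ups)
  ultimately show ?thesis by (simp add: x_def y_def N_def)
qed

text \<open>Move the point so that its spectrum is exactly \<open>x + t *\<^sub>R w\<close> up to
  order: within the blocks of \<open>x\<close> the direction is the conjugate \<open>B\<close> of
  \<open>Diag w\<close>, and off the blocks it comes from rotating \<open>Diag x\<close> with
  generator \<open>A\<close>. Then \<open>g\<close> along the curve is \<open>\<theta>\<close> along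
  \<open>w\<close>.\<close>

lemma subderiv_le_of_curve:
  assumes XY: "(X, Y) \<in> gph_subdiff SymMat g" and P: "P \<in> orth_diag X" "P \<in> orth_diag Y"
    and H: "H \<in> SymMat"
    and R: "orthogonal_matrix R" "blk (\<lambda>i j. eigvals X $ i = eigvals X $ j \<and> eigvals Y $ i = eigvals Y $ j) R"
    and HR: "\<And>i j. eigvals X $ i = eigvals X $ j \<Longrightarrow> rot P H $ i $ j = rot (transpose R) (Diag w) $ i $ j"
    and w: "eventually (\<lambda>t. \<theta> (eigvals X + t *\<^sub>R w) \<le> \<theta> (eigvals X) + ereal (t * (eigvals Y \<bullet> w))) (at_right 0)"
  shows "subderiv SymMat g X H \<le> ereal (Y \<bullet> H)"
    "subderiv2 SymMat g X Y H \<le> ereal (ups (eigvals X) (eigvals Y) (rot P H))"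
proof -
  define x y where "x = eigvals X" and "y = eigvals Y"
  define N where "N = rot P H"
  have sub: "y \<in> subdiff UNIV \<theta> x" using gph_eigvals[OF XY P] by (simp add: x_def y_def)
  note PX = orth_diagD[OF P(1), folded x_def] and PY = orth_diagD[OF P(2), folded y_def]
  note R' = R(2)[folded x_def y_def]
  obtain r where r: "\<theta> x = ereal r" using subdiff_finite[OF sub] by blast
  then have gX: "g X = ereal r" by (simp add: x_def)
  define B where "B = rot (transpose R) (Diag w)"
  define A where "A = skewgen x N"
  have A: "transpose A = - A" unfolding A_def by (rule transpose_skewgen) (simp add: N_def H)
  let ?C = "\<lambda>M. A ** M - M ** A"
  define S where "S = (1 / 2) *\<^sub>R (A ** A ** Diag x + Diag x ** A ** A) - A ** Diag x ** A"
  obtain U where U: "\<And>t. orthogonal_matrix (U t)" and U0: "(U \<longlongrightarrow> mat 1) (at_right 0)"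
    and U1: "\<And>M. ((\<lambda>t. (1 / t) *\<^sub>R (rot (transpose (U t)) M - M)) \<longlongrightarrow> A ** M - M ** A) (at_right 0)"
    and U2: "\<And>M. ((\<lambda>t. (1 / t\<^sup>2) *\<^sub>R (rot (transpose (U t)) M - M - t *\<^sub>R (A ** M - M ** A))) \<longlongrightarrow>
       (1 / 2) *\<^sub>R (A ** A ** M + M ** A ** A) - A ** M ** A) (at_right 0)"
    using conjugation_expansion[OF A] by blast
  define E1 where "E1 t = (1 / t) *\<^sub>R (rot (transpose (U t)) B - B)" for t
  define E2 where "E2 t = (1 / t\<^sup>2) *\<^sub>R (rot (transpose (U t)) (Diag x) - Diag x - t *\<^sub>R ?C (Diag x))" for t
  \<comment> \<open>The direction that solves \<open>Diag x + t *\<^sub>R K t = rot (transpose (U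
    t)) (Diag x + t *\<^sub>R B)\<close>.\<close>
  define K where "K t = (1 / t) *\<^sub>R (rot (transpose (U t)) (Diag x) - Diag x) + rot (transpose (U t)) B" for t
  define \<gamma> where "\<gamma> t = (t, rot (transpose P) (K t))" for t
  have Rsym: "symp (\<lambda>i j. x $ i = x $ j \<and> y $ i = y $ j)" by (auto simp: symp_def)
  have Bblk: "blk (\<lambda>i j. x $ i = x $ j \<and> y $ i = y $ j) B"
    unfolding B_def by (intro blk_rot blk_transpose R' Rsym) (auto simp: transp_def blk_def Diag_nth)
  have CB: "?C (Diag x) + B = N"
  proof -
    have "A $ i $ j * (x $ j - x $ i) + B $ i $ j = N $ i $ j" for i j
    proof (cases "x $ i = x $ j")
      case True
      then show ?thesis using HR[of i j] by (simp add: B_def N_def x_def)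
    next
      case False
      then have "B $ i $ j = 0" using blkD[OF Bblk] by blast
      then show ?thesis using False by (simp add: A_def skewgen_nth field_simps)
    qed
    then show ?thesis by (simp only: vec_eq_iff vector_add_component commutator_Diag_nth) blast
  qed
  have "(K \<longlongrightarrow> ?C (Diag x) + rot (transpose (mat 1)) B) (at_right 0)"
    unfolding K_def[abs_def] by (intro tendsto_intros tendsto_transpose U0 U1)
  then have "(K \<longlongrightarrow> N) (at_right 0)" by (simp add: CB)
  then have Klim: "((\<lambda>t. rot (transpose P) (K t)) \<longlongrightarrow> H) (at_right 0)"
    using tendsto_rot_right[of K N "at_right 0" "transpose P"] PX(1) by (simp add: N_def)
  have KS: "rot (transpose P) (K t) \<in> SymMat" for t
    unfolding K_def B_def by (intro rot_SymMat subspace_add[OF subspace_SymMat] subspace_scale[OF subspace_SymMat]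
        subspace_diff[OF subspace_SymMat] Diag_SymMat)
  have \<gamma>: "filterlim \<gamma> (dir_filter SymMat H) (at_right 0)"
    unfolding dir_filter_def \<gamma>_def
    by (intro filterlim_Pair filterlim_ident filterlim_inf[THEN iffD2] conjI Klim)
      (simp add: filterlim_principal KS)
  have gK: "eventually (\<lambda>t. t > 0 \<and> g (X + t *\<^sub>R rot (transpose P) (K t)) \<le> ereal (r + t * (y \<bullet> w))) (at_right 0)"
    using w eventually_at_right_less
  proof eventually_elim
    case (elim t)
    have "rot (transpose R) (Diag x) = Diag x" by (rule blk_rot_Diag(2)[OF R' _ R(1)]) simp
    then have "Diag x + t *\<^sub>R B = rot (transpose R) (Diag (x + t *\<^sub>R w))"
      by (simp add: B_def Diag_add Diag_scaleR rot_add rot_scaleR)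
    moreover have "Diag x + t *\<^sub>R K t = rot (transpose (U t)) (Diag x + t *\<^sub>R B)"
      using elim by (simp add: K_def rot_add rot_scaleR scaleR_add_right)
    moreover have "X + t *\<^sub>R rot (transpose P) (K t) = rot (transpose P) (Diag x + t *\<^sub>R K t)"
      by (subst PX(3)) (simp add: rot_add rot_scaleR)
    ultimately have "X + t *\<^sub>R rot (transpose P) (K t) =
        rot ((transpose R ** transpose (U t)) ** transpose P) (Diag (x + t *\<^sub>R w))"
      by (simp add: rot_rot)
    moreover have "orthogonal_matrix ((transpose R ** transpose (U t)) ** transpose P)"
      by (intro orthogonal_matrix_mul orthogonal_matrix_transpose R(1) U PX(1))
    ultimately have "g (X + t *\<^sub>R rot (transpose P) (K t)) = \<theta> (x + t *\<^sub>R w)"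
      using g_rot_Diag by metis
    then show ?case using elim r by (simp add: x_def y_def)
  qed
  have yB: "y \<bullet> w = Diag y \<bullet> B"
  proof -
    have "rot R (Diag y) = Diag y" by (rule blk_rot_Diag(1)[OF R' _ R(1)]) simp
    then have "Diag y \<bullet> B = Diag y \<bullet> Diag w"
      unfolding B_def by (metis inner_commute inner_rot transpose_transpose)
    then show ?thesis by (simp add: inner_Diag)
  qed
  have yC: "Diag y \<bullet> ?C (Diag x) = 0"
    using commutator_Diag_inner_Diag[of A x y] by (simp only: inner_commute)
  have YH: "Y \<bullet> H = y \<bullet> w"
  proof -
    have "Y \<bullet> H = Diag y \<bullet> N" by (simp add: rot_trace_eigvals[OF P(2)] N_def y_def inner_Diag)
    then show ?thesis unfolding CB[symmetric] inner_add_right yC by (simp add: yB)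
  qed
  show "subderiv SymMat g X H \<le> ereal (Y \<bullet> H)"
    unfolding subderiv_def
  proof (rule Liminf_le_of_curve[OF \<gamma> trivial_limit_at_right_real])
    show "eventually (\<lambda>t. (case \<gamma> t of (t, h') \<Rightarrow> (g (X + t *\<^sub>R h') - g X) / ereal t) \<le> ereal (Y \<bullet> H)) (at_right 0)"
      using gK
    proof eventually_elim
      case (elim t)
      then have "(g (X + t *\<^sub>R rot (transpose P) (K t)) - g X) / ereal t \<le> ereal (t * (y \<bullet> w) / t)"
        by (intro quotient_le(1)[OF gX]) auto
      then show ?case using elim by (simp add: \<gamma>_def YH)
    qed
  qed simp
  show "subderiv2 SymMat g X Y H \<le> ereal (ups (eigvals X) (eigvals Y) (rot P H))"
    unfolding subderiv2_def
  proof (rule Liminf_le_of_curve[OF \<gamma> trivial_limit_at_right_real])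
    let ?\<phi> = "\<lambda>t. - 2 * (Diag y \<bullet> E2 t) - 2 * (Diag y \<bullet> E1 t)"
    show "eventually (\<lambda>t. (case \<gamma> t of (t, h') \<Rightarrow>
        (g (X + t *\<^sub>R h') - g X - ereal (t * (Y \<bullet> h'))) / ereal (t\<^sup>2 / 2)) \<le> ereal (?\<phi> t)) (at_right 0)"
      using gK
    proof eventually_elim
      case (elim t)
      have "(g (X + t *\<^sub>R rot (transpose P) (K t)) - g X - ereal (t * (Y \<bullet> rot (transpose P) (K t)))) / ereal (t\<^sup>2 / 2)
          \<le> ereal ((t * (y \<bullet> w) - t * (Y \<bullet> rot (transpose P) (K t))) / (t\<^sup>2 / 2))"
        using elim by (intro quotient_le(2)[OF gX]) auto
      moreover have "(t * (y \<bullet> w) - t * (Y \<bullet> rot (transpose P) (K t))) / (t\<^sup>2 / 2) = ?\<phi> t"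
      proof -
        have YK: "Y \<bullet> rot (transpose P) (K t) = Diag y \<bullet> K t"
          using PX(1) by (simp add: rot_trace_eigvals[OF P(2)] y_def inner_Diag)
        have e2: "Diag y \<bullet> E2 t = (Diag y \<bullet> rot (transpose (U t)) (Diag x) - Diag y \<bullet> Diag x) / t\<^sup>2"
          unfolding E2_def inner_scaleR_right inner_diff_right[of _ _ "t *\<^sub>R _"] yC by (simp add: inner_diff_right)
        have e1: "Diag y \<bullet> E1 t = (Diag y \<bullet> rot (transpose (U t)) B - Diag y \<bullet> B) / t"
          unfolding E1_def inner_scaleR_right inner_diff_right by simp
        have k: "Diag y \<bullet> K t = (Diag y \<bullet> rot (transpose (U t)) (Diag x) - Diag y \<bullet> Diag x) / t
            + Diag y \<bullet> rot (transpose (U t)) B"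
          unfolding K_def inner_scaleR_right inner_diff_right inner_add_right by simp
        show ?thesis using elim
          by (simp add: YK k e1 e2 yB power2_eq_square field_simps)
      qed
      ultimately show ?case by (simp add: \<gamma>_def)
    qed
    have E1: "(E1 \<longlongrightarrow> ?C B) (at_right 0)" and E2: "(E2 \<longlongrightarrow> S) (at_right 0)"
      unfolding E1_def E2_def S_def by (rule U1 U2)+
    have "(?\<phi> \<longlongrightarrow> - 2 * (Diag y \<bullet> S) - 2 * (Diag y \<bullet> ?C B)) (at_right 0)"
      by (intro tendsto_intros E1 E2)
    \<comment> \<open>The cross term between rotation and diagonal motion vanishes: \<open>A\<close>
      is zero on the blocks of \<open>x\<close>, and \<open>B\<close> lives on them.\<close>
    moreover have "Diag y \<bullet> ?C B = 0"
    proof -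
      have z: "A $ i $ j * B $ j $ i = 0" for i j
      proof (cases "B $ j $ i = 0")
        case False
        then have "x $ j = x $ i" using blkD[OF Bblk] by blast
        then show ?thesis by (simp add: A_def skewgen_nth)
      qed simp
      have z': "B $ i $ j * A $ j $ i = 0" for i j
        using z[of j i] by (simp only: mult.commute)
      have "(A ** B) $ i $ i = 0" "(B ** A) $ i $ i = 0" for i
        unfolding matrix_matrix_mult_def by (simp_all only: vec_lambda_beta z z' sum.neutral_const)
      then have "diagv (?C B) = 0" by (simp add: vec_eq_iff)
      then show ?thesis by (simp only: inner_Diag inner_zero_right)
    qed
    moreover have "- 2 * (Diag y \<bullet> S) = ups x y N"
      unfolding S_def inner_commute[of "Diag y"] second_order_inner[OF A]
      unfolding A_def skewgen_sum_ups[symmetric] by (simp add: mult_ac)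
    ultimately show "(?\<phi> \<longlongrightarrow> ups (eigvals X) (eigvals Y) (rot P H)) (at_right 0)"
      by (simp add: x_def y_def N_def)
  qed
qed

end

section \<open>Directions along which the second subderivative is finite\<close>

text \<open>Coordinates for the affine hull of the critical cone when \<open>W\<close> is the span
  of \<open>ncone\<close>. An off-diagonal entry in a common block of \<open>x\<close> and
  \<open>y\<close> is allowed only if \<open>W\<close> contains \<open>axis i 1 - axis j 1\<close>,
  the direction in which a rotation of that plane moves the diagonal.\<close>

definition model_space :: "real^'n^'n \<Rightarrow> real^'n \<Rightarrow> real^'n \<Rightarrow> (real^'n) set \<Rightarrow> (real^'n^'n) set" where
  "model_space P x y W = {H \<in> SymMat. diagv (rot P H) \<in> W \<and>
     (\<forall>i j. i \<noteq> j \<longrightarrow> x $ i = x $ j \<longrightarrow> rot P H $ i $ j \<noteq> 0 \<longrightarrow>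
        y $ i = y $ j \<and> axis i 1 - axis j 1 \<in> W)}"

lemma model_spaceD:
  assumes "H \<in> model_space P x y W"
  shows "H \<in> SymMat" "diagv (rot P H) \<in> W"
    "i \<noteq> j \<Longrightarrow> x $ i = x $ j \<Longrightarrow> rot P H $ i $ j \<noteq> 0 \<Longrightarrow> y $ i = y $ j \<and> axis i 1 - axis j 1 \<in> W"
  using assms by (auto simp: model_space_def)

lemma subspace_model_space:
  assumes W: "subspace W"
  shows "subspace (model_space P x y W)"
proof (rule subspaceI)
  show "0 \<in> model_space P x y W"
    using subspace_0[OF W] subspace_0[OF subspace_SymMat] by (auto simp: model_space_def rot_zero diagv_zero)
next
  fix H K assume HK: "H \<in> model_space P x y W" "K \<in> model_space P x y W"
  have "y $ i = y $ j \<and> axis i 1 - axis j 1 \<in> W"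
    if "i \<noteq> j" "x $ i = x $ j" "rot P (H + K) $ i $ j \<noteq> 0" for i j
  proof -
    have "rot P H $ i $ j \<noteq> 0 \<or> rot P K $ i $ j \<noteq> 0" using that(3) by (auto simp: rot_add)
    then show ?thesis using model_spaceD(3)[OF HK(1) that(1,2)] model_spaceD(3)[OF HK(2) that(1,2)] by blast
  qed
  then show "H + K \<in> model_space P x y W"
    using HK W subspace_SymMat
    by (auto simp: model_space_def rot_add diagv_add intro: subspace_add)
next
  fix s H assume "H \<in> model_space P x y W"
  then show "s *\<^sub>R H \<in> model_space P x y W"
    using W subspace_SymMat by (auto simp: model_space_def rot_scaleR diagv_scaleR intro: subspace_scale)
qed

lemma model_space_mono: "W \<subseteq> W' \<Longrightarrow> model_space P x y W \<subseteq> model_space P x y W'"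
  by (auto simp: model_space_def)

text \<open>Two rotations by \<open>45\<close> degrees in opposite senses isolate the off-diagonal entry.\<close>

lemma model_spaceI:
  assumes H: "H \<in> SymMat" and W: "subspace W"
    and diag: "\<And>R. orthogonal_matrix R \<Longrightarrow> blk (\<lambda>i j. x $ i = x $ j \<and> y $ i = y $ j) R \<Longrightarrow>
      diagv (rot R (rot P H)) \<in> W"
    and zero: "\<And>i j. x $ i = x $ j \<Longrightarrow> y $ i \<noteq> y $ j \<Longrightarrow> rot P H $ i $ j = 0"
  shows "H \<in> model_space P x y W"
proof -
  let ?r = "\<lambda>i j. x $ i = x $ j \<and> y $ i = y $ j"
  define N where "N = rot P H"
  have N: "N \<in> SymMat" using H by (simp add: N_def)
  have "axis i 1 - axis j 1 \<in> W" if "i \<noteq> j" "x $ i = x $ j" "y $ i = y $ j" "N $ i $ j \<noteq> 0" for i j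
  proof -
    define h :: real where "h = 1 / sqrt 2"
    have h: "h\<^sup>2 = 1 / 2" by (simp add: h_def power_divide)
    have G: "diagv (rot (givens i j h s) N) \<in> W" if "s\<^sup>2 = 1 / 2" for s
    proof -
      have "orthogonal_matrix (givens i j h s)" using \<open>i \<noteq> j\<close> that h by (intro orthogonal_givens) auto
      moreover have "blk ?r (givens i j h s)"
        using \<open>x $ i = x $ j\<close> \<open>y $ i = y $ j\<close> by (intro blk_givens) (auto simp: reflp_def symp_def)
      ultimately show ?thesis unfolding N_def by (rule diag)
    qed
    have 1: "diagv (rot (givens i j h s) N) =
        diagv N + ((1 / 2) * (N $ j $ j - N $ i $ i) + 2 * h * s * N $ i $ j) *\<^sub>R (axis i 1 - axis j 1)"
      if "s\<^sup>2 = 1 / 2" for s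
      using diagv_rot_givens[of i j h s N] that h \<open>i \<noteq> j\<close> N by simp
    have "diagv (rot (givens i j h h) N) - diagv (rot (givens i j h (-h)) N) \<in> W"
      using G[of h] G[of "-h"] h W by (intro subspace_diff) auto
    also have "diagv (rot (givens i j h h) N) - diagv (rot (givens i j h (-h)) N)
        = (4 * h\<^sup>2 * N $ i $ j) *\<^sub>R (axis i 1 - axis j 1)"
      using 1[of h] 1[of "-h"] h by (simp add: power2_eq_square flip: scaleR_diff_left)
    finally have "(2 * N $ i $ j) *\<^sub>R (axis i 1 - axis j 1) \<in> W" using h by simp
    then have "(1 / (2 * N $ i $ j)) *\<^sub>R ((2 * N $ i $ j) *\<^sub>R (axis i 1 - axis j 1)) \<in> W"
      by (rule subspace_scale[OF W])
    then show ?thesis using that(4) by simp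
  qed
  moreover have "diagv N \<in> W"
    using diag[OF orthogonal_matrix_id blk_mat_1] by (simp add: reflp_def N_def)
  ultimately show ?thesis using H zero by (auto simp: model_space_def N_def)
qed

text \<open>A vector orthogonal to \<open>W\<close> is constant on the blocks of \<open>R\<close>, hence its diagonal matrix commutes
  with \<open>R\<close>.\<close>

lemma diagv_rot_mem:
  assumes W: "subspace W" and R: "orthogonal_matrix R"
    and blk: "blk (\<lambda>i j. axis i 1 - axis j 1 \<in> W) R" and N: "diagv N \<in> W"
  shows "diagv (rot R N) \<in> W"
proof -
  have "s \<bullet> diagv (rot R N) = 0" if s: "s \<in> orthogonal_comp W" for s
  proof -
    have "s $ i = s $ j" if "axis i 1 - axis j 1 \<in> W" for i j
      using s that by (auto simp: orthogonal_comp_def orthogonal_def inner_diff_left inner_axis')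
    then have "rot (transpose R) (Diag s) = Diag s"
      by (rule blk_rot_Diag(2)[OF blk _ R])
    moreover have "s \<bullet> diagv (rot R N) = rot (transpose R) (Diag s) \<bullet> N"
      by (simp add: inner_Diag inner_rot flip: inner_Diag)
    ultimately have "s \<bullet> diagv (rot R N) = s \<bullet> diagv N" by (simp add: inner_Diag)
    then show ?thesis using s N by (auto simp: orthogonal_comp_def orthogonal_def inner_commute)
  qed
  then have "diagv (rot R N) \<in> orthogonal_comp (orthogonal_comp W)"
    by (auto simp: orthogonal_comp_def orthogonal_def)
  then show ?thesis by (simp add: orthogonal_comp_self[OF W])
qed

text \<open>Since \<open>W\<close> is a subspace, \<open>axis i 1 - axis j 1 \<in> W\<close> is an
  equivalence relation. Diagonalizing only within its classes, intersected with the common blocks of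
  \<open>x\<close> and \<open>y\<close>, keeps the diagonal in \<open>W\<close> by
  \<open>diagv_rot_mem\<close>.\<close>

lemma model_space_diagonalize:
  fixes x y :: "('n::{finite,linorder}) rvec"
  assumes H: "H \<in> model_space P x y W" and W: "subspace W"
  obtains R w where "orthogonal_matrix R" "blk (\<lambda>i j. x $ i = x $ j \<and> y $ i = y $ j) R" "w \<in> W"
    "\<And>i j. x $ i = x $ j \<Longrightarrow> rot P H $ i $ j = rot (transpose R) (Diag w) $ i $ j"
proof -
  define N where "N = rot P H"
  define r where "r i j \<longleftrightarrow> x $ i = x $ j \<and> y $ i = y $ j \<and> axis i 1 - axis j 1 \<in> W" for i j
  \<comment> \<open>\<open>model_space\<close> leaves the entries off the blocks of \<open>x\<close>
    free, so only the truncation to these blocks is diagonalized.\<close>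
  define B :: "'n rmat" where "B = (\<chi> i j. if x $ i = x $ j then N $ i $ j else 0)"
  have r: "reflp r" "symp r" "transp r"
  proof -
    show "reflp r" using subspace_0[OF W] by (auto simp: r_def reflp_def)
    show "symp r" using subspace_neg[OF W] by (force simp: r_def symp_def)
    show "transp r" using subspace_add[OF W] by (force simp: r_def transp_def)
  qed
  have N: "N \<in> SymMat" using model_spaceD(1)[OF H] by (simp add: N_def)
  then have B: "B \<in> SymMat" by (intro SymMatI) (auto simp: B_def SymMat_nth)
  have "blk r B"
    unfolding blk_def
  proof (intro allI impI)
    fix i j assume "B $ i $ j \<noteq> 0"
    then have "x $ i = x $ j" "N $ i $ j \<noteq> 0" by (auto simp: B_def split: if_splits)
    then show "r i j"
      using model_spaceD(3)[OF H, of i j] reflpD[OF r(1), of i] by (cases "i = j") (auto simp: r_def N_def)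
  qed
  then obtain R w where R: "orthogonal_matrix R" "blk r R" "rot R B = Diag w"
    using spectral_blk[OF r B] by metis
  have "diagv B = diagv N" by (simp add: vec_eq_iff B_def)
  then have "diagv B \<in> W" using model_spaceD(2)[OF H] by (simp add: N_def)
  moreover have "blk (\<lambda>i j. axis i 1 - axis j 1 \<in> W) R" using R(2) by (rule blk_mono) (simp add: r_def)
  ultimately have "diagv (rot R B) \<in> W" by (intro diagv_rot_mem[OF W R(1)])
  then have "w \<in> W" by (simp add: R(3))
  moreover have "rot (transpose R) (Diag w) = B" using R(1) by (simp flip: R(3))
  then have "rot P H $ i $ j = rot (transpose R) (Diag w) $ i $ j" if "x $ i = x $ j" for i j
    using that by (simp add: B_def N_def)
  moreover have "blk (\<lambda>i j. x $ i = x $ j \<and> y $ i = y $ j) R" using R(2) by (rule blk_mono) (simp add: r_def)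
  ultimately show ?thesis using that R(1) by blast
qed

lemma ups_hadamard: "ups x y N = (\<chi> i j. (y $ i - y $ j) / (x $ i - x $ j) * N $ i $ j) \<bullet> N"
  by (simp add: ups_def inner_vec_def power2_eq_square mult_ac)

text \<open>The operator multiplies entrywise by the divided differences of \<open>y\<close> over
  \<open>x\<close> in the coordinates of \<open>P\<close>. It preserves the domain because its
  output vanishes on the blocks of \<open>x\<close>, the diagonal included.\<close>

lemma gqf_model:
  fixes x y :: "real^'n"
  assumes P: "orthogonal_matrix P" and W: "subspace W"
  shows "gqf SymMat (\<lambda>H. ereal (ups x y (rot P H)) + indic (model_space P x y W) H)" (is "gqf _ ?q")
proof -
  let ?V = "model_space P x y W"
  define \<Theta> where "\<Theta> i j = (y $ i - y $ j) / (x $ i - x $ j)" for i j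
  define T where "T N = (\<chi> i j. \<Theta> i j * N $ i $ j)" for N :: "real^'n^'n"
  define L where "L H = rot (transpose P) (T (rot P H))" for H
  have V: "subspace ?V" using W by (rule subspace_model_space)
  have dom: "edom SymMat ?q = ?V"
  proof -
    have "?q H < \<infinity> \<longleftrightarrow> H \<in> ?V" for H by (simp add: indic_def)
    then show ?thesis using model_spaceD(1) by (auto simp: edom_def)
  qed
  have \<Theta>: "\<Theta> j i = \<Theta> i j" for i j
    unfolding \<Theta>_def by (metis minus_diff_eq minus_divide_divide)
  have PL: "rot P (L H) = T (rot P H)" for H using P by (simp add: L_def)
  have inner: "L H \<bullet> K = T (rot P H) \<bullet> rot P K" for H K
    using P by (simp add: L_def inner_rot)
  have "L H \<in> ?V" if H: "H \<in> ?V" for H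
  proof -
    have "T (rot P H) \<in> SymMat"
      using model_spaceD(1)[OF H] by (intro SymMatI) (simp add: T_def \<Theta> SymMat_nth)
    then have "L H \<in> SymMat" by (simp add: L_def)
    moreover have "diagv (rot P (L H)) = 0" by (simp add: PL vec_eq_iff T_def \<Theta>_def)
    moreover have "rot P (L H) $ i $ j = 0" if "x $ i = x $ j" for i j
      using that by (simp add: PL T_def \<Theta>_def)
    ultimately show ?thesis using subspace_0[OF W] by (simp add: model_space_def)
  qed
  moreover have "L (H + K) = L H + L K" for H K
  proof -
    have "T (M + N) = T M + T N" for M N by (simp add: T_def vec_eq_iff algebra_simps)
    then show ?thesis by (simp add: L_def rot_add)
  qed
  moreover have "L (s *\<^sub>R H) = s *\<^sub>R L H" for s H
  proof -
    have "T (s *\<^sub>R M) = s *\<^sub>R T M" for M by (simp add: T_def vec_eq_iff)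
    then show ?thesis by (simp add: L_def rot_scaleR)
  qed
  moreover have "L H \<bullet> K = H \<bullet> L K" for H K
    unfolding inner inner_commute[of H] by (simp add: T_def inner_vec_def mult_ac)
  moreover have "?q H = ereal (L H \<bullet> H)" if "H \<in> ?V" for H
    using that by (simp add: indic_def inner ups_hadamard T_def \<Theta>_def)
  moreover have "proper_on SymMat ?q"
    unfolding proper_on_def dom using subspace_0[OF V] by (auto simp: indic_def)
  ultimately show ?thesis
    unfolding gqf_def dom using V by blast
qed

text \<open>The divided differences are constant on pairs of common blocks, so entrywise
  multiplication by them commutes with conjugation by \<open>Q\<close>.\<close>

lemma ups_rot_invariant:
  fixes x y :: "real^'n"
  assumes Q: "orthogonal_matrix Q" "blk (\<lambda>i j. x $ i = x $ j \<and> y $ i = y $ j) Q"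
  shows "ups x y (rot Q M) = ups x y M"
proof -
  define \<Theta> where "\<Theta> i j = (y $ i - y $ j) / (x $ i - x $ j)" for i j
  define T where "T N = (\<chi> i j. \<Theta> i j * N $ i $ j)" for N :: "real^'n^'n"
  have "T (rot Q M) $ i $ j = rot Q (T M) $ i $ j" for i j
  proof -
    have rot: "rot Q N $ i $ j = (\<Sum>l\<in>UNIV. \<Sum>k\<in>UNIV. Q $ k $ i * N $ k $ l * Q $ l $ j)" for N :: "real^'n^'n"
      by (simp add: rot_def matrix_matrix_mult_def transpose_def sum_distrib_right)
    have eq: "\<Theta> i j * (Q $ k $ i * M $ k $ l * Q $ l $ j) = Q $ k $ i * (\<Theta> k l * M $ k $ l) * Q $ l $ j" for k l
    proof (cases "Q $ k $ i = 0 \<or> Q $ l $ j = 0")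
      case False
      then have "x $ k = x $ i \<and> y $ k = y $ i" "x $ l = x $ j \<and> y $ l = y $ j"
        using blkD[OF Q(2)] by blast+
      then have "\<Theta> i j = \<Theta> k l" by (simp add: \<Theta>_def)
      then show ?thesis by simp
    qed auto
    have "T (rot Q M) $ i $ j = (\<Sum>l\<in>UNIV. \<Sum>k\<in>UNIV. \<Theta> i j * (Q $ k $ i * M $ k $ l * Q $ l $ j))"
      by (simp only: T_def rot sum_distrib_left vec_lambda_beta)
    also have "\<dots> = rot Q (T M) $ i $ j"
      by (simp only: eq rot) (simp add: T_def)
    finally show ?thesis .
  qed
  then have "T (rot Q M) = rot Q (T M)" by (simp add: vec_eq_iff)
  then have "T (rot Q M) \<bullet> rot Q M = T M \<bullet> M" by (simp add: inner_rot_rot Q(1))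
  then show ?thesis by (simp add: ups_hadamard T_def \<Theta>_def)
qed

text \<open>The transition matrix between the two bases commutes with both diagonal matrices, so it
  respects the common blocks. This permits eigenbases found by compactness to replace the given
  \<open>P\<close>.\<close>

lemma ups_orth_diag_indep:
  assumes P: "P \<in> orth_diag X" "P \<in> orth_diag Y" and P': "P' \<in> orth_diag X" "P' \<in> orth_diag Y"
  shows "ups (eigvals X) (eigvals Y) (rot P H) = ups (eigvals X) (eigvals Y) (rot P' H)"
proof -
  define Q where "Q = transpose P' ** P"
  note o = orth_diagD(1)[OF P(1)] orth_diagD(1)[OF P'(1)]
  have Q: "orthogonal_matrix Q"
    unfolding Q_def by (intro orthogonal_matrix_mul orthogonal_matrix_transpose o)
  have PQ: "P = P' ** Q" by (simp add: Q_def matrix_mul_assoc orthogonal_matrix_cancel o)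
  have com: "eigvals Z $ i = eigvals Z $ j" if "Q $ i $ j \<noteq> 0" "P \<in> orth_diag Z" "P' \<in> orth_diag Z" for Z i j
  proof -
    have "rot Q (rot P' Z) = rot P Z" by (simp add: rot_rot PQ)
    then have "rot Q (Diag (eigvals Z)) = Diag (eigvals Z)"
      by (simp add: orth_diagD(2)[OF that(2)] orth_diagD(2)[OF that(3)])
    then have "Q ** rot Q (Diag (eigvals Z)) = Q ** Diag (eigvals Z)" by simp
    then have "Diag (eigvals Z) ** Q = Q ** Diag (eigvals Z)"
      by (simp add: rot_def matrix_mul_assoc orthogonal_matrix_cancel Q)
    then have "(Diag (eigvals Z) ** Q) $ i $ j = (Q ** Diag (eigvals Z)) $ i $ j" by simp
    then show ?thesis using that(1) by (simp add: Diag_mult_nth mult_Diag_nth)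
  qed
  have "blk (\<lambda>i j. eigvals X $ i = eigvals X $ j \<and> eigvals Y $ i = eigvals Y $ j) Q"
    using com P P' by (auto simp: blk_def)
  then show ?thesis
    unfolding PQ rot_rot[symmetric] by (rule ups_rot_invariant[OF Q])
qed

text \<open>By the ordering hypothesis all terms are nonnegative, so an upper bound for the sum
  bounds each term and survives the removal of terms.\<close>

lemma ups_limit:
  fixes xs ys :: "nat \<Rightarrow> real^'n" and Ns :: "nat \<Rightarrow> real^'n^'n"
  assumes xs: "xs \<longlonglongrightarrow> x" and ys: "ys \<longlonglongrightarrow> y" and Ns: "Ns \<longlonglongrightarrow> N" and rs: "rs \<longlonglongrightarrow> \<rho>"
    and le: "\<And>k. ups (xs k) (ys k) (Ns k) \<le> rs k"
    and ord: "\<And>k i j. 0 \<le> (ys k $ i - ys k $ j) * (xs k $ i - xs k $ j)"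
  shows "ups x y N \<le> \<rho>"
    "x $ i = x $ j \<Longrightarrow> (\<And>k. xs k $ i \<noteq> xs k $ j) \<Longrightarrow> y $ i \<noteq> y $ j \<Longrightarrow> N $ i $ j = 0"
proof -
  define T where "T k i j = (ys k $ i - ys k $ j) / (xs k $ i - xs k $ j) * (Ns k $ i $ j)\<^sup>2" for k i j
  have T0: "0 \<le> T k i j" for k i j
  proof -
    have "u / v = u * v / v\<^sup>2" for u v :: real by (cases "v = 0") (auto simp: power2_eq_square)
    then have "0 \<le> (ys k $ i - ys k $ j) / (xs k $ i - xs k $ j)"
      using ord[of k i j] by (metis zero_le_divide_iff zero_le_power2)
    then show ?thesis unfolding T_def by (intro mult_nonneg_nonneg) auto
  qed
  \<comment> \<open>Terms whose gap collapses need not converge. Dropping them only lowers the sum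
    and leaves the default value that \<open>ups x y\<close> assigns to them.\<close>
  define L where "L k i j = (if x $ i = x $ j then 0 else T k i j)" for k i j
  have lim: "(\<lambda>k. xs k $ i) \<longlonglongrightarrow> x $ i" "(\<lambda>k. ys k $ i) \<longlonglongrightarrow> y $ i" "(\<lambda>k. Ns k $ i $ j) \<longlonglongrightarrow> N $ i $ j" for i j
    using xs ys Ns by (auto intro!: tendsto_vec_nth)
  have "(\<lambda>k. L k i j) \<longlonglongrightarrow> (y $ i - y $ j) / (x $ i - x $ j) * (N $ i $ j)\<^sup>2" for i j
    by (cases "x $ i = x $ j") (auto simp: L_def T_def intro!: tendsto_intros lim)
  then have "(\<lambda>k. \<Sum>i\<in>UNIV. \<Sum>j\<in>UNIV. L k i j) \<longlonglongrightarrow> ups x y N"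
    unfolding ups_def by (intro tendsto_sum)
  moreover have "(\<Sum>i\<in>UNIV. \<Sum>j\<in>UNIV. L k i j) \<le> rs k" for k
  proof -
    have "(\<Sum>i\<in>UNIV. \<Sum>j\<in>UNIV. L k i j) \<le> (\<Sum>i\<in>UNIV. \<Sum>j\<in>UNIV. T k i j)"
      by (intro sum_mono) (simp add: L_def T0)
    then show ?thesis using le[of k] by (simp add: ups_def T_def)
  qed
  ultimately show "ups x y N \<le> \<rho>" using LIMSEQ_le[OF _ rs] by blast
  assume ij: "x $ i = x $ j" "\<And>k. xs k $ i \<noteq> xs k $ j" "y $ i \<noteq> y $ j"
  \<comment> \<open>Multiplication by the gap removes the denominator, so both sides converge and
    the right one tends to zero.\<close>
  have "\<bar>ys k $ i - ys k $ j\<bar> * (Ns k $ i $ j)\<^sup>2 \<le> rs k * \<bar>xs k $ i - xs k $ j\<bar>" for k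
  proof -
    have "T k i j \<le> (\<Sum>j\<in>UNIV. T k i j)" using T0 by (intro member_le_sum) auto
    also have "\<dots> \<le> (\<Sum>i\<in>UNIV. \<Sum>j\<in>UNIV. T k i j)"
      using T0 by (intro member_le_sum[where f = "\<lambda>i. \<Sum>j\<in>UNIV. T k i j"]) (auto intro: sum_nonneg)
    also have "\<dots> \<le> rs k" using le[of k] by (simp add: ups_def T_def)
    finally have "\<bar>T k i j\<bar> * \<bar>xs k $ i - xs k $ j\<bar> \<le> rs k * \<bar>xs k $ i - xs k $ j\<bar>"
      using T0[of k i j] by (intro mult_right_mono) auto
    moreover have "\<bar>T k i j\<bar> * \<bar>xs k $ i - xs k $ j\<bar> = \<bar>ys k $ i - ys k $ j\<bar> * (Ns k $ i $ j)\<^sup>2"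
      using ij(2)[of k] by (simp add: T_def abs_mult abs_divide)
    ultimately show ?thesis by simp
  qed
  moreover have "(\<lambda>k. \<bar>ys k $ i - ys k $ j\<bar> * (Ns k $ i $ j)\<^sup>2) \<longlonglongrightarrow> \<bar>y $ i - y $ j\<bar> * (N $ i $ j)\<^sup>2"
    by (intro tendsto_intros lim)
  moreover have "(\<lambda>k. rs k * \<bar>xs k $ i - xs k $ j\<bar>) \<longlonglongrightarrow> \<rho> * \<bar>x $ i - x $ j\<bar>"
    by (intro tendsto_intros lim rs)
  ultimately have "\<bar>y $ i - y $ j\<bar> * (N $ i $ j)\<^sup>2 \<le> \<rho> * \<bar>x $ i - x $ j\<bar>"
    by (intro LIMSEQ_le) auto
  then have "\<bar>y $ i - y $ j\<bar> * (N $ i $ j)\<^sup>2 \<le> 0" using ij(1) by simp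
  then show "N $ i $ j = 0" using ij(3) by (simp add: mult_le_0_iff)
qed

section \<open>Limits of eigenbases, interior directions and normal directions\<close>

lemma closed_SymMat: "closed SymMat"
  using subspace_SymMat by (rule closed_subspace)

text \<open>Orthogonality, diagonal form and sortedness are closed conditions. Along convergent
  eigenbases the eigenvalues are the diagonals of \<open>rot (Ps k) (Xs k)\<close>, so they converge
  without any perturbation inequality.\<close>

lemma orth_diag_limit:
  assumes Xs: "Xs \<longlonglongrightarrow> X" and Ps: "Ps \<longlonglongrightarrow> P" and PX: "\<And>k. Ps k \<in> orth_diag (Xs k)" "\<And>k. Xs k \<in> SymMat"
  shows "P \<in> orth_diag X" "(\<lambda>k. eigvals (Xs k)) \<longlonglongrightarrow> eigvals X"
proof -
  define v where "v = diagv (rot P X)"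
  have lim: "(\<lambda>k. Diag (eigvals (Xs k))) \<longlonglongrightarrow> rot P X"
    using tendsto_rot[OF Ps Xs] by (simp add: orth_diagD(2)[OF PX(1)])
  have v: "(\<lambda>k. eigvals (Xs k)) \<longlonglongrightarrow> v"
    using tendsto_diagv[OF lim] by (simp add: v_def)
  have "(\<lambda>k. Diag (eigvals (Xs k))) \<longlonglongrightarrow> Diag v" by (rule tendsto_Diag[OF v])
  then have PXv: "rot P X = Diag v" using lim LIMSEQ_unique by blast
  have "(\<lambda>k. transpose (Ps k) ** Ps k) \<longlonglongrightarrow> transpose P ** P"
    by (intro matrix_mult.tendsto tendsto_transpose Ps)
  then have "(\<lambda>k. mat 1) \<longlonglongrightarrow> transpose P ** P"
    using orth_diagD(1)[OF PX(1)] by (simp add: orthogonal_matrix_cancel)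
  then have "mat 1 = transpose P ** P" by (rule LIMSEQ_unique[OF tendsto_const])
  then have P: "orthogonal_matrix P" by (simp add: orthogonal_matrix)
  have "v $ j \<le> v $ i" if "i \<le> j" for i j
  proof (rule LIMSEQ_le)
    show "(\<lambda>k. eigvals (Xs k) $ j) \<longlonglongrightarrow> v $ j" "(\<lambda>k. eigvals (Xs k) $ i) \<longlonglongrightarrow> v $ i"
      by (rule tendsto_vec_nth[OF v])+
    show "\<exists>N. \<forall>n\<ge>N. eigvals (Xs n) $ j \<le> eigvals (Xs n) $ i"
      using sorted_eigvals[OF PX(2)] that by (auto simp: sorted_vec_def)
  qed
  then have "sorted_vec v" by (simp add: sorted_vec_def)
  from orth_diagI[OF P PXv this] v show "P \<in> orth_diag X" "(\<lambda>k. eigvals (Xs k)) \<longlonglongrightarrow> eigvals X"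
    by auto
qed

lemma ncone_perturb_interior:
  "\<exists>d. \<exists>e>0. \<forall>w\<in>span (ncone \<theta> x y). norm w < e \<longrightarrow> d + w \<in> ncone \<theta> x y"
proof -
  let ?C = "ncone \<theta> x y"
  have "rel_interior ?C \<noteq> {}" using rel_interior_eq_empty[OF convex_ncone] ncone_0 by blast
  then obtain d e where d: "d \<in> ?C" and e: "e > 0" "ball d e \<inter> affine hull ?C \<subseteq> ?C"
    by (auto simp: mem_rel_interior_ball)
  have aff: "affine hull ?C = span ?C" by (rule affine_hull_span_0) (intro hull_inc ncone_0)
  have "d + w \<in> ?C" if "w \<in> span ?C" "norm w < e" for w
  proof -
    have "d + w \<in> ball d e" using that(2) by (simp add: dist_norm)
    moreover have "d + w \<in> span ?C" using that(1) d by (intro span_add) (auto intro: span_base)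
    ultimately show ?thesis using e(2) aff by blast
  qed
  then show ?thesis using e(1) by auto
qed

lemma subdiff_shift:
  assumes "y \<in> subdiff UNIV \<theta> x" "\<theta> x = ereal r" "\<theta> (x + v) = ereal (r + y \<bullet> v)"
  shows "y \<in> subdiff UNIV \<theta> (x + v)"
  using assms by (auto simp: subdiff_def inner_diff_right inner_add_right algebra_simps)

lemma subdiff_closed_sequentially:
  assumes ys: "ys \<longlonglongrightarrow> y" and mem: "\<And>k. ys k \<in> subdiff UNIV \<theta> x"
  shows "y \<in> subdiff UNIV \<theta> x"
proof -
  obtain r where r: "\<theta> x = ereal r" using subdiff_finite[OF mem] by blast
  have "ereal (r + y \<bullet> (z - x)) \<le> \<theta> z" for z
  proof (rule LIMSEQ_le_const2)
    show "(\<lambda>k. ereal (r + ys k \<bullet> (z - x))) \<longlonglongrightarrow> ereal (r + y \<bullet> (z - x))"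
      unfolding lim_ereal by (intro tendsto_intros ys)
    show "\<exists>N. \<forall>n\<ge>N. ereal (r + ys n \<bullet> (z - x)) \<le> \<theta> z"
      using subdiffD[OF mem, of _ z] r by simp
  qed
  then show ?thesis using r by (simp add: subdiff_def)
qed

context symmetric_function
begin

text \<open>Sum an interior direction over the permutations fixing \<open>x\<close> and
  \<open>y\<close>. With this symmetry, indices tied in both \<open>x\<close> and \<open>y\<close>
  remain tied after the perturbation, and \<open>Diag d\<close> commutes with rotations of the
  common blocks.\<close>

lemma symmetric_interior_direction:
  "\<exists>d. (\<exists>e>0. \<forall>w\<in>span (ncone \<theta> x y). norm w < e \<longrightarrow> d + w \<in> ncone \<theta> x y) \<and>
    (\<forall>i j. x $ i = x $ j \<longrightarrow> y $ i = y $ j \<longrightarrow> d $ i = d $ j)"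
proof -
  obtain d e where e: "e > 0" and d: "\<And>w. w \<in> span (ncone \<theta> x y) \<Longrightarrow> norm w < e \<Longrightarrow> d + w \<in> ncone \<theta> x y"
    using ncone_perturb_interior[of \<theta> x y] by auto
  define G where "G = {\<sigma>. \<sigma> permutes UNIV \<and> (\<forall>i. x $ \<sigma> i = x $ i) \<and> (\<forall>i. y $ \<sigma> i = y $ i)}"
  have "finite {\<sigma>. \<sigma> permutes (UNIV :: 'n set)}" by (simp add: finite_permutations)
  then have fin: "finite G" by (rule rev_finite_subset) (auto simp: G_def)
  have id: "id \<in> G" using permutes_id[of UNIV] by (simp add: G_def)
  have d0: "d \<in> ncone \<theta> x y" using d[of 0] e by (simp add: span_0)
  define D where "D = (\<Sum>\<sigma>\<in>G. (\<chi> i. d $ \<sigma> i))"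
  \<comment> \<open>The identity summand keeps its radius \<open>e\<close>; the others lie in the
    convex cone, and adding them cannot destroy the neighbourhood.\<close>
  have split: "D = d + (\<Sum>\<sigma>\<in>G - {id}. (\<chi> i. d $ \<sigma> i))"
    unfolding D_def by (subst sum.remove[OF fin id]) simp
  have rest: "(\<Sum>\<sigma>\<in>G - {id}. (\<chi> i. d $ \<sigma> i)) \<in> ncone \<theta> x y"
  proof (rule ncone_sum)
    show "finite (G - {id})" using fin by simp
    show "(\<chi> i. d $ \<sigma> i) \<in> ncone \<theta> x y" if "\<sigma> \<in> G - {id}" for \<sigma>
      using that ncone_permute[OF d0, of \<sigma>] by (simp add: G_def)
  qed
  have "D + w \<in> ncone \<theta> x y" if "w \<in> span (ncone \<theta> x y)" "norm w < e" for w
    using ncone_add[OF d[OF that] rest] by (simp add: split algebra_simps)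
  with e have near: "\<exists>e>0. \<forall>w\<in>span (ncone \<theta> x y). norm w < e \<longrightarrow> D + w \<in> ncone \<theta> x y"
    by (intro exI[of _ e] conjI ballI impI)
  have "D $ i = D $ j" if "x $ i = x $ j" "y $ i = y $ j" for i j
  proof -
    let ?\<tau> = "Transposition.transpose i j"
    have \<tau>: "?\<tau> permutes UNIV" by (rule permutes_swap_id) auto
    have inv: "x $ ?\<tau> k = x $ k" "y $ ?\<tau> k = y $ k" for k
      using that by (simp_all add: Transposition.transpose_def)
    have G: "\<sigma> \<circ> ?\<tau> \<in> G" if "\<sigma> \<in> G" for \<sigma>
      using that inv permutes_compose[OF \<tau>, of \<sigma>] by (simp add: G_def)
    have "D $ i = (\<Sum>\<sigma>\<in>G. d $ \<sigma> i)" by (simp add: D_def)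
    also have "\<dots> = (\<Sum>\<sigma>\<in>G. d $ \<sigma> j)"
    proof (rule sum.reindex_cong[where l = "\<lambda>\<sigma>. \<sigma> \<circ> ?\<tau>"])
      have inv: "(\<sigma> \<circ> ?\<tau>) \<circ> ?\<tau> = \<sigma>" for \<sigma> :: "'n \<Rightarrow> 'n" by (simp add: fun_eq_iff)
      show "inj_on (\<lambda>\<sigma>. \<sigma> \<circ> ?\<tau>) G" by (rule inj_on_inverseI) (rule inv)
      show "G = (\<lambda>\<sigma>. \<sigma> \<circ> ?\<tau>) ` G"
      proof
        show "G \<subseteq> (\<lambda>\<sigma>. \<sigma> \<circ> ?\<tau>) ` G" using G inv by (metis image_eqI subsetI)
        show "(\<lambda>\<sigma>. \<sigma> \<circ> ?\<tau>) ` G \<subseteq> G" using G by blast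
      qed
      show "d $ (\<sigma> \<circ> ?\<tau>) i = d $ \<sigma> j" for \<sigma> by simp
    qed
    also have "\<dots> = D $ j" by (simp add: D_def)
    finally show ?thesis .
  qed
  with near show ?thesis by (intro exI[of _ D] conjI allI impI)
qed

lemma rot_mult_subdiff:
  assumes P: "P \<in> orth_diag X" and s: "s \<in> subdiff UNIV \<theta> (eigvals X)"
    and R: "orthogonal_matrix R" "blk (\<lambda>i j. eigvals X $ i = eigvals X $ j) R"
  shows "rot (transpose (P ** R)) (Diag s) \<in> subdiff SymMat g X"
proof (rule rot_subdiff[OF s])
  note P = orth_diagD[OF P]
  show "orthogonal_matrix (P ** R)" using P(1) R(1) by (rule orthogonal_matrix_mul)
  show "rot (P ** R) X = Diag (eigvals X)"
    unfolding rot_rot[symmetric] P(2) by (rule blk_rot_Diag(1)[OF R(2) _ R(1)])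
qed

text \<open>The subgradients of the spectral function contain the whole orbit of \<open>Diag (eigvals Y)\<close> under
  rotations within the eigenspaces of \<open>X\<close>.\<close>

lemma normal_direction:
  assumes XY: "(X, Y) \<in> gph_subdiff SymMat g" and P: "P \<in> orth_diag X" "P \<in> orth_diag Y"
    and H: "H \<in> SymMat" and normal: "\<And>M. M \<in> subdiff SymMat g X \<Longrightarrow> M \<bullet> H \<le> Y \<bullet> H"
  shows "orthogonal_matrix R \<Longrightarrow> blk (\<lambda>i j. eigvals X $ i = eigvals X $ j \<and> eigvals Y $ i = eigvals Y $ j) R
      \<Longrightarrow> diagv (rot R (rot P H)) \<in> ncone \<theta> (eigvals X) (eigvals Y)"
    and "eigvals X $ i = eigvals X $ j \<Longrightarrow> eigvals Y $ i \<noteq> eigvals Y $ j \<Longrightarrow> rot P H $ i $ j = 0"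
proof -
  define x y where "x = eigvals X" and "y = eigvals Y"
  have sub: "y \<in> subdiff UNIV \<theta> x" using gph_eigvals[OF XY P] by (simp add: x_def y_def)
  have YH: "Y \<bullet> H = y \<bullet> diagv (rot P H)" using rot_trace_eigvals[OF P(2)] by (simp add: y_def)
  have le: "s \<bullet> diagv (rot R (rot P H)) \<le> y \<bullet> diagv (rot P H)"
    if "s \<in> subdiff UNIV \<theta> x" "orthogonal_matrix R" "blk (\<lambda>i j. x $ i = x $ j) R" for s R
    using normal[OF rot_mult_subdiff[OF P(1) that(1)[unfolded x_def] that(2) that(3)[unfolded x_def]]]
    by (simp add: YH inner_rot inner_Diag rot_rot)
  show "diagv (rot R (rot P H)) \<in> ncone \<theta> (eigvals X) (eigvals Y)"
    if R: "orthogonal_matrix R" "blk (\<lambda>i j. eigvals X $ i = eigvals X $ j \<and> eigvals Y $ i = eigvals Y $ j) R"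
  proof -
    have "rot (transpose R) (Diag y) = Diag y" by (rule blk_rot_Diag(2)[OF R(2) _ R(1)]) (simp add: y_def)
    moreover have "y \<bullet> diagv (rot R (rot P H)) = rot (transpose R) (Diag y) \<bullet> rot P H"
      by (simp add: inner_rot inner_Diag)
    ultimately have "y \<bullet> diagv (rot R (rot P H)) = y \<bullet> diagv (rot P H)" by (simp add: inner_Diag)
    moreover have "blk (\<lambda>i j. x $ i = x $ j) R" using R(2) by (rule blk_mono) (simp add: x_def)
    ultimately show ?thesis
      using le[OF _ R(1)] by (simp add: ncone_def flip: x_def y_def)
  qed
  show "rot P H $ i $ j = 0" if "eigvals X $ i = eigvals X $ j" "eigvals Y $ i \<noteq> eigvals Y $ j"
  proof -
    have "i \<noteq> j" using that by auto
    have "(y $ i - y $ j) * rot P H $ i $ j = 0"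
    proof (rule givens_optimal(1)[OF \<open>i \<noteq> j\<close> rot_SymMat[OF H]])
      fix co si :: real assume "co\<^sup>2 + si\<^sup>2 = 1"
      then show "y \<bullet> diagv (rot (givens i j co si) (rot P H)) \<le> y \<bullet> diagv (rot P H)"
        using that \<open>i \<noteq> j\<close> by (intro le[OF sub] orthogonal_givens blk_givens)
          (auto simp: reflp_def symp_def x_def)
    qed
    then show ?thesis using that by (simp add: y_def)
  qed
qed

lemma normal_direction_model:
  assumes "(X, Y) \<in> gph_subdiff SymMat g" "P \<in> orth_diag X" "P \<in> orth_diag Y"
    and "H \<in> SymMat" "\<And>M. M \<in> subdiff SymMat g X \<Longrightarrow> M \<bullet> H \<le> Y \<bullet> H"
  shows "H \<in> model_space P (eigvals X) (eigvals Y) (span (ncone \<theta> (eigvals X) (eigvals Y)))"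
  using normal_direction[OF assms] assms(4) by (intro model_spaceI subspace_span span_base) auto

lemma crit_cone_subset_model:
  assumes "(X, Y) \<in> gph_subdiff SymMat g" "P \<in> orth_diag X" "P \<in> orth_diag Y"
  shows "crit_cone SymMat g X Y \<subseteq> model_space P (eigvals X) (eigvals Y) (span (ncone \<theta> (eigvals X) (eigvals Y)))"
proof
  fix H assume H: "H \<in> crit_cone SymMat g X Y"
  then have "H \<in> SymMat" by (simp add: crit_cone_def)
  then show "H \<in> model_space P (eigvals X) (eigvals Y) (span (ncone \<theta> (eigvals X) (eigvals Y)))"
  proof (rule normal_direction_model[OF assms])
    fix M assume "M \<in> subdiff SymMat g X"
    then have "ereal (M \<bullet> H) \<le> subderiv SymMat g X H" by (rule subderiv_ge_inner[OF subspace_SymMat])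
    also have "\<dots> = ereal (Y \<bullet> H)" using H by (simp add: crit_cone_def)
    finally show "M \<bullet> H \<le> Y \<bullet> H" by simp
  qed
qed

end

section \<open>Cones at perturbed points and the affine hull of the critical cone\<close>

locale symmetric_polyhedral = symmetric_function \<theta> + polyhedral_rep \<theta> a c p b d m
  for \<theta> :: "('n::{finite,linorder}) rvec \<Rightarrow> ereal" and a c p b d m
begin

lemma eventually_le_ncone:
  assumes "\<theta> x = ereal r" "w \<in> ncone \<theta> x y"
  shows "eventually (\<lambda>t. \<theta> (x + t *\<^sub>R w) \<le> ereal (r + t * (y \<bullet> w))) (at_right 0)"
  using assms by (intro eventually_le_support) (auto simp: ncone_def)

text \<open>At \<open>x + v\<close> the graph of \<open>\<theta>\<close> touches the minorant of
  slope \<open>y\<close> again, and from there \<open>\<theta>\<close> grows along \<open>w\<close>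
  at rate at most \<open>y \<bullet> w\<close>. Hence \<open>v + t *\<^sub>R w\<close> lies in the
  cone at \<open>x\<close> for some positive \<open>t\<close>, and \<open>v\<close> can be
  subtracted in the span.\<close>

lemma ncone_of_translate:
  assumes x: "\<theta> x = ereal r" and v: "\<theta> (x + v) = ereal (r + y \<bullet> v)"
    and v': "v \<in> span (ncone \<theta> x y)"
    and w: "\<And>s. s \<in> subdiff UNIV \<theta> (x + v) \<Longrightarrow> s \<bullet> w \<le> y \<bullet> w"
  shows "w \<in> span (ncone \<theta> x y)"
proof -
  have "eventually (\<lambda>t. \<theta> (x + v + t *\<^sub>R w) \<le> ereal (r + y \<bullet> v + t * (y \<bullet> w))) (at_right 0)"
    by (rule eventually_le_support[OF v w])
  then have "eventually (\<lambda>t. t > 0 \<and> v + t *\<^sub>R w \<in> ncone \<theta> x y) (at_right 0)"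
    using eventually_at_right_less
  proof eventually_elim
    case (elim t)
    then show ?case
      using ncone_of_le[of \<theta> x r "v + t *\<^sub>R w" y] x by (simp add: inner_add_right add.assoc)
  qed
  then obtain t where t: "t > 0" "v + t *\<^sub>R w \<in> ncone \<theta> x y"
    using eventually_happens'[OF trivial_limit_at_right_real] by blast
  have "(v + t *\<^sub>R w) - v \<in> span (ncone \<theta> x y)" by (rule span_diff[OF span_base[OF t(2)] v'])
  then have "(1 / t) *\<^sub>R (t *\<^sub>R w) \<in> span (ncone \<theta> x y)" by (intro span_scale[of "t *\<^sub>R w"]) simp
  then show ?thesis using t(1) by simp
qed

text \<open>Every subgradient at \<open>x + t *\<^sub>R dd\<close> agrees with \<open>y\<close> on \<open>dd\<close> and is a subgradient at \<open>x\<close>, so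
  testing it against \<open>dd + \<epsilon> *\<^sub>R w\<close> compares it with \<open>y\<close> on \<open>w\<close>.\<close>

lemma ncone_interior_direction:
  assumes x: "\<theta> x = ereal r"
    and e: "e > 0" "\<And>w. w \<in> span (ncone \<theta> x y) \<Longrightarrow> norm w < e \<Longrightarrow> dd + w \<in> ncone \<theta> x y"
    and t: "0 < t" "t < t0" "\<theta> (x + t *\<^sub>R dd) = ereal (r + t * (y \<bullet> dd))"
      "\<theta> (x + t0 *\<^sub>R dd) = ereal (r + t0 * (y \<bullet> dd))"
  shows "ncone \<theta> (x + t *\<^sub>R dd) y = span (ncone \<theta> x y)"
proof
  have dd: "dd \<in> ncone \<theta> x y" using e(2)[of 0] e(1) by (simp add: span_0)
  show "ncone \<theta> (x + t *\<^sub>R dd) y \<subseteq> span (ncone \<theta> x y)"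
  proof
    fix w assume w: "w \<in> ncone \<theta> (x + t *\<^sub>R dd) y"
    show "w \<in> span (ncone \<theta> x y)"
    proof (rule ncone_of_translate[OF x])
      show "\<theta> (x + t *\<^sub>R dd) = ereal (r + y \<bullet> (t *\<^sub>R dd))" using t(3) by simp
      show "t *\<^sub>R dd \<in> span (ncone \<theta> x y)" by (rule span_scale[OF span_base[OF dd]])
      show "s \<bullet> w \<le> y \<bullet> w" if "s \<in> subdiff UNIV \<theta> (x + t *\<^sub>R dd)" for s
        using w that by (simp add: ncone_def)
    qed
  qed
  show "span (ncone \<theta> x y) \<subseteq> ncone \<theta> (x + t *\<^sub>R dd) y"
    unfolding ncone_def[of \<theta> "x + t *\<^sub>R dd"]
  proof safe
    fix w s assume w: "w \<in> span (ncone \<theta> x y)" and s: "s \<in> subdiff UNIV \<theta> (x + t *\<^sub>R dd)"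
    \<comment> \<open>The point with parameter \<open>t\<close> lies strictly between those with
      parameters \<open>0\<close> and \<open>t0\<close>, and \<open>\<theta>\<close> is affine with
      slope \<open>y\<close> at the three points; testing at both ends forces
      \<open>s \<bullet> dd = y \<bullet> dd\<close>.\<close>
    have "r + t * (y \<bullet> dd) + s \<bullet> (x + t0 *\<^sub>R dd - (x + t *\<^sub>R dd)) \<le> r + t0 * (y \<bullet> dd)"
      using subdiffD[OF s, of "x + t0 *\<^sub>R dd"] t by simp
    then have "(t0 - t) * (s \<bullet> dd) \<le> (t0 - t) * (y \<bullet> dd)"
      by (simp add: inner_diff_right algebra_simps)
    then have 1: "s \<bullet> dd \<le> y \<bullet> dd" using t(2) by simp
    have "r + t * (y \<bullet> dd) + s \<bullet> (x - (x + t *\<^sub>R dd)) \<le> r"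
      using subdiffD[OF s, of x] t x by simp
    then have "t * (y \<bullet> dd) \<le> t * (s \<bullet> dd)" by simp
    then have 2: "s \<bullet> dd = y \<bullet> dd" using t(1) 1 by simp
    have "ereal (r + s \<bullet> (z - x)) \<le> \<theta> z" for z
      using subdiffD[OF s, of z] t(3) 2 by (simp add: inner_diff_right inner_add_right algebra_simps)
    then have s': "s \<in> subdiff UNIV \<theta> x" using x by (simp add: subdiff_def)
    \<comment> \<open>Any positive factor bringing the norm below \<open>e\<close> would do; the
      summand 1 covers \<open>w = 0\<close>.\<close>
    define \<epsilon> where "\<epsilon> = e / (2 * (norm w + 1))"
    have \<epsilon>: "\<epsilon> > 0" using e(1) by (simp add: \<epsilon>_def add_nonneg_pos)
    have "norm (\<epsilon> *\<^sub>R w) = \<epsilon> * norm w" using \<epsilon> by simp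
    also have "\<dots> = e * (norm w / (2 * (norm w + 1)))" by (simp add: \<epsilon>_def)
    also have "\<dots> < e * 1"
      using e(1) norm_ge_zero[of w] by (intro mult_strict_left_mono) (auto simp: divide_less_eq add_nonneg_pos)
    finally have "dd + \<epsilon> *\<^sub>R w \<in> ncone \<theta> x y" using w by (intro e(2) span_scale) auto
    then have "s \<bullet> (dd + \<epsilon> *\<^sub>R w) \<le> y \<bullet> (dd + \<epsilon> *\<^sub>R w)" using s' by (simp add: ncone_def)
    then show "s \<bullet> w \<le> y \<bullet> w" using 2 \<epsilon> by (simp add: inner_add_right)
  qed
qed

text \<open>When the cone is a subspace, the necessary condition, stated with its span, and the
  sufficient one, given by curves, describe the same domain.\<close>

lemma subderiv2_formula:
  assumes XY: "(X, Y) \<in> gph_subdiff SymMat g" and P: "P \<in> orth_diag X" "P \<in> orth_diag Y"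
    and sp: "subspace (ncone \<theta> (eigvals X) (eigvals Y))" and H: "H \<in> SymMat"
  shows "subderiv2 SymMat g X Y H = ereal (ups (eigvals X) (eigvals Y) (rot P H)) +
      indic (model_space P (eigvals X) (eigvals Y) (ncone \<theta> (eigvals X) (eigvals Y))) H"
    (is "_ = _ + indic ?M H")
proof (cases "H \<in> ?M")
  case True
  obtain R w where R: "orthogonal_matrix R"
    "blk (\<lambda>i j. eigvals X $ i = eigvals X $ j \<and> eigvals Y $ i = eigvals Y $ j) R"
    and w: "w \<in> ncone \<theta> (eigvals X) (eigvals Y)"
    and eq: "\<And>i j. eigvals X $ i = eigvals X $ j \<Longrightarrow> rot P H $ i $ j = rot (transpose R) (Diag w) $ i $ j"
    using model_space_diagonalize[OF True sp] by blast
  obtain r where r: "\<theta> (eigvals X) = ereal r" using gph_eigvals[OF XY P] subdiff_finite by blast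
  have "subderiv2 SymMat g X Y H \<le> ereal (ups (eigvals X) (eigvals Y) (rot P H))"
    using eventually_le_ncone[OF r w] r by (intro subderiv_le_of_curve(2)[OF XY P H R eq]) auto
  then show ?thesis
    using subderiv2_ge_ups[OF XY P H] True by (auto simp: indic_def intro: antisym)
next
  case False
  have "\<not> subderiv2 SymMat g X Y H < \<infinity>"
  proof
    assume "subderiv2 SymMat g X Y H < \<infinity>"
    then have "H \<in> model_space P (eigvals X) (eigvals Y) (span (ncone \<theta> (eigvals X) (eigvals Y)))"
      by (intro normal_direction_model[OF XY P H] subderiv2_finite_imp_inner_le[OF subspace_SymMat])
    then show False using False by (simp add: span_eq_iff[THEN iffD2, OF sp])
  qed
  then show ?thesis using False by (simp add: indic_def)
qed

text \<open>An interior direction of the cone lifts to a critical \<open>D\<close> from which every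
  \<open>H\<close> of the model space can be added with a small positive factor, so \<open>H\<close>
  is a multiple of a difference of critical directions.\<close>

lemma affine_hull_crit_cone:
  assumes XY: "(X, Y) \<in> gph_subdiff SymMat g" and P: "P \<in> orth_diag X" "P \<in> orth_diag Y"
  shows "affine hull (crit_cone SymMat g X Y) =
    model_space P (eigvals X) (eigvals Y) (span (ncone \<theta> (eigvals X) (eigvals Y)))"
proof -
  define x y where "x = eigvals X" and "y = eigvals Y"
  define W where "W = span (ncone \<theta> x y)"
  define C where "C = crit_cone SymMat g X Y"
  have W: "subspace W" by (simp add: W_def)
  note PX = orth_diagD[OF P(1), folded x_def]
  have S: "X \<in> SymMat" "Y \<in> SymMat" "Y \<in> subdiff SymMat g X"
    using XY by (auto simp: gph_subdiff_def subdiff_def)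
  have sub: "y \<in> subdiff UNIV \<theta> x" using gph_eigvals[OF XY P] by (simp add: x_def y_def)
  obtain r where r: "\<theta> x = ereal r" using subdiff_finite[OF sub] by blast
  have critI: "K \<in> C" if "K \<in> SymMat" "orthogonal_matrix R" "blk (\<lambda>i j. x $ i = x $ j \<and> y $ i = y $ j) R"
    "\<And>i j. x $ i = x $ j \<Longrightarrow> rot P K $ i $ j = rot (transpose R) (Diag w) $ i $ j" "w \<in> ncone \<theta> x y" for K R w
  proof -
    have "subderiv SymMat g X K \<le> ereal (Y \<bullet> K)"
      using eventually_le_ncone[OF r that(5)] r that(1-4)
      by (intro subderiv_le_of_curve(1)[OF XY P, of K R w]) (auto simp: x_def y_def)
    moreover have "ereal (Y \<bullet> K) \<le> subderiv SymMat g X K"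
      using S(3) by (rule subderiv_ge_inner[OF subspace_SymMat])
    ultimately show ?thesis using that(1) by (auto simp: C_def crit_cone_def intro: antisym)
  qed
  obtain dd where "\<exists>e>0. \<forall>w\<in>W. norm w < e \<longrightarrow> dd + w \<in> ncone \<theta> x y"
    and dd: "\<And>i j. x $ i = x $ j \<Longrightarrow> y $ i = y $ j \<Longrightarrow> dd $ i = dd $ j"
    using symmetric_interior_direction[of x y] unfolding W_def[symmetric] by blast
  then obtain e where e: "e > 0" "\<And>w. w \<in> W \<Longrightarrow> norm w < e \<Longrightarrow> dd + w \<in> ncone \<theta> x y"
    by blast
  \<comment> \<open>By the symmetry of \<open>dd\<close>, the rotation that diagonalizes the block
    part of \<open>H\<close> fixes \<open>Diag dd\<close>, so the blocks of
    \<open>D + \<epsilon> *\<^sub>R H\<close> are diagonalized by it too.\<close>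
  define D where "D = rot (transpose P) (Diag dd)"
  have DH: "\<exists>\<epsilon>>0. D \<in> C \<and> D + \<epsilon> *\<^sub>R H \<in> C" if H: "H \<in> model_space P x y W" for H
  proof -
    obtain R w where R: "orthogonal_matrix R" "blk (\<lambda>i j. x $ i = x $ j \<and> y $ i = y $ j) R" "w \<in> W"
      and eq: "\<And>i j. x $ i = x $ j \<Longrightarrow> rot P H $ i $ j = rot (transpose R) (Diag w) $ i $ j"
      using model_space_diagonalize[OF H W] by blast
    have Rd: "rot (transpose R) (Diag dd) = Diag dd"
      by (rule blk_rot_Diag(2)[OF R(2) _ R(1)]) (use dd in blast)
    define \<epsilon> where "\<epsilon> = e / (2 * (norm w + 1))"
    have \<epsilon>: "\<epsilon> > 0" using e(1) by (simp add: \<epsilon>_def add_nonneg_pos)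
    have "norm (\<epsilon> *\<^sub>R w) = \<epsilon> * norm w" using \<epsilon> by simp
    also have "\<dots> = e * (norm w / (2 * (norm w + 1)))" by (simp add: \<epsilon>_def)
    also have "\<dots> < e * 1"
      using e(1) norm_ge_zero[of w] by (intro mult_strict_left_mono) (auto simp: divide_less_eq add_nonneg_pos)
    finally have small: "norm (\<epsilon> *\<^sub>R w) < e" by simp
    have "D + \<delta> *\<^sub>R H \<in> C" if "norm (\<delta> *\<^sub>R w) < e" for \<delta>
    proof (rule critI[OF _ R(1,2)])
      show "D + \<delta> *\<^sub>R H \<in> SymMat"
        using model_spaceD(1)[OF H] unfolding D_def
        by (intro subspace_add[OF subspace_SymMat] subspace_scale[OF subspace_SymMat] rot_SymMat Diag_SymMat)
      show "rot P (D + \<delta> *\<^sub>R H) $ i $ j = rot (transpose R) (Diag (dd + \<delta> *\<^sub>R w)) $ i $ j" if "x $ i = x $ j" for i j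
        using eq[OF that] PX(1) by (simp add: D_def rot_add rot_scaleR Diag_add Diag_scaleR Rd)
      show "dd + \<delta> *\<^sub>R w \<in> ncone \<theta> x y" using that R(3) W by (intro e(2) subspace_scale) auto
    qed
    from this[of \<epsilon>] this[of 0] small e(1) show ?thesis using \<epsilon> by auto
  qed
  have "0 \<in> C"
    using PX(1) by (intro critI[of 0 "mat 1" 0])
      (auto simp: ncone_0 rot_zero Diag_zero subspace_0[OF subspace_SymMat] orthogonal_matrix_id
        blk_mat_1 reflp_def)
  then have aff: "affine hull C = span C" by (intro affine_hull_span_0 hull_inc)
  have "model_space P x y W \<subseteq> span C"
  proof
    fix H assume "H \<in> model_space P x y W"
    then obtain \<epsilon> where \<epsilon>: "\<epsilon> > 0" "D \<in> C" "D + \<epsilon> *\<^sub>R H \<in> C" using DH by blast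
    then have "(1 / \<epsilon>) *\<^sub>R ((D + \<epsilon> *\<^sub>R H) - D) \<in> span C" by (intro span_scale span_diff span_base)
    then show "H \<in> span C" using \<epsilon>(1) by simp
  qed
  moreover have "span C \<subseteq> model_space P x y W"
    using crit_cone_subset_model[OF XY P] subspace_model_space[OF W]
    by (intro span_minimal) (auto simp: C_def W_def x_def y_def)
  ultimately show ?thesis using aff by (auto simp: C_def W_def x_def y_def)
qed

end

section \<open>Epi-convergence\<close>

lemma inner_limit_subset_outer_limit: "inner_limit C \<subseteq> outer_limit C"
proof
  fix x assume "x \<in> inner_limit C"
  then obtain s where ev: "eventually (\<lambda>k. s k \<in> C k) sequentially" and s: "s \<longlonglongrightarrow> x"
    by (auto simp: inner_limit_def)
  from ev obtain K where K: "\<And>k. k \<ge> K \<Longrightarrow> s k \<in> C k" by (auto simp: eventually_sequentially)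
  have "strict_mono (\<lambda>k. k + K)" by (simp add: strict_mono_def)
  moreover have "\<forall>k. s (k + K) \<in> C (k + K)" using K by simp
  moreover have "(\<lambda>k. s (k + K)) \<longlonglongrightarrow> x" using s by (rule LIMSEQ_ignore_initial_segment)
  ultimately show "x \<in> outer_limit C" unfolding outer_limit_def by (intro CollectI exI conjI)
qed

lemma gqf_cong:
  assumes "\<And>x. x \<in> E \<Longrightarrow> f x = f' x"
  shows "gqf E f \<longleftrightarrow> gqf E f'"
proof -
  have dom: "edom E f = edom E f'" using assms by (auto simp: edom_def)
  have "proper_on E f \<longleftrightarrow> proper_on E f'" using assms by (simp add: proper_on_def dom)
  moreover have "(\<forall>x\<in>edom E f'. f x = h x) \<longleftrightarrow> (\<forall>x\<in>edom E f'. f' x = h x)" for h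
    using assms by (simp add: edom_def)
  ultimately show ?thesis unfolding gqf_def dom by simp
qed

lemma epi_cong: "(\<And>x. x \<in> E \<Longrightarrow> f x = f' x) \<Longrightarrow> epi E f = epi E f'"
  by (auto simp: epi_def)

text \<open>Formulas for the candidate hold on symmetric matrices only, so its two descriptions need
  not be equal as total functions.\<close>

lemma quad_cong:
  assumes "\<And>x. x \<in> E \<Longrightarrow> q x = q' x"
  shows "q \<in> quad E f x y \<longleftrightarrow> q' \<in> quad E f x y"
  using gqf_cong[of E q q', OF assms] epi_cong[of E q q', OF assms]
  by (simp add: quad_def epi_converges_def)

lemma epi_model:
  "(H, \<rho>) \<in> epi SymMat (\<lambda>H. ereal (ups x y (rot P H)) + indic (model_space P x y W) H) \<longleftrightarrow>
   H \<in> model_space P x y W \<and> ups x y (rot P H) \<le> \<rho>"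
  using model_spaceD(1)[of H P x y W] by (auto simp: epi_def indic_def)

text \<open>\<open>W\<close> stays fixed and the positions move. A constant \<open>H\<close>
  recovers each point of the limit; conversely a pair of indices separated by \<open>dd\<close> but
  tied in \<open>x\<close> has different \<open>y\<close>, so \<open>ups_limit\<close> removes its
  entry.\<close>

lemma epi_converges_model:
  fixes x y dd :: "real^'n" and t :: "nat \<Rightarrow> real"
  assumes W: "subspace W" and t: "t \<longlonglongrightarrow> 0" "\<And>k. t k > 0"
    and ne: "\<And>k i j. x $ i \<noteq> x $ j \<Longrightarrow> (x + t k *\<^sub>R dd) $ i \<noteq> (x + t k *\<^sub>R dd) $ j"
    and dd: "\<And>i j. x $ i = x $ j \<Longrightarrow> y $ i = y $ j \<Longrightarrow> dd $ i = dd $ j"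
    and ord: "\<And>k i j. 0 \<le> (y $ i - y $ j) * ((x + t k *\<^sub>R dd) $ i - (x + t k *\<^sub>R dd) $ j)"
  shows "epi_converges SymMat
    (\<lambda>k H. ereal (ups (x + t k *\<^sub>R dd) y (rot P H)) + indic (model_space P (x + t k *\<^sub>R dd) y W) H)
    (\<lambda>H. ereal (ups x y (rot P H)) + indic (model_space P x y W) H)"
proof -
  define xs where "xs k = x + t k *\<^sub>R dd" for k
  define C where "C k = epi SymMat (\<lambda>H. ereal (ups (xs k) y (rot P H)) + indic (model_space P (xs k) y W) H)" for k
  define D where "D = epi SymMat (\<lambda>H. ereal (ups x y (rot P H)) + indic (model_space P x y W) H)"
  have xs_eq: "xs k $ i = xs k $ j \<longleftrightarrow> x $ i = x $ j \<and> dd $ i = dd $ j" for k i j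
  proof (cases "x $ i = x $ j")
    case True
    then show ?thesis using t(2)[of k] by (simp add: xs_def)
  qed (use ne[of i j k] in \<open>auto simp: xs_def\<close>)
  have "(\<lambda>k. x + t k *\<^sub>R dd) \<longlonglongrightarrow> x + 0 *\<^sub>R dd" by (intro tendsto_intros t)
  then have xs: "xs \<longlonglongrightarrow> x" by (simp add: xs_def[abs_def])
  have inner: "D \<subseteq> inner_limit C"
  proof
    fix z assume "z \<in> D"
    then obtain H \<rho> where z: "z = (H, \<rho>)" and H: "H \<in> model_space P x y W" and \<rho>: "ups x y (rot P H) \<le> \<rho>"
      by (cases z) (auto simp: D_def epi_model)
    \<comment> \<open>The height is corrected by the difference of the two quadratic forms, which
      tends to zero.\<close>
    define s where "s k = (H, \<rho> + (ups (xs k) y (rot P H) - ups x y (rot P H)))" for k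
    have "H \<in> model_space P (xs k) y W" for k
      using H by (auto simp: model_space_def xs_eq)
    then have "s k \<in> C k" for k using \<rho> by (simp add: s_def C_def epi_model)
    moreover have "(\<lambda>k. ups (xs k) y (rot P H)) \<longlonglongrightarrow> ups x y (rot P H)"
      unfolding ups_def
    proof (intro tendsto_sum)
      fix i j
      show "(\<lambda>k. (y $ i - y $ j) / (xs k $ i - xs k $ j) * (rot P H $ i $ j)\<^sup>2) \<longlonglongrightarrow>
          (y $ i - y $ j) / (x $ i - x $ j) * (rot P H $ i $ j)\<^sup>2"
      proof (cases "x $ i = x $ j")
        case True
        \<comment> \<open>On the model space a pair tied in \<open>x\<close> has equal
          \<open>y\<close> or a zero entry, so its term is zero for every denominator, including the
          shrinking gaps.\<close>
        then have "(y $ i - y $ j) * (rot P H $ i $ j)\<^sup>2 = 0"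
          using model_spaceD(3)[OF H, of i j] by auto
        then have zero: "(y $ i - y $ j) / u * (rot P H $ i $ j)\<^sup>2 = 0" for u by auto
        show ?thesis unfolding zero by (rule tendsto_const)
      next
        case False
        then show ?thesis by (intro tendsto_intros tendsto_vec_nth xs) auto
      qed
    qed
    then have "s \<longlonglongrightarrow> (H, \<rho> + (ups x y (rot P H) - ups x y (rot P H)))"
      unfolding s_def[abs_def] by (intro tendsto_intros)
    ultimately show "z \<in> inner_limit C"
      unfolding inner_limit_def z by (auto intro!: exI[of _ s])
  qed
  have outer: "outer_limit C \<subseteq> D"
  proof
    fix z assume "z \<in> outer_limit C"
    then obtain \<phi> :: "nat \<Rightarrow> nat" and s where \<phi>: "strict_mono \<phi>" and s: "\<And>k. s k \<in> C (\<phi> k)" "s \<longlonglongrightarrow> z"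
      by (auto simp: outer_limit_def)
    define Hs rs where "Hs k = fst (s k)" and "rs k = snd (s k)" for k
    obtain H \<rho> where z: "z = (H, \<rho>)" by (cases z)
    have Hs: "Hs \<longlonglongrightarrow> H" and rs: "rs \<longlonglongrightarrow> \<rho>"
      using tendsto_fst[OF s(2)] tendsto_snd[OF s(2)] by (simp_all add: Hs_def[abs_def] rs_def[abs_def] z)
    have mem: "Hs k \<in> model_space P (xs (\<phi> k)) y W" and le: "ups (xs (\<phi> k)) y (rot P (Hs k)) \<le> rs k" for k
    proof -
      have "(Hs k, rs k) \<in> C (\<phi> k)" using s(1)[of k] by (simp add: Hs_def rs_def)
      then show "Hs k \<in> model_space P (xs (\<phi> k)) y W" "ups (xs (\<phi> k)) y (rot P (Hs k)) \<le> rs k"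
        by (simp_all add: C_def epi_model)
    qed
    have Ns: "(\<lambda>k. rot P (Hs k)) \<longlonglongrightarrow> rot P H" by (rule tendsto_rot_right[OF Hs])
    have x\<phi>: "(\<lambda>k. xs (\<phi> k)) \<longlonglongrightarrow> x" using LIMSEQ_subseq_LIMSEQ[OF xs \<phi>] by (simp add: o_def)
    have ord': "0 \<le> (y $ i - y $ j) * (xs (\<phi> k) $ i - xs (\<phi> k) $ j)" for k i j
      using ord unfolding xs_def by blast
    note lim = ups_limit[OF x\<phi> tendsto_const[of y] Ns rs le ord']
    have "H \<in> SymMat" using closed_sequentially[OF closed_SymMat _ Hs] model_spaceD(1)[OF mem] by blast
    moreover have "diagv (rot P H) \<in> W"
      using closed_sequentially[OF closed_subspace[OF W] _ tendsto_diagv[OF Ns]] model_spaceD(2)[OF mem] by blast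
    moreover have "y $ i = y $ j \<and> axis i 1 - axis j 1 \<in> W"
      if ij: "i \<noteq> j" "x $ i = x $ j" "rot P H $ i $ j \<noteq> 0" for i j
    proof (cases "dd $ i = dd $ j")
      case True
      have "(\<lambda>k. rot P (Hs k) $ i $ j) \<longlonglongrightarrow> rot P H $ i $ j" by (intro tendsto_vec_nth Ns)
      then have "eventually (\<lambda>k. rot P (Hs k) $ i $ j \<noteq> 0) sequentially"
        using ij(3) by (rule tendsto_imp_eventually_ne)
      then obtain k where "rot P (Hs k) $ i $ j \<noteq> 0" using eventually_happens'[OF sequentially_bot] by blast
      then show ?thesis using model_spaceD(3)[OF mem[of k] ij(1)] xs_eq True ij(2) by blast
    next
      case False
      then have "xs (\<phi> k) $ i \<noteq> xs (\<phi> k) $ j" for k by (simp add: xs_eq)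
      then have "y $ i = y $ j" using lim(2)[OF ij(2)] ij(3) by blast
      then show ?thesis using dd[OF ij(2)] False by blast
    qed
    ultimately have "H \<in> model_space P x y W" by (auto simp: model_space_def)
    then show "z \<in> D" using lim(1) by (simp add: z D_def epi_model)
  qed
  have "inner_limit C = D" "outer_limit C = D"
    using inner outer inner_limit_subset_outer_limit[of C] by auto
  then show ?thesis
    unfolding epi_converges_def pk_converges_def C_def[abs_def] D_def xs_def by simp
qed

section \<open>The minimal element of the quadratic bundle\<close>

context symmetric_polyhedral
begin

text \<open>Only \<open>X\<close> moves, along the lifted interior direction \<open>dd\<close>;
  \<open>Y\<close> and the basis \<open>P\<close> are kept. Each perturbed cone equals
  \<open>W\<close>, so \<open>subderiv2_formula\<close> applies along the sequence.\<close>

lemma model_mem_quad: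
  assumes XY: "(X, Y) \<in> gph_subdiff SymMat g" and P: "P \<in> orth_diag X" "P \<in> orth_diag Y"
  shows "(\<lambda>H. ereal (ups (eigvals X) (eigvals Y) (rot P H)) +
      indic (model_space P (eigvals X) (eigvals Y) (span (ncone \<theta> (eigvals X) (eigvals Y)))) H) \<in> quad SymMat g X Y"
proof -
  define x y where "x = eigvals X" and "y = eigvals Y"
  define W where "W = span (ncone \<theta> x y)"
  have W: "subspace W" by (simp add: W_def)
  have S: "X \<in> SymMat" "Y \<in> SymMat" using XY by (auto simp: gph_subdiff_def subdiff_def)
  note PX = orth_diagD[OF P(1), folded x_def] and PY = orth_diagD[OF P(2), folded y_def]
  have sx: "sorted_vec x" and sy: "sorted_vec y" using sorted_eigvals S by (simp_all add: x_def y_def)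
  have sub: "y \<in> subdiff UNIV \<theta> x" using gph_eigvals[OF XY P] by (simp add: x_def y_def)
  obtain r where r: "\<theta> x = ereal r" using subdiff_finite[OF sub] by blast
  obtain dd where "\<exists>e>0. \<forall>w\<in>W. norm w < e \<longrightarrow> dd + w \<in> ncone \<theta> x y"
    and dd: "\<And>i j. x $ i = x $ j \<Longrightarrow> y $ i = y $ j \<Longrightarrow> dd $ i = dd $ j"
    using symmetric_interior_direction[of x y] unfolding W_def[symmetric] by blast
  then obtain e where e: "e > 0" "\<And>w. w \<in> W \<Longrightarrow> norm w < e \<Longrightarrow> dd + w \<in> ncone \<theta> x y"
    by blast
  have ddC: "dd \<in> ncone \<theta> x y" using e(2)[of 0] e(1) W by (simp add: subspace_0)
  have ge: "ereal (r + t * (y \<bullet> dd)) \<le> \<theta> (x + t *\<^sub>R dd)" for t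
    using subdiffD[OF sub, of "x + t *\<^sub>R dd"] r by simp
  have "eventually (\<lambda>t. \<theta> (x + t *\<^sub>R dd) = ereal (r + t * (y \<bullet> dd))) (at_right 0)"
    using eventually_le_ncone[OF r ddC] by eventually_elim (use ge in \<open>auto intro: antisym\<close>)
  moreover have "eventually (\<lambda>t. \<forall>i\<in>UNIV. \<forall>j\<in>UNIV. x $ j < x $ i \<longrightarrow> (x + t *\<^sub>R dd) $ j < (x + t *\<^sub>R dd) $ i) (at_right 0)"
  proof (intro eventually_ball_finite ballI finite)
    fix i j
    show "eventually (\<lambda>t. x $ j < x $ i \<longrightarrow> (x + t *\<^sub>R dd) $ j < (x + t *\<^sub>R dd) $ i) (at_right 0)"
    proof (cases "x $ j < x $ i")
      case True
      have "((\<lambda>t. (x + t *\<^sub>R dd) $ i - (x + t *\<^sub>R dd) $ j) \<longlongrightarrow> (x + 0 *\<^sub>R dd) $ i - (x + 0 *\<^sub>R dd) $ j) (at_right 0)"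
        by (intro tendsto_intros tendsto_vec_nth)
      then have "eventually (\<lambda>t. 0 < (x + t *\<^sub>R dd) $ i - (x + t *\<^sub>R dd) $ j) (at_right 0)"
        by (rule order_tendstoD) (use True in simp)
      then show ?thesis by eventually_elim simp
    qed simp
  qed
  ultimately have "eventually (\<lambda>t. \<theta> (x + t *\<^sub>R dd) = ereal (r + t * (y \<bullet> dd)) \<and>
      (\<forall>i\<in>UNIV. \<forall>j\<in>UNIV. x $ j < x $ i \<longrightarrow> (x + t *\<^sub>R dd) $ j < (x + t *\<^sub>R dd) $ i)) (at_right 0)"
    by (rule eventually_conj)
  then obtain \<delta> where \<delta>: "\<delta> > 0"
    and val: "\<And>t. 0 < t \<Longrightarrow> t < \<delta> \<Longrightarrow> \<theta> (x + t *\<^sub>R dd) = ereal (r + t * (y \<bullet> dd))"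
    and gt: "\<And>t i j. 0 < t \<Longrightarrow> t < \<delta> \<Longrightarrow> x $ j < x $ i \<Longrightarrow> (x + t *\<^sub>R dd) $ j < (x + t *\<^sub>R dd) $ i"
    unfolding eventually_at_right_field by blast
  \<comment> \<open>All \<open>t k\<close> are at most \<open>\<delta> / 2\<close>, which leaves
    \<open>3 * \<delta> / 4\<close> as the farther point required by
    \<open>ncone_interior_direction\<close>.\<close>
  define t where "t k = (\<delta> / 2) * inverse (real (Suc k))" for k
  have t: "0 < t k" "t k < 3 * \<delta> / 4" "t k < \<delta>" for k
  proof -
    have "inverse (real (Suc k)) \<le> 1" "0 < inverse (real (Suc k))" by (simp_all add: inverse_le_1_iff)
    then have "t k \<le> (\<delta> / 2) * 1" "0 < t k" unfolding t_def using \<delta> by (intro mult_left_mono mult_pos_pos; simp)+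
    then show "0 < t k" "t k < 3 * \<delta> / 4" "t k < \<delta>" using \<delta> by auto
  qed
  have "t \<longlonglongrightarrow> (\<delta> / 2) * 0" unfolding t_def by (intro tendsto_intros LIMSEQ_inverse_real_of_nat)
  then have t0: "t \<longlonglongrightarrow> 0" by simp
  define xs where "xs k = x + t k *\<^sub>R dd" for k
  define Xs where "Xs k = rot (transpose P) (Diag (xs k))" for k
  have sub_k: "y \<in> subdiff UNIV \<theta> (xs k)" for k
    unfolding xs_def using val[OF t(1,3)] by (intro subdiff_shift[of y \<theta> x r, OF sub r]) simp
  have ord: "0 \<le> (y $ i - y $ j) * (xs k $ i - xs k $ j)" for k i j
    using subdiff_ordered[OF sub_k] .
  have gt_k: "xs k $ j < xs k $ i" if "x $ j < x $ i" for k i j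
    unfolding xs_def by (rule gt[OF t(1,3) that])
  \<comment> \<open>\<open>P\<close> diagonalizes the perturbed matrix in the sense of
    \<open>orth_diag\<close> only if \<open>xs k\<close> is sorted. Strict gaps of \<open>x\<close>
    persist, ties with different \<open>y\<close> follow the order of the subgradient
    \<open>y\<close>, and full ties remain by the symmetry of \<open>dd\<close>.\<close>
  have "xs k $ j \<le> xs k $ i" if "i \<le> j" for k i j
  proof (cases "x $ j < x $ i")
    case True
    then show ?thesis using gt_k less_imp_le by blast
  next
    case False
    then have x: "x $ i = x $ j" using sx that by (auto simp: sorted_vec_def intro: antisym)
    show ?thesis
    proof (cases "y $ i = y $ j")
      case True
      then show ?thesis using dd[OF x] x by (simp add: xs_def)
    next
      case False
      then have "y $ j < y $ i" using sy that by (auto simp: sorted_vec_def order_less_le)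
      then show ?thesis using ord[of i j k] by (simp add: zero_le_mult_iff)
    qed
  qed
  then have sorted_k: "sorted_vec (xs k)" for k by (simp add: sorted_vec_def)
  have PXs: "rot P (Xs k) = Diag (xs k)" for k using PX(1) by (simp add: Xs_def)
  have eig: "eigvals (Xs k) = xs k" and P_k: "P \<in> orth_diag (Xs k)" for k
    using orth_diagI[OF PX(1) PXs sorted_k] by auto
  have XYs: "(Xs k, Y) \<in> gph_subdiff SymMat g" for k
    using rot_subdiff[OF sub_k PX(1) PXs] PY(3) by (simp add: gph_subdiff_def)
  have cone: "ncone \<theta> (xs k) y = W" for k
    unfolding xs_def W_def
  proof (rule ncone_interior_direction[OF r e(1) e(2)[unfolded W_def] t(1,2)])
    show "\<theta> (x + t k *\<^sub>R dd) = ereal (r + t k * (y \<bullet> dd))" by (rule val[OF t(1,3)])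
    show "\<theta> (x + (3 * \<delta> / 4) *\<^sub>R dd) = ereal (r + (3 * \<delta> / 4) * (y \<bullet> dd))" using \<delta> by (intro val) auto
  qed
  have form: "subderiv2 SymMat g (Xs k) Y H = ereal (ups (xs k) y (rot P H)) + indic (model_space P (xs k) y W) H"
    if "H \<in> SymMat" for H k
    using subderiv2_formula[OF XYs P_k P(2) _ that] W by (simp add: eig cone flip: y_def)
  let ?q = "\<lambda>H. ereal (ups x y (rot P H)) + indic (model_space P x y W) H"
  have "gqf SymMat ?q" by (rule gqf_model[OF PX(1) W])
  moreover have "gqf SymMat (subderiv2 SymMat g (Xs k) Y)" for k
  proof -
    have "gqf SymMat (subderiv2 SymMat g (Xs k) Y) \<longleftrightarrow>
        gqf SymMat (\<lambda>H. ereal (ups (xs k) y (rot P H)) + indic (model_space P (xs k) y W) H)"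
      by (rule gqf_cong[OF form])
    then show ?thesis using gqf_model[OF PX(1) W] by (rule iffD2)
  qed
  moreover have "epi_converges SymMat (\<lambda>k. subderiv2 SymMat g (Xs k) Y) ?q"
  proof -
    have "epi_converges SymMat (\<lambda>k H. ereal (ups (xs k) y (rot P H)) + indic (model_space P (xs k) y W) H) ?q"
      unfolding xs_def
    proof (rule epi_converges_model[OF W t0 t(1) _ dd])
      show "(x + t k *\<^sub>R dd) $ i \<noteq> (x + t k *\<^sub>R dd) $ j" if "x $ i \<noteq> x $ j" for k i j
        using gt_k[of i j k] gt_k[of j i k] that unfolding xs_def by (metis less_irrefl neqE)
      show "0 \<le> (y $ i - y $ j) * ((x + t k *\<^sub>R dd) $ i - (x + t k *\<^sub>R dd) $ j)" for k i j
        using ord unfolding xs_def .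
    qed
    moreover have "epi SymMat (subderiv2 SymMat g (Xs k) Y) =
        epi SymMat (\<lambda>H. ereal (ups (xs k) y (rot P H)) + indic (model_space P (xs k) y W) H)" for k
      by (rule epi_cong[OF form])
    ultimately show ?thesis by (simp add: epi_converges_def)
  qed
  moreover have "(\<lambda>k. (Xs k, Y)) \<longlonglongrightarrow> (X, Y)"
  proof -
    have "(\<lambda>k. x + t k *\<^sub>R dd) \<longlonglongrightarrow> x + 0 *\<^sub>R dd" by (intro tendsto_intros t0)
    then have "xs \<longlonglongrightarrow> x" by (simp add: xs_def[abs_def])
    then have "Xs \<longlonglongrightarrow> rot (transpose P) (Diag x)"
      unfolding Xs_def by (intro tendsto_rot_right tendsto_Diag)
    then show ?thesis using PX(3) by (intro tendsto_Pair tendsto_const) simp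
  qed
  ultimately have "?q \<in> quad SymMat g X Y"
    unfolding quad_def using XYs
    by (intro CollectI conjI) (assumption, rule exI[of _ Xs], rule exI[of _ "\<lambda>_. Y"], simp)
  then show ?thesis by (simp add: x_def y_def W_def)
qed

text \<open>With constant active sets every \<open>ys l\<close> is a subgradient at every
  \<open>xs k\<close>, and hence so is the limit \<open>y\<close>. So \<open>\<theta>\<close>
  attains the minorant of slope \<open>y\<close> at \<open>x\<close> and at \<open>xs k\<close>: the
  displacement \<open>xs k - x\<close> lies in the cone at \<open>x\<close>, and
  \<open>ncone_of_translate\<close> carries the cones at \<open>xs k\<close> into
  \<open>W\<close>.\<close>

lemma sequence_limit_model:
  assumes XY: "(X, Y) \<in> gph_subdiff SymMat g" and XYs: "\<And>k. (Xs k, Ys k) \<in> gph_subdiff SymMat g"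
    and lim: "Xs \<longlonglongrightarrow> X" "Ys \<longlonglongrightarrow> Y" "Ps \<longlonglongrightarrow> P" "Hs \<longlonglongrightarrow> H" "rs \<longlonglongrightarrow> \<rho>"
    and Ps: "\<And>k. Ps k \<in> orth_diag (Xs k)" "\<And>k. Ps k \<in> orth_diag (Ys k)"
    and Hs: "\<And>k. Hs k \<in> SymMat"
    and normal: "\<And>k M. M \<in> subdiff SymMat g (Xs k) \<Longrightarrow> M \<bullet> Hs k = Ys k \<bullet> Hs k"
    and le: "\<And>k. ups (eigvals (Xs k)) (eigvals (Ys k)) (rot (Ps k) (Hs k)) \<le> rs k"
    and act: "\<And>k l. iota1 a c p (eigvals (Xs k)) = iota1 a c p (eigvals (Xs l))"
      "\<And>k l. iota2 b d m (eigvals (Xs k)) = iota2 b d m (eigvals (Xs l))"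
    and pat: "\<And>k l i j. eigvals (Xs k) $ i = eigvals (Xs k) $ j \<Longrightarrow> eigvals (Xs l) $ i = eigvals (Xs l) $ j"
  shows "P \<in> orth_diag X" "P \<in> orth_diag Y" "ups (eigvals X) (eigvals Y) (rot P H) \<le> \<rho>"
    "H \<in> model_space P (eigvals X) (eigvals Y) (span (ncone \<theta> (eigvals X) (eigvals Y)))"
proof -
  define x y where "x = eigvals X" and "y = eigvals Y"
  define xs ys where "xs k = eigvals (Xs k)" and "ys k = eigvals (Ys k)" for k
  define W where "W = span (ncone \<theta> x y)"
  have W: "subspace W" by (simp add: W_def)
  have S: "Xs k \<in> SymMat" "Ys k \<in> SymMat" for k using XYs[of k] by (auto simp: gph_subdiff_def subdiff_def)
  show P: "P \<in> orth_diag X" "P \<in> orth_diag Y"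
    using orth_diag_limit(1)[OF lim(1,3) Ps(1) S(1)] orth_diag_limit(1)[OF lim(2,3) Ps(2) S(2)] by auto
  have xs: "xs \<longlonglongrightarrow> x" and ys: "ys \<longlonglongrightarrow> y"
    using orth_diag_limit(2)[OF lim(1,3) Ps(1) S(1)] orth_diag_limit(2)[OF lim(2,3) Ps(2) S(2)]
    by (simp_all add: xs_def[abs_def] ys_def[abs_def] x_def y_def)
  have sub_k: "ys k \<in> subdiff UNIV \<theta> (xs k)" for k
    using gph_eigvals[OF XYs Ps] by (simp add: xs_def ys_def)
  have sub: "y \<in> subdiff UNIV \<theta> x" using gph_eigvals[OF XY P] by (simp add: x_def y_def)
  obtain r where r: "\<theta> x = ereal r" using subdiff_finite[OF sub] by blast
  have y_sub: "y \<in> subdiff UNIV \<theta> (xs k)" for k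
  proof (rule subdiff_closed_sequentially[OF ys])
    fix l
    obtain u v where "\<theta> (xs k) = ereal u" "\<theta> (xs l) = ereal v" using subdiff_finite[OF sub_k] by blast
    then show "ys l \<in> subdiff UNIV \<theta> (xs k)"
      using act by (intro subdiff_eq_of_active[OF _ _ _ _ sub_k]) (auto simp: xs_def)
  qed
  have val: "\<theta> (x + (xs k - x)) = ereal (r + y \<bullet> (xs k - x))" for k
  proof (rule antisym)
    obtain u where u: "\<theta> (xs k) = ereal u" using subdiff_finite[OF sub_k] by blast
    then have "u + y \<bullet> (x - xs k) \<le> r" using subdiffD[OF y_sub[of k], of x] r by simp
    then show "\<theta> (x + (xs k - x)) \<le> ereal (r + y \<bullet> (xs k - x))" using u by (simp add: inner_diff_right)
    show "ereal (r + y \<bullet> (xs k - x)) \<le> \<theta> (x + (xs k - x))" using subdiffD[OF sub, of "xs k"] r by simp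
  qed
  have shift: "xs k - x \<in> ncone \<theta> x y" for k
    using ncone_of_le[of \<theta> x r "xs k - x" y] r val[of k] by simp
  \<comment> \<open>The lineality space of the cone at \<open>xs k\<close>, with equality because
    the hypothesis \<open>normal\<close> is an equality.\<close>
  define lin where "lin k = {w. \<forall>s\<in>subdiff UNIV \<theta> (xs k). s \<bullet> w = ys k \<bullet> w}" for k
  have lin: "subspace (lin k)" for k
    by (rule subspaceI) (auto simp: lin_def inner_add_right)
  have lin_W: "lin k \<subseteq> W" for k
  proof
    fix w assume w: "w \<in> lin k"
    show "w \<in> W" unfolding W_def
    proof (rule ncone_of_translate[OF r val[of k] span_base[OF shift]])
      fix s assume "s \<in> subdiff UNIV \<theta> (x + (xs k - x))"
      then show "s \<bullet> w \<le> y \<bullet> w" using w y_sub[of k] by (simp add: lin_def)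
    qed
  qed
  have mem: "Hs k \<in> model_space (Ps k) (xs k) (ys k) W" for k
  proof -
    have neg: "rot Q (- M) = - rot Q M" for Q M :: "'n rmat" using rot_scaleR[of Q "-1" M] by simp
    have dneg: "diagv (- M) = - diagv M" for M :: "'n rmat" by (simp add: vec_eq_iff)
    \<comment> \<open>\<open>normal_direction\<close> yields cone membership only; using it for
      \<open>- Hs k\<close> as well upgrades it to the lineality space.\<close>
    have Hneg: "- Hs k \<in> SymMat" using subspace_neg[OF subspace_SymMat Hs] .
    note dir = normal_direction[OF XYs Ps, folded xs_def ys_def]
    have "Hs k \<in> model_space (Ps k) (xs k) (ys k) (lin k)"
    proof (rule model_spaceI[OF Hs lin])
      fix R :: "'n rmat" assume R: "orthogonal_matrix R" "blk (\<lambda>i j. xs k $ i = xs k $ j \<and> ys k $ i = ys k $ j) R"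
      have "diagv (rot R (rot (Ps k) (Hs k))) \<in> ncone \<theta> (xs k) (ys k)"
        using normal by (intro dir(1)[OF Hs _ R]) simp
      moreover have "diagv (rot R (rot (Ps k) (- Hs k))) \<in> ncone \<theta> (xs k) (ys k)"
        using normal by (intro dir(1)[OF Hneg _ R]) simp
      ultimately show "diagv (rot R (rot (Ps k) (Hs k))) \<in> lin k"
        by (auto simp: ncone_def lin_def neg dneg intro: antisym)
    next
      fix i j assume "xs k $ i = xs k $ j" "ys k $ i \<noteq> ys k $ j"
      then show "rot (Ps k) (Hs k) $ i $ j = 0" using normal by (intro dir(2)[OF Hs]) simp
    qed
    then show ?thesis using model_space_mono[OF lin_W] by blast
  qed
  have Ns: "(\<lambda>k. rot (Ps k) (Hs k)) \<longlonglongrightarrow> rot P H" by (rule tendsto_rot[OF lim(3,4)])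
  have ord: "0 \<le> (ys k $ i - ys k $ j) * (xs k $ i - xs k $ j)" for k i j
    using subdiff_ordered[OF sub_k] .
  note limits = ups_limit[OF xs ys Ns lim(5) le[folded xs_def ys_def] ord]
  show "ups (eigvals X) (eigvals Y) (rot P H) \<le> \<rho>" using limits(1) by (simp add: x_def y_def)
  have "H \<in> SymMat" using closed_sequentially[OF closed_SymMat _ lim(4)] Hs by blast
  moreover have "diagv (rot P H) \<in> W"
    using closed_sequentially[OF closed_subspace[OF W] _ tendsto_diagv[OF Ns]] model_spaceD(2)[OF mem] by blast
  moreover have "y $ i = y $ j \<and> axis i 1 - axis j 1 \<in> W"
    if ij: "i \<noteq> j" "x $ i = x $ j" "rot P H $ i $ j \<noteq> 0" for i j
  proof (cases "xs 0 $ i = xs 0 $ j")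
    case True
    then have eq: "xs k $ i = xs k $ j" for k using pat unfolding xs_def by blast
    have "(\<lambda>k. rot (Ps k) (Hs k) $ i $ j) \<longlonglongrightarrow> rot P H $ i $ j" by (intro tendsto_vec_nth Ns)
    then have "eventually (\<lambda>k. rot (Ps k) (Hs k) $ i $ j \<noteq> 0) sequentially"
      using ij(3) by (rule tendsto_imp_eventually_ne)
    then have ev: "eventually (\<lambda>k. ys k $ i = ys k $ j \<and> axis i 1 - axis j 1 \<in> W) sequentially"
      by eventually_elim (rule model_spaceD(3)[OF mem ij(1) eq])
    then have "axis i 1 - axis j 1 \<in> W" using eventually_happens'[OF sequentially_bot] by blast
    moreover have "eventually (\<lambda>k. ys k $ i = ys k $ j) sequentially" using ev by eventually_elim simp
    with tendsto_vec_nth[OF ys] have "(\<lambda>k. ys k $ j) \<longlonglongrightarrow> y $ i" by (rule Lim_transform_eventually)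
    then have "y $ i = y $ j" using tendsto_vec_nth[OF ys] by (rule LIMSEQ_unique)
    ultimately show ?thesis by blast
  next
    case False
    then have ne: "xs k $ i \<noteq> xs k $ j" for k using pat unfolding xs_def by blast
    then have y: "y $ i = y $ j" using limits(2)[OF ij(2)] ij(3) by blast
    \<comment> \<open>The pair is tied in \<open>x\<close> and \<open>y\<close> but separated along
      the sequence. Both the displacement and its transposed copy lie in the cone, and their
      difference is a nonzero multiple of \<open>axis i 1 - axis j 1\<close>.\<close>
    define v where "v = xs 0 - x"
    define \<tau> where "\<tau> = Transposition.transpose i j"
    have \<tau>: "\<tau> permutes UNIV" unfolding \<tau>_def by (rule permutes_swap_id) auto
    have "x $ \<tau> k = x $ k" "y $ \<tau> k = y $ k" for k
      using ij(2) y by (simp_all add: \<tau>_def Transposition.transpose_def)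
    then have "(\<chi> k. v $ \<tau> k) \<in> ncone \<theta> x y"
      by (intro ncone_permute[OF shift[of 0, folded v_def] \<tau>])
    then have "v - (\<chi> k. v $ \<tau> k) \<in> W"
      unfolding W_def using shift[of 0] by (intro span_diff span_base) (auto simp: v_def)
    also have "v - (\<chi> k. v $ \<tau> k) = (v $ i - v $ j) *\<^sub>R (axis i 1 - axis j 1)"
      using ij(1) by (auto simp: vec_eq_iff \<tau>_def Transposition.transpose_def axis_nth_if)
    finally have "(1 / (v $ i - v $ j)) *\<^sub>R ((v $ i - v $ j) *\<^sub>R (axis i 1 - axis j 1)) \<in> W"
      by (rule subspace_scale[OF W])
    moreover have "v $ i - v $ j \<noteq> 0" using ne[of 0] ij(2) by (simp add: v_def)
    ultimately show ?thesis using y by simp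
  qed
  ultimately show "H \<in> model_space P (eigvals X) (eigvals Y) (span (ncone \<theta> (eigvals X) (eigvals Y)))"
    by (auto simp: model_space_def x_def y_def W_def)
qed

text \<open>A finite value \<open>q H\<close> has a recovery sequence in the epigraphs. Compactness
  makes the eigenbases converge and the pigeonhole principle freezes the combinatorial data, so that
  \<open>sequence_limit_model\<close> applies.\<close>

lemma quad_lower_bound:
  assumes XY: "(X, Y) \<in> gph_subdiff SymMat g" and P: "P \<in> orth_diag X" "P \<in> orth_diag Y"
    and q: "q \<in> quad SymMat g X Y" and H: "H \<in> SymMat"
  shows "ereal (ups (eigvals X) (eigvals Y) (rot P H)) + indic (affine hull (crit_cone SymMat g X Y)) H \<le> q H"
proof (cases "q H = \<infinity>")
  case False
  from q obtain Xs Ys where XYs: "\<And>k. (Xs k, Ys k) \<in> gph_subdiff SymMat g"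
    and lim: "(\<lambda>k. (Xs k, Ys k)) \<longlonglongrightarrow> (X, Y)"
    and gqf: "\<And>k. gqf SymMat (subderiv2 SymMat g (Xs k) (Ys k))"
    and conv: "epi_converges SymMat (\<lambda>k. subderiv2 SymMat g (Xs k) (Ys k)) q"
    and gq: "gqf SymMat q"
    unfolding quad_def by blast
  have "q H \<noteq> - \<infinity>" using gq H by (auto simp: gqf_def proper_on_def)
  then obtain \<rho> where \<rho>: "q H = ereal \<rho>" using False by (cases "q H") auto
  then have "(H, \<rho>) \<in> epi SymMat q" using H by (simp add: epi_def)
  then have "(H, \<rho>) \<in> inner_limit (\<lambda>k. epi SymMat (subderiv2 SymMat g (Xs k) (Ys k)))"
    using conv by (simp add: epi_converges_def pk_converges_def)
  then obtain s where s: "s \<longlonglongrightarrow> (H, \<rho>)"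
    and "eventually (\<lambda>k. s k \<in> epi SymMat (subderiv2 SymMat g (Xs k) (Ys k))) sequentially"
    unfolding inner_limit_def by blast
  then obtain K where K: "\<And>k. k \<ge> K \<Longrightarrow> s k \<in> epi SymMat (subderiv2 SymMat g (Xs k) (Ys k))"
    by (auto simp: eventually_sequentially)
  \<comment> \<open>\<open>P\<close> need not diagonalize the nearby pairs. Their own bases
    converge, after extraction, to some \<open>P'\<close> possibly different from \<open>P\<close>;
    \<open>ups_orth_diag_indep\<close> returns to \<open>P\<close> at the end.\<close>
  have "\<exists>Q. Q \<in> orth_diag (Xs k) \<and> Q \<in> orth_diag (Ys k)" for k
    using gph_orth_diag[OF XYs[of k]] by metis
  then obtain Q where Q: "\<And>k. Q k \<in> orth_diag (Xs k)" "\<And>k. Q k \<in> orth_diag (Ys k)" by metis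
  have "\<forall>k. Q (k + K) \<in> {Q. orthogonal_matrix Q \<and> blk (\<lambda>_ _. True) Q}"
    using orth_diagD(1)[OF Q(1)] by (simp add: blk_def)
  then obtain P' \<phi> where \<phi>: "strict_mono \<phi>" and P': "((\<lambda>k. Q (k + K)) \<circ> \<phi>) \<longlonglongrightarrow> P'"
    using seq_compactE[OF compact_orthogonal_blk[of "\<lambda>_ _. True", THEN compact_imp_seq_compact],
        of "\<lambda>k. Q (k + K)"] by blast
  \<comment> \<open>Active indices and ties of eigenvalues take finitely many values in total, so
    one pattern occurs infinitely often.\<close>
  define pattern where "pattern k = (iota1 a c p (eigvals (Xs (\<phi> k + K))), iota2 b d m (eigvals (Xs (\<phi> k + K))),
      {(i, j). eigvals (Xs (\<phi> k + K)) $ i = eigvals (Xs (\<phi> k + K)) $ j})" for k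
  have "finite (range pattern)"
  proof (rule finite_subset)
    show "range pattern \<subseteq> Pow {1..p} \<times> Pow {1..m} \<times> UNIV"
      by (auto simp: pattern_def iota1_def iota2_def)
  qed auto
  then obtain k0 where "infinite {k. pattern k = pattern k0}"
    using pigeonhole_infinite[of "UNIV :: nat set" pattern] by auto
  then obtain \<psi> :: "nat \<Rightarrow> nat" where \<psi>: "strict_mono \<psi>" "\<And>k. pattern (\<psi> k) = pattern k0"
    using infinite_enumerate[of "{k. pattern k = pattern k0}"] by auto
  define \<omega> where "\<omega> k = \<phi> (\<psi> k) + K" for k
  have \<omega>: "strict_mono \<omega>"
    unfolding strict_mono_def \<omega>_def using \<phi> \<psi>(1) by (simp add: strict_mono_less)
  have lim\<omega>: "(\<lambda>k. u (\<omega> k)) \<longlonglongrightarrow> l" if "u \<longlonglongrightarrow> l" for u :: "nat \<Rightarrow> 'z::topological_space" and l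
    using LIMSEQ_subseq_LIMSEQ[OF that \<omega>] by (simp add: o_def)
  define Hs rs where "Hs k = fst (s (\<omega> k))" and "rs k = snd (s (\<omega> k))" for k
  have Hs: "Hs k \<in> SymMat" and le: "subderiv2 SymMat g (Xs (\<omega> k)) (Ys (\<omega> k)) (Hs k) \<le> ereal (rs k)" for k
    using K[of "\<omega> k"] by (auto simp: Hs_def rs_def epi_def \<omega>_def)
  \<comment> \<open>The domain of a generalized quadratic form is a subspace, so both
    \<open>Hs k\<close> and \<open>- Hs k\<close> have finite value, and the two resulting
    inequalities give equality.\<close>
  have normal: "M \<bullet> Hs k = Ys (\<omega> k) \<bullet> Hs k" if M: "M \<in> subdiff SymMat g (Xs (\<omega> k))" for k M
  proof -
    let ?f = "subderiv2 SymMat g (Xs (\<omega> k)) (Ys (\<omega> k))"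
    have "?f (Hs k) < \<infinity>" using le[of k] by (rule order_le_less_trans) simp
    then have "Hs k \<in> edom SymMat ?f" using Hs by (simp add: edom_def)
    moreover have "subspace (edom SymMat ?f)" using gqf by (simp add: gqf_def)
    ultimately have "- Hs k \<in> edom SymMat ?f" by (simp add: subspace_neg)
    then have "?f (- Hs k) < \<infinity>" by (simp add: edom_def)
    from subderiv2_finite_imp_inner_le[OF subspace_SymMat M this]
      subderiv2_finite_imp_inner_le[OF subspace_SymMat M \<open>?f (Hs k) < \<infinity>\<close>]
    show ?thesis by simp
  qed
  have ups: "ups (eigvals (Xs (\<omega> k))) (eigvals (Ys (\<omega> k))) (rot (Q (\<omega> k)) (Hs k)) \<le> rs k" for k
    using order_trans[OF subderiv2_ge_ups[OF XYs Q Hs] le] by simp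
  have pat: "pattern (\<psi> k) = pattern (\<psi> l)" for k l by (simp add: \<psi>(2))
  have limits: "(\<lambda>k. Xs (\<omega> k)) \<longlonglongrightarrow> X" "(\<lambda>k. Ys (\<omega> k)) \<longlonglongrightarrow> Y" "(\<lambda>k. Q (\<omega> k)) \<longlonglongrightarrow> P'" "Hs \<longlonglongrightarrow> H" "rs \<longlonglongrightarrow> \<rho>"
  proof -
    show "(\<lambda>k. Xs (\<omega> k)) \<longlonglongrightarrow> X" "(\<lambda>k. Ys (\<omega> k)) \<longlonglongrightarrow> Y"
      using tendsto_fst[OF lim] tendsto_snd[OF lim] by (auto intro: lim\<omega>)
    show "(\<lambda>k. Q (\<omega> k)) \<longlonglongrightarrow> P'"
      using LIMSEQ_subseq_LIMSEQ[OF P' \<psi>(1)] by (simp add: o_def \<omega>_def)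
    show "Hs \<longlonglongrightarrow> H" "rs \<longlonglongrightarrow> \<rho>"
      using tendsto_fst[OF lim\<omega>[OF s]] tendsto_snd[OF lim\<omega>[OF s]] by (simp_all add: Hs_def[abs_def] rs_def[abs_def])
  qed
  have act: "iota1 a c p (eigvals (Xs (\<omega> k))) = iota1 a c p (eigvals (Xs (\<omega> l)))"
    "iota2 b d m (eigvals (Xs (\<omega> k))) = iota2 b d m (eigvals (Xs (\<omega> l)))"
    "eigvals (Xs (\<omega> k)) $ i = eigvals (Xs (\<omega> k)) $ j \<Longrightarrow> eigvals (Xs (\<omega> l)) $ i = eigvals (Xs (\<omega> l)) $ j" for k l i j
    using pat[of k l] by (auto simp: pattern_def \<omega>_def)
  note res = sequence_limit_model[OF XY XYs limits Q Hs normal ups act]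
  have "H \<in> affine hull (crit_cone SymMat g X Y)"
    using res(4) affine_hull_crit_cone[OF XY res(1,2)] by simp
  moreover have "ups (eigvals X) (eigvals Y) (rot P H) \<le> \<rho>"
    using res(3) ups_orth_diag_indep[OF P res(1,2)] by simp
  ultimately show ?thesis by (simp add: \<rho> indic_def)
qed simp

end

text \<open>Group the index pairs with \<open>x $ j < x $ i\<close> by their eigenvalues. Symmetry
  of \<open>H\<close> makes the terms symmetric in \<open>i\<close> and \<open>j\<close>, which
  accounts for the factor 2; tied pairs contribute zero.\<close>

lemma Upsilon_eq_ups:
  assumes H: "H \<in> SymMat"
  shows "Upsilon P X Y H = ups (eigvals X) (eigvals Y) (rot P H)"
proof -
  define x y N where "x = eigvals X" and "y = eigvals Y" and "N = rot P H"
  define F where "F i j = (y $ i - y $ j) / (x $ i - x $ j) * (N $ i $ j)\<^sup>2" for i j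
  define T where "T = {(i, j). x $ j < x $ i}"
  define M where "M = {(\<mu>, \<mu>'). \<mu> \<in> distinct_eigvals X \<and> \<mu>' \<in> distinct_eigvals X \<and> \<mu>' < \<mu>}"
  have F_sym: "F j i = F i j" for i j
  proof -
    have "N $ j $ i = N $ i $ j" using H by (simp add: N_def SymMat_nth)
    moreover have "(y $ j - y $ i) / (x $ j - x $ i) = (y $ i - y $ j) / (x $ i - x $ j)"
      by (metis minus_diff_eq minus_divide_divide)
    ultimately show ?thesis by (simp add: F_def)
  qed
  have "distinct_eigvals X = range (($) x)" by (auto simp: distinct_eigvals_def x_def)
  then have fin: "finite (distinct_eigvals X)" by simp
  have "finite M" by (rule finite_subset[OF _ finite_cartesian_product[OF fin fin]]) (auto simp: M_def)
  moreover have "(\<lambda>(i, j). (x $ i, x $ j)) ` T \<subseteq> M"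
    by (auto simp: T_def M_def distinct_eigvals_def x_def)
  ultimately have "(\<Sum>z\<in>M. sum (\<lambda>(i, j). F i j) {w \<in> T. (\<lambda>(i, j). (x $ i, x $ j)) w = z}) = sum (\<lambda>(i, j). F i j) T"
    by (intro sum.group) auto
  moreover have "(\<Sum>i\<in>eig_block X \<mu>. \<Sum>j\<in>eig_block X \<mu>'. F i j) =
      sum (\<lambda>(i, j). F i j) {w \<in> T. (\<lambda>(i, j). (x $ i, x $ j)) w = (\<mu>, \<mu>')}" if "(\<mu>, \<mu>') \<in> M" for \<mu> \<mu>'
  proof -
    have "{w \<in> T. (\<lambda>(i, j). (x $ i, x $ j)) w = (\<mu>, \<mu>')} = eig_block X \<mu> \<times> eig_block X \<mu>'"
      using that by (auto simp: T_def M_def eig_block_def x_def)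
    then show ?thesis by (simp add: sum.cartesian_product)
  qed
  then have "(\<Sum>(\<mu>, \<mu>')\<in>M. \<Sum>i\<in>eig_block X \<mu>. \<Sum>j\<in>eig_block X \<mu>'. F i j) =
      (\<Sum>z\<in>M. sum (\<lambda>(i, j). F i j) {w \<in> T. (\<lambda>(i, j). (x $ i, x $ j)) w = z})"
    by (intro sum.cong refl) (auto simp only: split: prod.split)
  ultimately have "(\<Sum>(\<mu>, \<mu>')\<in>M. \<Sum>i\<in>eig_block X \<mu>. \<Sum>j\<in>eig_block X \<mu>'. F i j) = sum (\<lambda>(i, j). F i j) T"
    by simp
  then have "Upsilon P X Y H = 2 * sum (\<lambda>(i, j). F i j) T"
    by (simp add: Upsilon_def M_def F_def x_def y_def N_def rot_def)
  also have "\<dots> = ups x y N"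
  proof -
    have "sum (\<lambda>(i, j). F i j) T = sum (\<lambda>(i, j). F i j) {(i, j). x $ i < x $ j}"
      by (rule sum.reindex_bij_witness[of _ prod.swap prod.swap]) (auto simp: T_def F_sym)
    moreover have "ups x y N = sum (\<lambda>(i, j). F i j) (T \<union> {(i, j). x $ i < x $ j})"
    proof -
      have "ups x y N = sum (\<lambda>(i, j). F i j) UNIV"
        by (simp add: ups_def F_def sum.cartesian_product)
      also have "\<dots> = sum (\<lambda>(i, j). F i j) (T \<union> {(i, j). x $ i < x $ j})"
        by (rule sum.mono_neutral_right) (auto simp: T_def F_def)
      finally show ?thesis .
    qed
    moreover have "T \<inter> {(i, j). x $ i < x $ j} = {}" by (auto simp: T_def)
    ultimately show ?thesis by (simp add: sum.union_disjoint)
  qed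
  finally show ?thesis by (simp add: x_def y_def N_def)
qed

theorem theorem4p15:
  fixes \<theta> :: "('n::{finite,linorder}) rvec \<Rightarrow> ereal"
    and g :: "'n rmat \<Rightarrow> ereal"
    and a b :: "nat \<Rightarrow> 'n rvec"
    and c d :: "nat \<Rightarrow> real"
    and p m :: nat
    and X Y P :: "'n rmat"
  assumes "proper_on UNIV \<theta>"
    and "symmetric_fun \<theta>"
    and "polyhedral_fun \<theta>"
    and "represents \<theta> a c p b d m"
    and "g = \<theta> \<circ> eigvals"
    and "(X, Y) \<in> gph_subdiff SymMat g"
    and "P \<in> orth_diag X \<inter> orth_diag Y"
    and "K_set a c p b d m X Y \<noteq> {}"
  shows "(\<lambda>H. ereal (Upsilon P X Y H) + indic (affine hull (crit_cone SymMat g X Y)) H)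
           \<in> quad SymMat g X Y \<and>
         (\<forall>q \<in> quad SymMat g X Y. \<forall>H \<in> SymMat.
           ereal (Upsilon P X Y H) + indic (affine hull (crit_cone SymMat g X Y)) H \<le> q H)"
proof -
  interpret symmetric_polyhedral \<theta> a c p b d m
    using assms(2,4) by unfold_locales
  note g = \<open>g = \<theta> \<circ> eigvals\<close>
  have XY: "(X, Y) \<in> gph_subdiff SymMat (\<theta> \<circ> eigvals)" using assms(5,6) by simp
  have P: "P \<in> orth_diag X" "P \<in> orth_diag Y" using assms(7) by auto
  let ?q = "\<lambda>H. ereal (Upsilon P X Y H) + indic (affine hull (crit_cone SymMat g X Y)) H"
  let ?q' = "\<lambda>H. ereal (ups (eigvals X) (eigvals Y) (rot P H)) +
      indic (model_space P (eigvals X) (eigvals Y) (span (ncone \<theta> (eigvals X) (eigvals Y)))) H"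
  have eq: "?q H = ?q' H" if "H \<in> SymMat" for H
    using affine_hull_crit_cone[OF XY P] by (simp add: Upsilon_eq_ups[OF that] g)
  have "?q' \<in> quad SymMat g X Y" using model_mem_quad[OF XY P] by (simp add: g)
  with quad_cong[of SymMat ?q ?q', OF eq] have "?q \<in> quad SymMat g X Y" by (rule iffD2)
  then show ?thesis
    using quad_lower_bound[OF XY P] by (simp add: Upsilon_eq_ups g)
qed

end
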